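(* Let $K$ be a Zacharias ring (e.g. a Euclidean ring), let $I\subset K[x_1,\dots,x_n]$ be a prime ideal in a polynomial ring with $K\cap I=\{0\}$, let $R:=K[x_1,\dots,x_n]/I$, and let $G$ be a finite group of ($K$-algebra) automorphisms of $R$. Consider the following procedure. (1) With $a_i:=x_i+I\in R$ and $L:=\operatorname{Quot}(R)$, compute a reduced Gr\"obner basis $\mathcal G$ of the Derksen ideal $D_{a_1,\dots,a_n}\subseteq L[y_1,\dots,y_n]$. (2) Choose a nonzero invariant $a\in R^G$ such that $a^k\cdot\mathcal G\subseteq R[y_1,\dots,y_n]$ holds for some $k$. (3) Let $S$ be the set whose elements are the coefficients of all polynomials in $\mathcal G$. Change $S$ by multiplying each element by a suitable power of $a$ to obtain an element from $R$. Let $B\subseteq R^G$ be the $K$-subalgebra generated by $a$ and $S$. (4) Apply the unlocalization procedure described in the context to $B$ and $a$. Then the procedure is guaranteed to terminate after finitely many steps, and its output is a finite set of generators of the invariant ring $R^G$ as a $K$-algebra.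
   Context: Rings are commutative with identity. A Zacharias ring is a Noetherian ring $K$ for which there is an algorithm for computing all solutions $(c_1,\dots,c_r)\in K^r$ of a linear equation $a_1c_1+\cdots+a_rc_r=b$ with $b,a_i\in K$; over such rings Gr\"obner bases, ideal membership tests and elimination ideals in polynomial rings can be computed. The $G$-action extends to $L=\operatorname{Quot}(R)$, and the Derksen ideal is $D_{a_1,\dots,a_n}:=\bigcap_{\sigma\in G}(y_1-\sigma\cdot a_1,\dots,y_n-\sigma\cdot a_n)\subseteq L[y_1,\dots,y_n]$. Unlocalization procedure. Input: the kernel $I_y$ of $K[y_1,\dots,y_n]\to R$, $y_i\mapsto a_i$; generators $\overline f_i=f_i(a_1,\dots,a_n)$ ($f_i\in K[y_1,\dots,y_n]$, $i=1,\dots,m$) of a subalgebra $B\subseteq R^G$; a nonzero $a\in B$ with $R^G[a^{-1}]=B[a^{-1}]$. Repeat: (i) optionally replace $\overline f_1,\dots,\overline f_m$ by a smaller set generating the same subalgebra; (ii) with new indeterminates $z_1,\dots,z_m$, let $\widehat L\subseteq K[y_1,\dots,y_n,z_1,\dots,z_m]$ be the ideal generated by $I_y$ and all $z_i-f_i$, choose $g\in K[z_1,\dots,z_m]$ with $g(\overline f_1,\dots,\overline f_m)=a$, and let $\widehat M$ be generated by $\widehat L$ and $g$; (iii) put $M:=K[z_1,\dots,z_m]\cap\widehat M$ and let $N$ be the ideal generated by $K[z_1,\dots,z_m]\cap\widehat L$ and $g$; (iv) if $M\subseteq N$, return $\overline f_1,\dots,\overline f_m$ and stop; (v) otherwise choose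 $h_1,\dots,h_r\in M$ that together with $N$ generate $M$, find (by Gr\"obner basis reduction modulo the ideal generated by $I_y$ and $g(f_1,\dots,f_m)$) polynomials $f_{m+i}\in K[y_1,\dots,y_n]$ with $a\cdot f_{m+i}(a_1,\dots,a_n)=h_i(\overline f_1,\dots,\overline f_m)$ for $i=1,\dots,r$, add $\overline f_{m+i}:=f_{m+i}(a_1,\dots,a_n)$ to the list, replace $m$ by $m+r$, and continue with (i). *)

theory Defs
  imports
    "HOL-Library.Poly_Mapping"
    "HOL-Computational_Algebra.Polynomial_Factorial"
    "HOL-Algebra.QuotRing"
    "HOL-Algebra.Ring_Divisibility"
    "HOL-Algebra.Generated_Rings"
    "HOL-Algebra.Bij"
    "HOL-Decision_Procs.Algebra_Aux"
begin

text \<open>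
  Multivariate polynomials are finitely supported maps from exponent vectors to coefficients,
  multiplied by convolution.  Variables are indexed by natural numbers starting from 0, so that
  \<open>K[y\<^sub>1,\<dots>,y\<^sub>n]\<close> is \<open>mpoly_ring {..<n}\<close>, and
  \<open>K[y\<^sub>1,\<dots>,y\<^sub>n,z\<^sub>1,\<dots>,z\<^sub>m]\<close> is \<open>mpoly_ring {..<n + m}\<close>
  with \<open>z\<^sub>1,\<dots>,z\<^sub>m\<close> the variables \<open>n,\<dots>,n+m-1\<close>.
\<close>

type_synonym monomial = "nat \<Rightarrow>\<^sub>0 nat"
type_synonym 'a mpoly = "monomial \<Rightarrow>\<^sub>0 'a"

definition mpoly_ring :: "nat set \<Rightarrow> ('a::comm_ring_1) mpoly ring" where
  "mpoly_ring V =
     \<lparr>carrier = {p. \<forall>t\<in>Poly_Mapping.keys p. Poly_Mapping.keys t \<subseteq> V}, mult = (*), one = 1, zero = 0, add = (+)\<rparr>"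

definition Const :: "'a::comm_ring_1 \<Rightarrow> 'a mpoly" where
  "Const c = Poly_Mapping.single 0 c"

definition Var :: "nat \<Rightarrow> ('a::comm_ring_1) mpoly" where
  "Var i = Poly_Mapping.single (Poly_Mapping.single i 1) 1"

definition mpoly_eval ::
    "('a::comm_ring_1 \<Rightarrow> 'b::comm_ring_1) \<Rightarrow> (nat \<Rightarrow> 'b) \<Rightarrow> 'a mpoly \<Rightarrow> 'b" where
  "mpoly_eval h v p = (\<Sum>t\<in>Poly_Mapping.keys p. h (Poly_Mapping.lookup p t) * (\<Prod>i\<in>Poly_Mapping.keys t. v i ^ Poly_Mapping.lookup t i))"


section \<open>Zacharias rings\<close>

definition linear_solutions :: "'k::comm_ring_1 list \<Rightarrow> 'k \<Rightarrow> 'k list set" where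
  "linear_solutions as b =
     {cs. length cs = length as \<and> (\<Sum>i<length as. as ! i * cs ! i) = b}"

text \<open>
  All solutions of a solvable linear equation are described by one solution together with a
  finite list of generators of the module of solutions of the homogeneous equation.
\<close>

definition solves_linear_equations ::
    "('k::comm_ring_1 list \<times> 'k \<Rightarrow> ('k list \<times> 'k list list) option) \<Rightarrow> bool" where
  "solves_linear_equations solve \<longleftrightarrow>
     (\<forall>as b. case solve (as, b) of
        None \<Rightarrow> linear_solutions as b = {}
      | Some (cs, ss) \<Rightarrow>
          length cs = length as \<and> (\<forall>s\<in>set ss. length s = length as) \<and>
          linear_solutions as b =
            {map (\<lambda>i. cs ! i + (\<Sum>j<length ss. d j * ss ! j ! i)) [0..<length as] | d. True})"

text \<open>
  HOL functions carry no computational content.  The predicate \<open>algorithmic\<close> stands for the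
  notion of algorithm in use (Turing computability with respect to some encoding of the
  ring, computability relative to the ring operations, ...), and is left arbitrary.
\<close>

definition zacharias_ring ::
    "(('k::comm_ring_1 list \<times> 'k \<Rightarrow> ('k list \<times> 'k list list) option) \<Rightarrow> bool) \<Rightarrow> bool" where
  "zacharias_ring algorithmic \<longleftrightarrow>
     noetherian_ring (cring_class_ops :: 'k ring) \<and>
     (\<exists>solve. algorithmic solve \<and> solves_linear_equations solve)"


section \<open>Reduced Groebner bases\<close>

definition monomial_order :: "nat \<Rightarrow> monomial rel \<Rightarrow> bool" where
  "monomial_order n ord \<longleftrightarrow>
     linear_order_on {t. Poly_Mapping.keys t \<subseteq> {..<n}} ord \<and>
     (\<forall>t. Poly_Mapping.keys t \<subseteq> {..<n} \<longrightarrow> (0, t) \<in> ord) \<and>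
     (\<forall>s t u. (s, t) \<in> ord \<and> Poly_Mapping.keys u \<subseteq> {..<n} \<longrightarrow> (s + u, t + u) \<in> ord)"

definition leading_monomial :: "monomial rel \<Rightarrow> ('a::zero) mpoly \<Rightarrow> monomial" where
  "leading_monomial ord p = (THE t. t \<in> Poly_Mapping.keys p \<and> (\<forall>s\<in>Poly_Mapping.keys p. (s, t) \<in> ord))"

definition leading_ideal ::
    "nat \<Rightarrow> monomial rel \<Rightarrow> ('a::comm_ring_1) mpoly set \<Rightarrow> 'a mpoly set" where
  "leading_ideal n ord F =
     Idl\<^bsub>mpoly_ring {..<n}\<^esub>
       ((\<lambda>f. Poly_Mapping.single (leading_monomial ord f) 1) ` (F - {0}))"

definition groebner_basis ::
    "nat \<Rightarrow> monomial rel \<Rightarrow> ('a::field) mpoly set \<Rightarrow> 'a mpoly set \<Rightarrow> bool" where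
  "groebner_basis n ord J Gb \<longleftrightarrow>
     finite Gb \<and> Gb \<subseteq> J \<and> leading_ideal n ord Gb = leading_ideal n ord J"

definition reduced_groebner_basis ::
    "nat \<Rightarrow> monomial rel \<Rightarrow> ('a::field) mpoly set \<Rightarrow> 'a mpoly set \<Rightarrow> bool" where
  "reduced_groebner_basis n ord J Gb \<longleftrightarrow>
     groebner_basis n ord J Gb \<and>
     (\<forall>g\<in>Gb. g \<noteq> 0 \<and> Poly_Mapping.lookup g (leading_monomial ord g) = 1 \<and>
       (\<forall>h\<in>Gb - {g}. \<forall>t\<in>Poly_Mapping.keys g. \<not> (\<exists>u. t = leading_monomial ord h + u)))"


section \<open>Invariants, subalgebras and localizations\<close>

text \<open>The \<open>K\<close>-algebra structure of \<open>R\<close> is given by the homomorphism \<open>\<iota> :: K \<Rightarrow> R\<close>.\<close>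

definition subalgebra_generated ::
    "('k::comm_ring_1 \<Rightarrow> 'r::comm_ring_1) \<Rightarrow> 'r set \<Rightarrow> 'r set" where
  "subalgebra_generated \<iota> S = generate_ring cring_class_ops (range \<iota> \<union> S)"

definition invariants :: "('r \<Rightarrow> 'r) set \<Rightarrow> 'r set" where
  "invariants G = {r. \<forall>\<sigma>\<in>G. \<sigma> r = r}"

definition localization_at :: "'r::idom set \<Rightarrow> 'r \<Rightarrow> 'r fract set" where
  "localization_at A a = {to_fract r / to_fract a ^ k | r k. r \<in> A}"

text \<open>
  The elements \<open>\<sigma> \<cdot> a\<^sub>i\<close> lie in \<open>R\<close>, so the extension of the action to the
  field of fractions is not needed here.
\<close>

definition derksen_ideal ::
    "nat \<Rightarrow> (nat \<Rightarrow> 'r::idom) \<Rightarrow> ('r \<Rightarrow> 'r) set \<Rightarrow> 'r fract mpoly set" where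
  "derksen_ideal n x G =
     (\<Inter>\<sigma>\<in>G. Idl\<^bsub>mpoly_ring {..<n}\<^esub> {Var i - Const (to_fract (\<sigma> (x i))) | i. i < n})"

definition coefficients :: "('a::zero) mpoly set \<Rightarrow> 'a set" where
  "coefficients F = (\<Union>f\<in>F. Poly_Mapping.lookup f ` Poly_Mapping.keys f)"

definition integral_mpolys :: "nat \<Rightarrow> ('r::idom) fract mpoly set" where
  "integral_mpolys n =
     {p \<in> carrier (mpoly_ring {..<n}). coefficients {p} \<subseteq> range to_fract}"


section \<open>Ideals occurring in the unlocalization procedure\<close>

context
  fixes n :: nat and \<iota> :: "'k::comm_ring_1 \<Rightarrow> 'r::idom" and x :: "nat \<Rightarrow> 'r"
begin

definition relation_ideal :: "'k mpoly set" where
  "relation_ideal = {p \<in> carrier (mpoly_ring {..<n}). mpoly_eval \<iota> x p = 0}"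

definition ideal_L_hat :: "'k mpoly list \<Rightarrow> 'k mpoly set" where
  "ideal_L_hat fs =
     Idl\<^bsub>mpoly_ring {..<n + length fs}\<^esub>
       (relation_ideal \<union> {Var (n + i) - fs ! i | i. i < length fs})"

definition ideal_M_hat :: "'k mpoly list \<Rightarrow> 'k mpoly \<Rightarrow> 'k mpoly set" where
  "ideal_M_hat fs g = Idl\<^bsub>mpoly_ring {..<n + length fs}\<^esub> (ideal_L_hat fs \<union> {g})"

definition z_ring :: "'k mpoly list \<Rightarrow> 'k mpoly ring" where
  "z_ring fs = mpoly_ring {n..<n + length fs}"

definition ideal_M :: "'k mpoly list \<Rightarrow> 'k mpoly \<Rightarrow> 'k mpoly set" where
  "ideal_M fs g = carrier (z_ring fs) \<inter> ideal_M_hat fs g"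

definition ideal_N :: "'k mpoly list \<Rightarrow> 'k mpoly \<Rightarrow> 'k mpoly set" where
  "ideal_N fs g = Idl\<^bsub>z_ring fs\<^esub> ((carrier (z_ring fs) \<inter> ideal_L_hat fs) \<union> {g})"

definition algebra_of :: "'k mpoly list \<Rightarrow> 'r set" where
  "algebra_of fs = subalgebra_generated \<iota> (mpoly_eval \<iota> x ` set fs)"

text \<open>Substitution of \<open>f\<^sub>i(a\<^sub>1,\<dots>,a\<^sub>n)\<close> for \<open>z\<^sub>i\<close>.\<close>

definition z_eval :: "'k mpoly list \<Rightarrow> 'k mpoly \<Rightarrow> 'r" where
  "z_eval fs h = mpoly_eval \<iota> (\<lambda>j. mpoly_eval \<iota> x (fs ! (j - n))) h"

end

definition unlocalization_input :: "('r \<Rightarrow> 'r) set \<Rightarrow> 'r::idom set \<Rightarrow> 'r \<Rightarrow> bool" where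
  "unlocalization_input G B a \<longleftrightarrow>
     B \<subseteq> invariants G \<and> a \<in> B \<and> a \<noteq> 0 \<and>
     localization_at (invariants G) a = localization_at B a"


section \<open>The procedure\<close>

text \<open>
  The procedure makes choices, so it is a transition relation between the following states.
  A generator of a subalgebra of \<open>R\<close> is recorded by a polynomial \<open>f \<in> K[y\<^sub>1,\<dots>,y\<^sub>n]\<close>
  representing it.
\<close>

context notes [[typedef_overloaded]] begin

datatype ('k::zero, 'r::idom) state =
    Start
  | Basis "'r fract mpoly set"
  | Denominator "'r fract mpoly set" 'r
  | Subalgebra "'r set" 'r
  | Unlocalize 'r "'k mpoly list"
  | Trimmed 'r "'k mpoly list"
  | Ideals 'r "'k mpoly list" "'k mpoly"
  | Enlarge 'r "'k mpoly list" "'k mpoly list"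
  | Return "'k mpoly list"

end

inductive step ::
    "nat \<Rightarrow> ('k::comm_ring_1 \<Rightarrow> 'r::idom) \<Rightarrow> (nat \<Rightarrow> 'r) \<Rightarrow> ('r \<Rightarrow> 'r) set \<Rightarrow> monomial rel \<Rightarrow>
     ('k, 'r) state \<Rightarrow> ('k, 'r) state \<Rightarrow> bool"
  for n \<iota> x G ord where
  groebner:
    "reduced_groebner_basis n ord (derksen_ideal n x G) Gb \<Longrightarrow>
     step n \<iota> x G ord Start (Basis Gb)"
| denominator:
    "\<lbrakk>a \<in> invariants G; a \<noteq> 0;
      \<exists>k. \<forall>g\<in>Gb. Const (to_fract a ^ k) * g \<in> integral_mpolys n\<rbrakk> \<Longrightarrow>
     step n \<iota> x G ord (Basis Gb) (Denominator Gb a)"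
| coefficient_algebra:
    "\<lbrakk>\<forall>s\<in>coefficients Gb. to_fract a ^ e s * s \<in> range to_fract;
      S = {r. \<exists>s\<in>coefficients Gb. to_fract r = to_fract a ^ e s * s}\<rbrakk> \<Longrightarrow>
     step n \<iota> x G ord (Denominator Gb a) (Subalgebra (subalgebra_generated \<iota> ({a} \<union> S)) a)"
| start_unlocalization:
    "\<lbrakk>unlocalization_input G B a;
      set fs \<subseteq> carrier (mpoly_ring {..<n}); algebra_of \<iota> x fs = B\<rbrakk> \<Longrightarrow>
     step n \<iota> x G ord (Subalgebra B a) (Unlocalize a fs)"
| keep:
    "step n \<iota> x G ord (Unlocalize a fs) (Trimmed a fs)"
| replace:
    "\<lbrakk>set fs' \<subseteq> carrier (mpoly_ring {..<n}); length fs' < length fs;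
      algebra_of \<iota> x fs' = algebra_of \<iota> x fs\<rbrakk> \<Longrightarrow>
     step n \<iota> x G ord (Unlocalize a fs) (Trimmed a fs')"
| ideals:
    "\<lbrakk>g \<in> carrier (z_ring n fs); z_eval n \<iota> x fs g = a\<rbrakk> \<Longrightarrow>
     step n \<iota> x G ord (Trimmed a fs) (Ideals a fs g)"
| return:
    "ideal_M n \<iota> x fs g \<subseteq> ideal_N n \<iota> x fs g \<Longrightarrow>
     step n \<iota> x G ord (Ideals a fs g) (Return fs)"
| new_elements:
    "\<lbrakk>\<not> ideal_M n \<iota> x fs g \<subseteq> ideal_N n \<iota> x fs g;
      set hs \<subseteq> ideal_M n \<iota> x fs g;
      Idl\<^bsub>z_ring n fs\<^esub> (ideal_N n \<iota> x fs g \<union> set hs) = ideal_M n \<iota> x fs g\<rbrakk> \<Longrightarrow>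
     step n \<iota> x G ord (Ideals a fs g) (Enlarge a fs hs)"
| enlarge:
    "\<lbrakk>set fs' \<subseteq> carrier (mpoly_ring {..<n}); length fs' = length hs;
      \<forall>i<length hs. a * mpoly_eval \<iota> x (fs' ! i) = z_eval n \<iota> x fs (hs ! i)\<rbrakk> \<Longrightarrow>
     step n \<iota> x G ord (Enlarge a fs hs) (Unlocalize a (fs @ fs'))"

end

theory Submission
  imports Defs
begin

text \<open>
  Write \<open>L\<close> for the field of fractions of \<open>R\<close> and \<open>D\<close> for the Derksen ideal, which is the
  vanishing ideal in \<open>L[y]\<close> of the \<open>G\<close>-orbit of the point \<open>x = (x\<^sub>1, \<dots>, x\<^sub>n)\<close>.

  \<^item> The subalgebra \<open>B\<close> built from the Groebner basis is correct up to denominators. Conjugation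
    by \<open>\<sigma> \<in> G\<close> preserves \<open>D\<close>, so by reducedness the basis is fixed coefficient by coefficient
    (\<open>coefficients_invariant\<close>), and \<open>B \<subseteq> R\<^sup>G\<close>. Conversely, if \<open>f = F(x)\<close> is invariant, then
    \<open>F - f\<close> vanishes on the orbit, so the constant \<open>f\<close> is the normal form of \<open>F\<close> modulo \<open>D\<close>.
    Reduction by a monic basis never leaves the ring generated by the coefficients, whence
    \<open>f \<in> B[a\<inverse>]\<close> (\<open>invariants_in_localization\<close>).

  \<^item> In the loop, the ideal generated by \<open>I\<^sub>y\<close> and the \<open>z\<^sub>i - f\<^sub>i\<close> is the kernel of the evaluation
    \<open>K[y, z] \<rightarrow> R\<close>. Consequently \<open>M\<close> and \<open>N\<close> are the preimages of \<open>B \<inter> aR\<close> and \<open>aB\<close>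
    (\<open>in_ideal_M_iff\<close>, \<open>in_ideal_N_iff\<close>), and the loop stops when \<open>B \<inter> aR \<subseteq> aB\<close>.
    Then \<open>a\<^sup>k r \<in> B\<close> implies \<open>r \<in> B\<close> by cancelling \<open>a\<close> repeatedly, and \<open>R\<^sup>G \<subseteq> B[a\<inverse>]\<close>
    gives \<open>B = R\<^sup>G\<close> (\<open>return_correct\<close>).

  \<^item> Otherwise the loop enlarges \<open>B\<close> so that it contains every \<open>r\<close> with \<open>a r \<in> B\<close>
    (\<open>enlarge_divides\<close>). By Noether's theorem \<open>R\<^sup>G\<close> has a finite set \<open>S\<close> of generators
    (\<open>invariants_finitely_generated\<close>), and \<open>a\<^sup>k S \<subseteq> B\<close> for some \<open>k\<close>. Each round lowers this
    \<open>k\<close> by one, and once it is \<open>0\<close> the stopping criterion holds (\<open>terminating_Trimmed\<close>).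

  \<^item> No state is stuck, because every object that a step asks for exists: the reduced Groebner
    basis, an invariant common denominator, finitely many generators of \<open>M\<close>, and representatives
    of the new elements (\<open>step_progress\<close>).

  The finiteness statements all rest on one form of Hilbert's basis theorem, \<open>hilbert_basis\<close>:
  if a subring \<open>A\<close> of a commutative ring is Noetherian, so is \<open>A[t]\<close> for any element \<open>t\<close>. It yields
  Dickson's lemma, and with it the well-foundedness of monomial orders, the finite generation of
  \<open>M\<close>, and Noether's theorem.
\<close>

section \<open>Subrings, modules over them and Noetherian rings\<close>

text \<open>
  Subrings and modules over them are sets within one ambient ring type. In this way \<open>A\<close>, \<open>A[t]\<close>
  and their ideals share the arithmetic of the type, and the submodules of the ambient ring
  include the ideals of \<open>A\<close> as well as \<open>R\<^sup>G\<close> over a subalgebra.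
\<close>

definition unital_subring :: "'a::comm_ring_1 set \<Rightarrow> bool" where
  "unital_subring A \<longleftrightarrow> 1 \<in> A \<and> (\<forall>a\<in>A. \<forall>b\<in>A. a - b \<in> A \<and> a * b \<in> A)"

definition is_submodule :: "'a::comm_ring_1 set \<Rightarrow> 'a set \<Rightarrow> bool" where
  "is_submodule A N \<longleftrightarrow>
     0 \<in> N \<and> (\<forall>u\<in>N. \<forall>v\<in>N. u + v \<in> N) \<and> (\<forall>c\<in>A. \<forall>v\<in>N. c * v \<in> N)"

inductive_set module_span :: "'a::comm_ring_1 set \<Rightarrow> 'a set \<Rightarrow> 'a set" for A S where
  zero: "0 \<in> module_span A S"
| base: "s \<in> S \<Longrightarrow> s \<in> module_span A S"
| add: "u \<in> module_span A S \<Longrightarrow> v \<in> module_span A S \<Longrightarrow> u + v \<in> module_span A S"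
| scale: "c \<in> A \<Longrightarrow> v \<in> module_span A S \<Longrightarrow> c * v \<in> module_span A S"

definition noetherian :: "'a::comm_ring_1 set \<Rightarrow> bool" where
  "noetherian A \<longleftrightarrow>
     (\<forall>J. is_submodule A J \<and> J \<subseteq> A \<longrightarrow> (\<exists>F. finite F \<and> F \<subseteq> J \<and> J \<subseteq> module_span A F))"

lemma unital_subringD:
  assumes "unital_subring A"
  shows "1 \<in> A" "0 \<in> A" "a \<in> A \<Longrightarrow> - a \<in> A" "a \<in> A \<Longrightarrow> b \<in> A \<Longrightarrow> a + b \<in> A"
    "a \<in> A \<Longrightarrow> b \<in> A \<Longrightarrow> a - b \<in> A" "a \<in> A \<Longrightarrow> b \<in> A \<Longrightarrow> a * b \<in> A"
proof -
  have diff: "a - b \<in> A" if "a \<in> A" "b \<in> A" for a b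
    using assms that by (auto simp: unital_subring_def)
  show one: "1 \<in> A" using assms by (auto simp: unital_subring_def)
  show zero: "0 \<in> A" using diff[OF one one] by simp
  have neg: "- a \<in> A" if "a \<in> A" for a
    using diff[OF zero that] by simp
  show "a \<in> A \<Longrightarrow> - a \<in> A" by (rule neg)
  show "a \<in> A \<Longrightarrow> b \<in> A \<Longrightarrow> a + b \<in> A" using diff[of a "- b"] neg[of b] by simp
  show "a \<in> A \<Longrightarrow> b \<in> A \<Longrightarrow> a - b \<in> A" by (rule diff)
  show "a \<in> A \<Longrightarrow> b \<in> A \<Longrightarrow> a * b \<in> A" using assms by (auto simp: unital_subring_def)
qed

lemma unital_subring_sum:
  assumes "unital_subring A" "\<And>i. i \<in> T \<Longrightarrow> f i \<in> A"
  shows "sum f T \<in> A"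
  using assms(2) by (induction T rule: infinite_finite_induct)
    (auto intro: unital_subringD[OF assms(1)])

lemma unital_subring_power:
  assumes "unital_subring A" "a \<in> A"
  shows "a ^ k \<in> A"
  by (induction k) (auto intro: unital_subringD[OF assms(1)] assms(2))

lemma submoduleD:
  assumes "is_submodule A N"
  shows "0 \<in> N" "u \<in> N \<Longrightarrow> v \<in> N \<Longrightarrow> u + v \<in> N" "c \<in> A \<Longrightarrow> v \<in> N \<Longrightarrow> c * v \<in> N"
  using assms by (auto simp: is_submodule_def)

lemma submodule_diff:
  assumes "is_submodule A N" "unital_subring A" "u \<in> N" "v \<in> N"
  shows "u - v \<in> N"
proof -
  have "- 1 * v \<in> N"
    using assms by (intro submoduleD(3)[OF assms(1)] unital_subringD(3)[OF assms(2)]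
        unital_subringD(1)[OF assms(2)])
  then show ?thesis using submoduleD(2)[OF assms(1,3)] by fastforce
qed

lemma submodule_sum:
  assumes "is_submodule A N" "\<And>i. i \<in> T \<Longrightarrow> f i \<in> N"
  shows "sum f T \<in> N"
  using assms(2) by (induction T rule: infinite_finite_induct)
    (auto intro: submoduleD[OF assms(1)])

lemma submodule_module_span: "is_submodule A (module_span A S)"
  by (auto simp: is_submodule_def intro: module_span.intros)

lemma module_span_minimal:
  assumes "is_submodule A N" "S \<subseteq> N"
  shows "module_span A S \<subseteq> N"
proof
  fix v assume "v \<in> module_span A S"
  then show "v \<in> N"
    by induction (use assms in \<open>auto intro: submoduleD[OF assms(1)]\<close>)
qed

lemma module_span_mono: "S \<subseteq> T \<Longrightarrow> module_span A S \<subseteq> module_span A T"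
  by (rule module_span_minimal[OF submodule_module_span]) (auto intro: module_span.base)

lemma module_span_base: "S \<subseteq> module_span A S"
  by (auto intro: module_span.base)

lemma module_span_finite:
  assumes "v \<in> module_span A S"
  shows "\<exists>F. finite F \<and> F \<subseteq> S \<and> v \<in> module_span A F"
  using assms
proof induction
  case zero
  then show ?case by (auto intro!: exI[of _ "{}"] module_span.zero)
next
  case (base s)
  then show ?case by (auto intro!: exI[of _ "{s}"] module_span.base)
next
  case (add u v)
  then obtain F1 F2 where "finite F1" "F1 \<subseteq> S" "u \<in> module_span A F1"
    "finite F2" "F2 \<subseteq> S" "v \<in> module_span A F2" by blast
  moreover from this have "u \<in> module_span A (F1 \<union> F2)" "v \<in> module_span A (F1 \<union> F2)"
    using module_span_mono[of F1 "F1 \<union> F2" A] module_span_mono[of F2 "F1 \<union> F2" A] by auto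
  ultimately show ?case
    by (intro exI[of _ "F1 \<union> F2"]) (auto intro: module_span.add)
next
  case (scale c v)
  then show ?case by (meson module_span.scale)
qed

text \<open>
  Any generating set of a finitely generated module contains a finite one, because every
  element of the finite generating set involves only finitely many of the given generators.
\<close>

lemma module_span_finite_subset:
  assumes "finite F" "F \<subseteq> module_span A S"
  shows "\<exists>T. finite T \<and> T \<subseteq> S \<and> F \<subseteq> module_span A T"
  using assms
proof (induction F)
  case empty
  then show ?case by (intro exI[of _ "{}"]) auto
next
  case (insert v F)
  then obtain T where T: "finite T" "T \<subseteq> S" "F \<subseteq> module_span A T" by auto
  from insert.prems obtain U where U: "finite U" "U \<subseteq> S" "v \<in> module_span A U"
    using module_span_finite[of v A S] by auto
  have "insert v F \<subseteq> module_span A (T \<union> U)"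
    using T U module_span_mono[of T "T \<union> U" A] module_span_mono[of U "T \<union> U" A] by auto
  with T U show ?case by (intro exI[of _ "T \<union> U"]) auto
qed

lemma module_span_insert:
  assumes "unital_subring A" "v \<in> module_span A (insert m S)"
  obtains c u where "c \<in> A" "u \<in> module_span A S" "v = c * m + u"
proof -
  have "\<exists>c\<in>A. \<exists>u\<in>module_span A S. v = c * m + u"
    using assms(2)
  proof induction
    case zero
    show ?case
      by (intro bexI[of _ 0]) (auto intro: module_span.zero unital_subringD[OF assms(1)])
  next
    case (base s)
    show ?case
    proof (cases "s = m")
      case True
      then show ?thesis
        by (intro bexI[of _ 1] bexI[of _ 0])
          (auto intro: module_span.zero unital_subringD[OF assms(1)])
    next
      case False
      with base show ?thesis
        by (intro bexI[of _ 0] bexI[of _ s])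
          (auto intro: module_span.base unital_subringD[OF assms(1)])
    qed
  next
    case (add u v)
    then obtain c u' d v' where "c \<in> A" "u' \<in> module_span A S" "u = c * m + u'"
      "d \<in> A" "v' \<in> module_span A S" "v = d * m + v'" by blast
    then show ?case
      by (intro bexI[of _ "c + d"] bexI[of _ "u' + v'"])
        (auto intro: module_span.add unital_subringD[OF assms(1)] simp: algebra_simps)
  next
    case (scale e v)
    then obtain d v' where "d \<in> A" "v' \<in> module_span A S" "v = d * m + v'" by blast
    with scale(1) show ?case
      by (intro bexI[of _ "e * d"] bexI[of _ "e * v'"])
        (auto intro: module_span.scale unital_subringD[OF assms(1)] simp: algebra_simps)
  qed
  then show ?thesis using that by blast
qed

text \<open>
  Finitely generated modules over a Noetherian ring are Noetherian.  By induction on the number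
  of generators: the coefficients of the last generator \<open>m\<close> that occur in \<open>N\<close> form a finitely
  generated ideal, and subtracting elements of \<open>N\<close> that realise its generators moves any element
  of \<open>N\<close> into the span of the other generators.
\<close>

lemma noetherian_submodule_fg:
  assumes A: "unital_subring A" "noetherian A"
  shows "finite M \<Longrightarrow> is_submodule A N \<Longrightarrow> N \<subseteq> module_span A M \<Longrightarrow>
    \<exists>F. finite F \<and> F \<subseteq> N \<and> N \<subseteq> module_span A F"
proof (induction M arbitrary: N rule: finite_induct)
  case empty
  have "module_span A {} \<subseteq> {0}"
    by (rule module_span_minimal) (auto simp: is_submodule_def)
  with empty show ?case
    by (intro exI[of _ "{}"]) (auto intro: module_span.zero)
next
  case (insert m M)
  note N = submoduleD[OF insert.prems(1)]
  define J where "J = {c \<in> A. \<exists>u\<in>module_span A M. c * m + u \<in> N}"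
  have "is_submodule A J"
    unfolding is_submodule_def
  proof (intro conjI ballI)
    show "0 \<in> J"
      unfolding J_def using N(1) unital_subringD(2)[OF A(1)] module_span.zero[of A M] by force
  next
    fix c d assume "c \<in> J" "d \<in> J"
    then obtain u v where "c \<in> A" "d \<in> A" "u \<in> module_span A M" "v \<in> module_span A M"
      "c * m + u \<in> N" "d * m + v \<in> N" by (auto simp: J_def)
    moreover from this have "(c + d) * m + (u + v) \<in> N"
      using N(2)[of "c * m + u" "d * m + v"] by (simp add: algebra_simps)
    ultimately show "c + d \<in> J"
      unfolding J_def using module_span.add unital_subringD(4)[OF A(1)] by blast
  next
    fix c d assume "c \<in> A" "d \<in> J"
    then obtain v where "c \<in> A" "d \<in> A" "v \<in> module_span A M" "d * m + v \<in> N"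
      by (auto simp: J_def)
    moreover from this have "(c * d) * m + (c * v) \<in> N"
      using N(3)[of c "d * m + v"] by (simp add: algebra_simps)
    ultimately show "c * d \<in> J"
      unfolding J_def using module_span.scale unital_subringD(6)[OF A(1)] by blast
  qed
  moreover have "J \<subseteq> A" by (auto simp: J_def)
  ultimately obtain C where C: "finite C" "C \<subseteq> J" "J \<subseteq> module_span A C"
    using A(2) unfolding noetherian_def by meson
  have "\<forall>c\<in>C. \<exists>u. u \<in> module_span A M \<and> c * m + u \<in> N"
    using C(2) unfolding J_def by auto
  then obtain w where w: "\<And>c. c \<in> C \<Longrightarrow> w c \<in> module_span A M \<and> c * m + w c \<in> N"
    by metis
  define F1 where "F1 = (\<lambda>c. c * m + w c) ` C"
  have F1: "finite F1" "F1 \<subseteq> N"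
    unfolding F1_def using C(1) w by auto
  have lift: "\<exists>u\<in>module_span A M. c * m + u \<in> module_span A F1" if "c \<in> module_span A C" for c
    using that
  proof induction
    case zero
    show ?case by (intro bexI[of _ 0]) (auto intro: module_span.zero)
  next
    case (base c)
    then have "c * m + w c \<in> F1" by (simp add: F1_def)
    then show ?case
      using w[OF base] by (intro bexI[of _ "w c"] module_span.base[of _ F1]) auto
  next
    case (add c d)
    then obtain u v where "u \<in> module_span A M" "c * m + u \<in> module_span A F1"
      "v \<in> module_span A M" "d * m + v \<in> module_span A F1" by auto
    then show ?case
      using module_span.add[of "c * m + u" A F1 "d * m + v"]
      by (intro bexI[of _ "u + v"]) (auto simp: algebra_simps intro: module_span.add)
  next
    case (scale c d)
    then obtain v where "v \<in> module_span A M" "d * m + v \<in> module_span A F1" by auto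
    then show ?case
      using module_span.scale[of c A "d * m + v" F1] scale(1)
      by (intro bexI[of _ "c * v"]) (auto simp: algebra_simps intro: module_span.scale)
  qed
  have "is_submodule A (N \<inter> module_span A M)"
    using insert.prems(1) submodule_module_span[of A M] by (auto simp: is_submodule_def)
  then obtain F2 where F2: "finite F2" "F2 \<subseteq> N \<inter> module_span A M"
    "N \<inter> module_span A M \<subseteq> module_span A F2"
    using insert.IH[of "N \<inter> module_span A M"] by auto
  have F1N: "module_span A F1 \<subseteq> N"
    using module_span_minimal[OF insert.prems(1)] F1 by auto
  have "N \<subseteq> module_span A (F1 \<union> F2)"
  proof
    fix v assume v: "v \<in> N"
    then obtain c u where cu: "c \<in> A" "u \<in> module_span A M" "v = c * m + u"
      using insert.prems(2) module_span_insert[OF A(1), of v m M] by blast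
    with v have "c \<in> J" unfolding J_def by auto
    then obtain u' where u': "u' \<in> module_span A M" "c * m + u' \<in> module_span A F1"
      using C(3) lift by blast
    have "u - u' \<in> module_span A M"
      using submodule_diff[OF submodule_module_span A(1)] cu u' by blast
    moreover have "u - u' \<in> N"
      using submodule_diff[OF insert.prems(1) A(1) v, of "c * m + u'"] u' F1N cu by auto
    ultimately have "u - u' \<in> module_span A F2" using F2 by blast
    then have "(c * m + u') + (u - u') \<in> module_span A (F1 \<union> F2)"
      using u' module_span_mono[of F1 "F1 \<union> F2" A] module_span_mono[of F2 "F1 \<union> F2" A] module_span.add[of "c * m + u'" A "F1 \<union> F2" "u - u'"] by blast
    then show "v \<in> module_span A (F1 \<union> F2)" using cu by simp
  qed
  then show ?case using F1 F2 by (intro exI[of _ "F1 \<union> F2"]) auto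
qed

text \<open>Pull an ideal of the image back, and push its generators forward.\<close>

lemma noetherian_image:
  assumes "noetherian A" "unital_subring A"
    and h: "\<And>a b. a \<in> A \<Longrightarrow> b \<in> A \<Longrightarrow> h (a + b) = h a + h b"
      "\<And>a b. a \<in> A \<Longrightarrow> b \<in> A \<Longrightarrow> h (a * b) = h a * h b" "h 0 = 0"
  shows "noetherian (h ` A)"
  unfolding noetherian_def
proof (intro allI impI, elim conjE)
  fix J assume J: "is_submodule (h ` A) J" "J \<subseteq> h ` A"
  define J' where "J' = {a \<in> A. h a \<in> J}"
  have "is_submodule A J'"
    unfolding is_submodule_def J'_def
    using submoduleD[OF J(1)] h unital_subringD[OF assms(2)] by auto
  then obtain F where F: "finite F" "F \<subseteq> J'" "J' \<subseteq> module_span A F"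
    using assms(1) unfolding noetherian_def by (metis (no_types, lifting) J'_def mem_Collect_eq subsetI)
  have FA: "F \<subseteq> A" using F(2) by (auto simp: J'_def)
  have "a \<in> A \<and> h a \<in> module_span (h ` A) (h ` F)" if "a \<in> module_span A F" for a
    using that
  proof induction
    case zero
    then show ?case using h unital_subringD[OF assms(2)] by (simp add: module_span.zero)
  next
    case (base s)
    then show ?case using FA by (auto intro: module_span.base)
  next
    case (add u v)
    then show ?case using h unital_subringD[OF assms(2)] by (simp add: module_span.add)
  next
    case (scale c v)
    then show ?case using h unital_subringD[OF assms(2)] by (simp add: module_span.scale)
  qed
  then have "J \<subseteq> module_span (h ` A) (h ` F)"
    using J(2) F(3) unfolding J'_def by auto
  then show "\<exists>F. finite F \<and> F \<subseteq> J \<and> J \<subseteq> module_span (h ` A) F"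
    using F by (intro exI[of _ "h ` F"]) (auto simp: J'_def)
qed


section \<open>Hilbert's basis theorem\<close>

definition adjoin :: "'a::comm_ring_1 set \<Rightarrow> 'a \<Rightarrow> 'a set" where
  "adjoin A t = {poly p t | p. \<forall>i. Polynomial.coeff p i \<in> A}"

lemma unital_subring_adjoin:
  assumes "unital_subring A"
  shows "unital_subring (adjoin A t)"
  unfolding unital_subring_def
proof (intro conjI ballI)
  note A = unital_subringD[OF assms]
  show "1 \<in> adjoin A t"
    unfolding adjoin_def by (auto intro!: exI[of _ 1] simp: coeff_1 A)
  fix a b assume "a \<in> adjoin A t" "b \<in> adjoin A t"
  then obtain p q where *: "a = poly p t" "\<forall>i. Polynomial.coeff p i \<in> A" "b = poly q t" "\<forall>i. Polynomial.coeff q i \<in> A"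
    unfolding adjoin_def by auto
  show "a - b \<in> adjoin A t"
    unfolding adjoin_def using * by (auto intro!: exI[of _ "p - q"] A)
  show "a * b \<in> adjoin A t"
    unfolding adjoin_def using *
    by (auto intro!: exI[of _ "p * q"] A unital_subring_sum[OF assms] simp: coeff_mult)
qed

lemma adjoin_base:
  assumes "unital_subring A"
  shows "A \<subseteq> adjoin A t" "t \<in> adjoin A t"
proof -
  note A = unital_subringD[OF assms]
  show "A \<subseteq> adjoin A t"
  proof
    fix a assume "a \<in> A"
    then show "a \<in> adjoin A t"
      unfolding adjoin_def
      by (auto intro!: exI[of _ "[:a:]"] A simp: coeff_pCons split: nat.splits)
  qed
  show "t \<in> adjoin A t"
    unfolding adjoin_def
    by (auto intro!: exI[of _ "[:0, 1:]"] A simp: coeff_pCons split: nat.splits)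
qed

text \<open>
  For an ideal \<open>J\<close> of \<open>A[t]\<close>, the leading coefficients of the polynomials of degree at most \<open>d\<close>
  with value in \<open>J\<close> form an ideal \<open>Lc d\<close> of \<open>A\<close>.  These ideals increase with \<open>d\<close> and their
  union is finitely generated, so that \<open>Lc d = Lc D\<close> for \<open>d \<ge> D\<close>.
  Finitely many elements of \<open>J\<close> realising generators of \<open>Lc 0, \<dots>, Lc D\<close> generate \<open>J\<close>.
\<close>

theorem hilbert_basis:
  fixes A :: "'a::comm_ring_1 set"
  assumes A: "unital_subring A" and noeth: "noetherian A"
  shows "noetherian (adjoin A t)"
  unfolding noetherian_def
proof (intro allI impI, elim conjE)
  fix J assume J: "is_submodule (adjoin A t) J" "J \<subseteq> adjoin A t"
  note A' = unital_subringD[OF A]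
  note J' = submoduleD[OF J(1)]
  note C' = unital_subringD[OF unital_subring_adjoin[OF A, of t]]
  define Q where "Q d = {p. (\<forall>i. Polynomial.coeff p i \<in> A) \<and> (\<forall>i>d. Polynomial.coeff p i = 0)}" for d :: nat
  define Lc where "Lc d = {Polynomial.coeff p d | p. p \<in> Q d \<and> poly p t \<in> J}" for d
  have Q_add: "p + q \<in> Q d" if "p \<in> Q d" "q \<in> Q d" for p q d
    using that by (auto simp: Q_def intro: A')
  have Q_smult: "Polynomial.smult c p \<in> Q d" if "p \<in> Q d" "c \<in> A" for p c d
    using that by (auto simp: Q_def intro: A')
  have Q_zero: "0 \<in> Q d" for d by (auto simp: Q_def intro: A')
  have tC: "c \<in> adjoin A t" if "c \<in> A" for c using adjoin_base[OF A] that by auto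
  have Lc_A: "Lc d \<subseteq> A" for d by (auto simp: Lc_def Q_def)
  have Lc_mod: "is_submodule A (Lc d)" for d
    unfolding is_submodule_def
  proof (intro conjI ballI)
    show "0 \<in> Lc d" unfolding Lc_def using Q_zero J'(1) by (auto intro!: exI[of _ 0])
  next
    fix a b assume "a \<in> Lc d" "b \<in> Lc d"
    then obtain p q where "a = Polynomial.coeff p d" "p \<in> Q d" "poly p t \<in> J"
       "b = Polynomial.coeff q d" "q \<in> Q d" "poly q t \<in> J" by (auto simp: Lc_def)
    then show "a + b \<in> Lc d"
      unfolding Lc_def by (auto intro!: exI[of _ "p + q"] Q_add J')
  next
    fix c a assume "c \<in> A" "a \<in> Lc d"
    then obtain p where "a = Polynomial.coeff p d" "p \<in> Q d" "poly p t \<in> J" "c \<in> A"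
      by (auto simp: Lc_def)
    then show "c * a \<in> Lc d"
      unfolding Lc_def by (auto intro!: exI[of _ "Polynomial.smult c p"] Q_smult J' tC)
  qed
  have Q_shift: "Polynomial.monom 1 k * p \<in> Q (d + k)" if "p \<in> Q d" for p d k
    using that by (auto simp: Q_def coeff_monom_mult A')
  have t_pow: "t ^ k \<in> adjoin A t" for k
    using adjoin_base(2)[OF A] by (induction k) (auto intro: C')
  have Lc_mono: "Lc d \<subseteq> Lc (d + k)" for d k
  proof
    fix a assume "a \<in> Lc d"
    then obtain p where p: "a = Polynomial.coeff p d" "p \<in> Q d" "poly p t \<in> J" by (auto simp: Lc_def)
    then show "a \<in> Lc (d + k)"
      unfolding Lc_def using Q_shift[OF p(2), of k] J'(3)[OF t_pow p(3)]
      by (auto intro!: exI[of _ "Polynomial.monom 1 k * p"] simp: coeff_monom_mult poly_monom)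
  qed
  then have Lc_mono': "Lc d \<subseteq> Lc e" if "d \<le> e" for d e
    using that by (metis le_add_diff_inverse)
  have "is_submodule A (\<Union>d. Lc d)"
    unfolding is_submodule_def
  proof (intro conjI ballI)
    show "0 \<in> (\<Union>d. Lc d)" using submoduleD(1)[OF Lc_mod] by auto
  next
    fix a b assume "a \<in> (\<Union>d. Lc d)" "b \<in> (\<Union>d. Lc d)"
    then obtain d e where "a \<in> Lc d" "b \<in> Lc e" by auto
    then have "a \<in> Lc (max d e)" "b \<in> Lc (max d e)"
      using Lc_mono'[of d "max d e"] Lc_mono'[of e "max d e"] by auto
    then show "a + b \<in> (\<Union>d. Lc d)" using submoduleD(2)[OF Lc_mod] by blast
  next
    fix c a assume "c \<in> A" "a \<in> (\<Union>d. Lc d)"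
    then show "c * a \<in> (\<Union>d. Lc d)" using submoduleD(3)[OF Lc_mod] by blast
  qed
  moreover have "(\<Union>d. Lc d) \<subseteq> A" using Lc_A by auto
  ultimately obtain F where F: "finite F" "F \<subseteq> (\<Union>d. Lc d)" "(\<Union>d. Lc d) \<subseteq> module_span A F"
    using noeth unfolding noetherian_def by meson
  have "\<forall>a\<in>F. \<exists>d. a \<in> Lc d" using F(2) by auto
  then obtain deg where deg: "\<And>a. a \<in> F \<Longrightarrow> a \<in> Lc (deg a)" by metis
  define D where "D = Max (insert 0 (deg ` F))"
  have "deg a \<le> D" if "a \<in> F" for a
    unfolding D_def using F(1) that by (intro Max_ge) auto
  then have "F \<subseteq> Lc D" using deg Lc_mono' by blast
  then have Lc_D: "Lc d \<subseteq> Lc D" for d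
    using F(3) module_span_minimal[OF Lc_mod] by blast
  have "\<exists>E. finite E \<and> E \<subseteq> Lc d \<and> Lc d \<subseteq> module_span A E" for d
    using noeth Lc_mod Lc_A unfolding noetherian_def by meson
  then obtain E where E: "\<And>d. finite (E d) \<and> E d \<subseteq> Lc d \<and> Lc d \<subseteq> module_span A (E d)"
    by metis
  have "\<forall>d. \<forall>a\<in>E d. \<exists>p. a = Polynomial.coeff p d \<and> p \<in> Q d \<and> poly p t \<in> J"
    using E unfolding Lc_def by blast
  then obtain pol where pol:
    "\<And>d a. a \<in> E d \<Longrightarrow> a = Polynomial.coeff (pol d a) d \<and> pol d a \<in> Q d \<and> poly (pol d a) t \<in> J"
    by metis
  define Gen where "Gen = (\<Union>d\<in>{..D}. (\<lambda>a. poly (pol d a) t) ` E d)"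
  have Gen: "finite Gen" "Gen \<subseteq> J"
    unfolding Gen_def using E pol by auto
  have small: "\<exists>q\<in>Q d. Polynomial.coeff q d = a \<and> poly q t \<in> module_span (adjoin A t) Gen"
    if "d \<le> D" "a \<in> module_span A (E d)" for d a
    using that(2)
  proof induction
    case zero
    show ?case using Q_zero by (intro bexI[of _ 0]) (auto intro: module_span.zero)
  next
    case (base a)
    then show ?case
      using pol[OF base] that(1) by (intro bexI[of _ "pol d a"])
        (auto intro!: module_span.base simp: Gen_def)
  next
    case (add a b)
    then obtain p q where "p \<in> Q d" "Polynomial.coeff p d = a" "poly p t \<in> module_span (adjoin A t) Gen"
      "q \<in> Q d" "Polynomial.coeff q d = b" "poly q t \<in> module_span (adjoin A t) Gen" by blast
    then show ?case by (intro bexI[of _ "p + q"]) (auto intro: module_span.add Q_add)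
  next
    case (scale c a)
    then obtain p where "p \<in> Q d" "Polynomial.coeff p d = a" "poly p t \<in> module_span (adjoin A t) Gen"
      by blast
    with scale(1) show ?case
      by (intro bexI[of _ "Polynomial.smult c p"]) (auto intro: module_span.scale Q_smult tC)
  qed
  have realise: "\<exists>q\<in>Q d. Polynomial.coeff q d = a \<and> poly q t \<in> module_span (adjoin A t) Gen"
    if "a \<in> Lc d" for d a
  proof (cases "d \<le> D")
    case True
    with that E show ?thesis by (intro small) auto
  next
    case False
    then obtain k where k: "d = D + k" by (metis le_add_diff_inverse nat_le_linear)
    have "a \<in> module_span A (E D)" using Lc_D that E by blast
    then obtain q where q: "q \<in> Q D" "Polynomial.coeff q D = a" "poly q t \<in> module_span (adjoin A t) Gen"
      using small[of D a] by auto
    then show ?thesis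
      unfolding k using Q_shift[OF q(1), of k] module_span.scale[OF t_pow q(3), of k]
      by (auto intro!: bexI[of _ "Polynomial.monom 1 k * q"] simp: coeff_monom_mult poly_monom)
  qed
  have "poly p t \<in> module_span (adjoin A t) Gen"
    if "\<forall>i. Polynomial.coeff p i \<in> A" "\<forall>i\<ge>d. Polynomial.coeff p i = 0" "poly p t \<in> J" for p d
    using that
  proof (induction d arbitrary: p)
    case 0
    then have "p = 0" by (intro poly_eqI) auto
    then show ?case by (simp add: module_span.zero)
  next
    case (Suc d)
    then have "p \<in> Q d" by (auto simp: Q_def)
    then have "Polynomial.coeff p d \<in> Lc d" using Suc.prems unfolding Lc_def by auto
    then obtain q where q: "q \<in> Q d" "Polynomial.coeff q d = Polynomial.coeff p d"
      "poly q t \<in> module_span (adjoin A t) Gen" using realise by blast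
    have "poly q t \<in> J" using q(3) module_span_minimal[OF J(1)] Gen by blast
    then have "poly (p - q) t \<in> J"
      using submodule_diff[OF J(1) unital_subring_adjoin[OF A]] Suc.prems(3) by auto
    moreover have "\<forall>i. Polynomial.coeff (p - q) i \<in> A"
      using q(1) Suc.prems(1) by (auto simp: Q_def intro: A')
    moreover have "\<forall>i\<ge>d. Polynomial.coeff (p - q) i = 0"
    proof (intro allI impI)
      fix i assume "d \<le> i"
      then show "Polynomial.coeff (p - q) i = 0"
        using q Suc.prems(2) by (cases "i = d") (auto simp: Q_def)
    qed
    ultimately have "poly (p - q) t \<in> module_span (adjoin A t) Gen" by (rule Suc.IH[rotated 2])
    then have "poly (p - q) t + poly q t \<in> module_span (adjoin A t) Gen"
      using q(3) by (rule module_span.add)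
    then show ?case by simp
  qed
  then have "poly p t \<in> module_span (adjoin A t) Gen"
    if "\<forall>i. Polynomial.coeff p i \<in> A" "poly p t \<in> J" for p
    using that by (meson coeff_eq_0 Suc_le_eq)
  then have "J \<subseteq> module_span (adjoin A t) Gen"
    using J(2) unfolding adjoin_def by blast
  with Gen show "\<exists>F. finite F \<and> F \<subseteq> J \<and> J \<subseteq> module_span (adjoin A t) F" by blast
qed


section \<open>Ideals of subrings and ring homomorphisms\<close>

abbreviation ring_on :: "'a::comm_ring_1 set \<Rightarrow> 'a ring" where
  "ring_on A \<equiv> \<lparr>carrier = A, mult = (*), one = 1, zero = 0, add = (+)\<rparr>"

lemma unital_subring_UNIV: "unital_subring UNIV"
  by (simp add: unital_subring_def)

lemma cring_ring_on:
  assumes "unital_subring A"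
  shows "cring (ring_on A)"
proof -
  note A = unital_subringD[OF assms]
  show ?thesis
  proof (rule cringI)
    show "abelian_group (ring_on A)"
    proof (rule abelian_groupI)
      fix a assume "a \<in> carrier (ring_on A)"
      then show "\<exists>y\<in>carrier (ring_on A). y \<oplus>\<^bsub>ring_on A\<^esub> a = \<zero>\<^bsub>ring_on A\<^esub>"
        by (intro bexI[of _ "- a"]) (auto intro: A)
    qed (auto intro: A simp: algebra_simps)
    show "comm_monoid (ring_on A)"
      by (rule comm_monoidI) (auto intro: A simp: algebra_simps)
  qed (auto simp: algebra_simps)
qed

lemma ideal_ring_on_iff:
  assumes "unital_subring A"
  shows "ideal J (ring_on A) \<longleftrightarrow> is_submodule A J \<and> J \<subseteq> A"
proof
  assume "ideal J (ring_on A)"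
  then interpret ideal J "ring_on A" .
  show "is_submodule A J \<and> J \<subseteq> A"
    using additive_subgroup.zero_closed[OF is_additive_subgroup]
      additive_subgroup.a_closed[OF is_additive_subgroup] I_l_closed a_subset
    unfolding is_submodule_def by auto
next
  assume J: "is_submodule A J \<and> J \<subseteq> A"
  interpret cring "ring_on A" by (rule cring_ring_on[OF assms])
  have "\<ominus>\<^bsub>ring_on A\<^esub> a \<in> J" if "a \<in> J" for a
  proof -
    have "- a \<in> J"
      using submodule_diff[of A J 0 a] assms J that by (auto simp: is_submodule_def)
    moreover have "\<ominus>\<^bsub>ring_on A\<^esub> a = - a"
      using minus_equality[of "- a" a] J that \<open>- a \<in> J\<close> by auto
    ultimately show ?thesis by simp
  qed
  then have "subgroup J (add_monoid (ring_on A))"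
    using J by (intro add.subgroupI) (auto simp: is_submodule_def a_inv_def)
  moreover have "a * c \<in> J" if "a \<in> J" "c \<in> A" for a c
    using J that by (simp add: is_submodule_def mult.commute[of a c])
  ultimately show "ideal J (ring_on A)"
    using J by (intro idealI ring_axioms) (auto simp: is_submodule_def)
qed

lemma genideal_ring_on:
  assumes "unital_subring A" "S \<subseteq> A"
  shows "Idl\<^bsub>ring_on A\<^esub> S = module_span A S"
proof
  have "is_submodule A A"
    using unital_subringD[OF assms(1)] by (auto simp: is_submodule_def)
  then have "module_span A S \<subseteq> A"
    by (rule module_span_minimal) (rule assms)
  then have "ideal (module_span A S) (ring_on A)"
    by (simp add: ideal_ring_on_iff[OF assms(1)] submodule_module_span)
  then show "Idl\<^bsub>ring_on A\<^esub> S \<subseteq> module_span A S"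
    unfolding genideal_def by (auto intro: module_span.base)
  show "module_span A S \<subseteq> Idl\<^bsub>ring_on A\<^esub> S"
    unfolding genideal_def ideal_ring_on_iff[OF assms(1)]
    by (intro Inter_greatest module_span_minimal) auto
qed

lemma noetherian_UNIV_of_noetherian_ring:
  assumes "noetherian_ring (cring_class_ops :: 'a::comm_ring_1 ring)"
  shows "noetherian (UNIV :: 'a set)"
  unfolding noetherian_def
proof (intro allI impI, elim conjE)
  fix J :: "'a set" assume "is_submodule UNIV J"
  then have "ideal J cring_class_ops"
    unfolding cring_class_ops_def by (simp add: ideal_ring_on_iff[OF unital_subring_UNIV])
  then obtain F where "finite F" "J = Idl\<^bsub>cring_class_ops\<^esub> F"
    using noetherian_ring.finetely_gen[OF assms] by blast
  then have "finite F" "J = module_span UNIV F"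
    unfolding cring_class_ops_def by (auto simp: genideal_ring_on[OF unital_subring_UNIV])
  then show "\<exists>F. finite F \<and> F \<subseteq> J \<and> J \<subseteq> module_span UNIV F"
    using module_span_base by blast
qed

definition unital_hom :: "('a::comm_ring_1 \<Rightarrow> 'b::comm_ring_1) \<Rightarrow> bool" where
  "unital_hom h \<longleftrightarrow> h 1 = 1 \<and> (\<forall>a b. h (a + b) = h a + h b) \<and> (\<forall>a b. h (a * b) = h a * h b)"

lemma unital_homD:
  assumes "unital_hom h"
  shows "h 1 = 1" "h 0 = 0" "h (a + b) = h a + h b" "h (a * b) = h a * h b"
    "h (- a) = - h a" "h (a - b) = h a - h b" "h (a ^ k) = h a ^ k"
proof -
  show one: "h 1 = 1" and add: "h (a + b) = h a + h b" and mult: "h (a * b) = h a * h b" for a b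
    using assms by (auto simp: unital_hom_def)
  show zero: "h 0 = 0" using add[of 0 0] by simp
  have neg: "h (- a) = - h a" for a
    using add[of a "- a"] zero by (simp add: eq_neg_iff_add_eq_0 add.commute)
  then show "h (- a) = - h a" .
  show "h (a - b) = h a - h b" using add[of a "- b"] neg by simp
  show "h (a ^ k) = h a ^ k" by (induction k) (auto simp: one mult)
qed

lemma unital_hom_sum: "unital_hom h \<Longrightarrow> h (sum f T) = (\<Sum>i\<in>T. h (f i))"
  by (induction T rule: infinite_finite_induct) (auto simp: unital_homD)

lemma unital_hom_prod: "unital_hom h \<Longrightarrow> h (prod f T) = (\<Prod>i\<in>T. h (f i))"
  by (induction T rule: infinite_finite_induct) (auto simp: unital_homD)

lemma unital_hom_to_fract: "unital_hom to_fract"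
  by (auto simp: unital_hom_def)

lemma unital_hom_id: "unital_hom (\<lambda>c. c)"
  by (auto simp: unital_hom_def)


section \<open>Multivariate polynomials\<close>

abbreviation polys :: "nat set \<Rightarrow> ('a::comm_ring_1) mpoly set" where
  "polys V \<equiv> carrier (mpoly_ring V)"

abbreviation monomials :: "nat set \<Rightarrow> monomial set" where
  "monomials V \<equiv> {t. Poly_Mapping.keys t \<subseteq> V}"

lemma in_polys_iff: "p \<in> polys V \<longleftrightarrow> Poly_Mapping.keys p \<subseteq> monomials V"
  by (auto simp: mpoly_ring_def)

lemma keys_add_monomial:
  fixes s t :: monomial
  shows "Poly_Mapping.keys (s + t) = Poly_Mapping.keys s \<union> Poly_Mapping.keys t"
  by (auto simp: in_keys_iff lookup_add)

lemma poly_mapping_decomp: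
  "p = (\<Sum>t\<in>Poly_Mapping.keys p. Poly_Mapping.single t (Poly_Mapping.lookup p t))"
proof (rule poly_mapping_eqI)
  fix k
  have "Poly_Mapping.lookup (\<Sum>t\<in>Poly_Mapping.keys p.
      Poly_Mapping.single t (Poly_Mapping.lookup p t)) k =
    (\<Sum>t\<in>Poly_Mapping.keys p. if t = k then Poly_Mapping.lookup p t else 0)"
    by (simp add: lookup_sum lookup_single when_def)
  also have "\<dots> = Poly_Mapping.lookup p k"
    by (simp add: in_keys_iff)
  finally show "Poly_Mapping.lookup p k = Poly_Mapping.lookup (\<Sum>t\<in>Poly_Mapping.keys p.
      Poly_Mapping.single t (Poly_Mapping.lookup p t)) k" by simp
qed

lemma unital_subring_polys: "unital_subring (polys V :: 'a::comm_ring_1 mpoly set)"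
  unfolding unital_subring_def
proof (intro conjI ballI)
  show "(1 :: 'a mpoly) \<in> polys V"
    by (simp add: in_polys_iff)
  fix p q :: "'a mpoly" assume pq: "p \<in> polys V" "q \<in> polys V"
  have "Poly_Mapping.keys (p - q) \<subseteq> Poly_Mapping.keys p \<union> Poly_Mapping.keys q"
    by (auto simp: in_keys_iff lookup_minus)
  then show "p - q \<in> polys V"
    using pq unfolding in_polys_iff by blast
  show "p * q \<in> polys V"
    using pq keys_mult[of p q] unfolding in_polys_iff by (force simp: keys_add_monomial)
qed

lemmas polys_closed = unital_subringD[OF unital_subring_polys]

lemma genideal_mpoly_ring:
  "S \<subseteq> polys V \<Longrightarrow> Idl\<^bsub>mpoly_ring V\<^esub> S = module_span (polys V) S"
  using genideal_ring_on[of "polys V" S] unital_subring_polys[of V] by (simp add: mpoly_ring_def)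

lemma is_submodule_polys: "is_submodule (polys V) (polys V)"
  by (auto simp: is_submodule_def intro: polys_closed)

lemma module_span_polys_subset: "S \<subseteq> polys V \<Longrightarrow> module_span (polys V) S \<subseteq> polys V"
  by (rule module_span_minimal[OF is_submodule_polys])

lemma polys_mono: "V \<subseteq> W \<Longrightarrow> polys V \<subseteq> polys W"
  by (auto simp: mpoly_ring_def)

lemma Const_in_polys: "Const c \<in> polys V"
  by (auto simp: in_polys_iff Const_def)

lemma Var_in_polys: "i \<in> V \<Longrightarrow> Var i \<in> polys V"
  by (auto simp: in_polys_iff Var_def)

lemma single_in_polys: "t \<in> monomials V \<Longrightarrow> Poly_Mapping.single t c \<in> polys V"
  by (auto simp: in_polys_iff)

lemma unital_hom_Const: "unital_hom Const"
  by (auto simp: unital_hom_def Const_def single_add mult_single)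

lemma Const_mult_single: "Const c * Poly_Mapping.single t d = Poly_Mapping.single t (c * d)"
  by (simp add: Const_def mult_single)

lemma single_eq_prod_Var:
  "Poly_Mapping.single t (c::'a::comm_ring_1) =
     Const c * (\<Prod>i\<in>Poly_Mapping.keys t. Var i ^ Poly_Mapping.lookup t i)"
proof -
  have pow: "(Var i :: 'a mpoly) ^ k = Poly_Mapping.single (Poly_Mapping.single i k) 1" for i k
  proof (induction k)
    case (Suc k)
    then show ?case by (simp add: Var_def mult_single single_add[symmetric])
  qed simp
  have "(\<Prod>i\<in>T. Poly_Mapping.single (f i) 1) = (Poly_Mapping.single (sum f T) 1 :: 'a mpoly)"
    if "finite T" for T and f :: "nat \<Rightarrow> monomial"
    using that by induction (auto simp: mult_single)
  then have "(\<Prod>i\<in>Poly_Mapping.keys t. (Var i :: 'a mpoly) ^ Poly_Mapping.lookup t i) =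
      Poly_Mapping.single t 1"
    using poly_mapping_decomp[of t] by (simp add: pow)
  then show ?thesis by (simp add: Const_mult_single)
qed

text \<open>
  Used throughout to compare homomorphisms on a polynomial ring and to reduce polynomials modulo
  an ideal: both need to be checked only on constants and variables.
\<close>

lemma polys_induct [consumes 1, case_names Const Var add mult]:
  assumes p: "p \<in> polys V"
    and Const: "\<And>c. Q (Const c)"
    and Var: "\<And>i. i \<in> V \<Longrightarrow> Q (Var i)"
    and add: "\<And>p q. p \<in> polys V \<Longrightarrow> q \<in> polys V \<Longrightarrow> Q p \<Longrightarrow> Q q \<Longrightarrow> Q (p + q)"
    and mult: "\<And>p q. p \<in> polys V \<Longrightarrow> q \<in> polys V \<Longrightarrow> Q p \<Longrightarrow> Q q \<Longrightarrow> Q (p * q)"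
  shows "Q p"
proof -
  let ?R = "{p \<in> polys V. Q p}"
  have one: "1 \<in> ?R"
    using Const[of 1] Const_in_polys[of 1 V] by (simp add: Const_def)
  have zero: "0 \<in> ?R"
    using Const[of 0] Const_in_polys[of 0 V] by (simp add: Const_def)
  have mult': "p * q \<in> ?R" if "p \<in> ?R" "q \<in> ?R" for p q
    using that by (auto intro: mult polys_closed)
  have add': "p + q \<in> ?R" if "p \<in> ?R" "q \<in> ?R" for p q
    using that by (auto intro: add polys_closed)
  have sum: "sum f T \<in> ?R" if "\<And>i. i \<in> T \<Longrightarrow> f i \<in> ?R" for T and f :: "monomial \<Rightarrow> _"
    using that
  proof (induction T rule: infinite_finite_induct)
    case (insert x F)
    have "f x + sum f F \<in> ?R" by (rule add') (use insert in blast)+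
    then show ?case using insert by simp
  qed (use zero in simp_all)
  have prod: "prod f T \<in> ?R" if "\<And>i. i \<in> T \<Longrightarrow> f i \<in> ?R" for T and f :: "nat \<Rightarrow> _"
    using that
  proof (induction T rule: infinite_finite_induct)
    case (insert x F)
    have "f x * prod f F \<in> ?R" by (rule mult') (use insert in blast)+
    then show ?case using insert by simp
  qed (use one in simp_all)
  have power: "q ^ k \<in> ?R" if "q \<in> ?R" for q k
  proof (induction k)
    case (Suc k)
    have "q * q ^ k \<in> ?R" using that Suc by (rule mult')
    then show ?case by simp
  qed (use one in simp)
  have "Poly_Mapping.single t c \<in> ?R" if "t \<in> monomials V" for t c
    unfolding single_eq_prod_Var[of t c]
    using that by (intro mult' prod power) (auto intro!: Const Var Const_in_polys Var_in_polys)
  then have "(\<Sum>t\<in>Poly_Mapping.keys p. Poly_Mapping.single t (Poly_Mapping.lookup p t)) \<in> ?R"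
    using p by (intro sum) (auto simp: mpoly_ring_def)
  then show ?thesis using poly_mapping_decomp[of p] by simp
qed

text \<open>Adjoin the variables one at a time, starting from the constants.\<close>

theorem noetherian_polys:
  assumes "noetherian (UNIV :: 'a::comm_ring_1 set)" "finite V"
  shows "noetherian (polys V :: 'a mpoly set)"
  using assms(2)
proof (induction V rule: finite_induct)
  case empty
  have "polys {} \<subseteq> range (Const :: 'a \<Rightarrow> 'a mpoly)"
  proof
    fix p :: "'a mpoly" assume "p \<in> polys {}"
    then show "p \<in> range Const"
    proof (induction rule: polys_induct)
      case (add p q)
      then show ?case by (metis (no_types, lifting) imageE rangeI unital_homD(3)[OF unital_hom_Const])
    next
      case (mult p q)
      then show ?case by (metis (no_types, lifting) imageE rangeI unital_homD(4)[OF unital_hom_Const])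
    qed auto
  qed
  then have "polys {} = range (Const :: 'a \<Rightarrow> 'a mpoly)"
    using Const_in_polys by blast
  then show ?case
    using noetherian_image[OF assms(1) unital_subring_UNIV, of Const]
    by (simp add: unital_homD[OF unital_hom_Const])
next
  case (insert i V)
  note adj = unital_subringD[OF unital_subring_adjoin[OF unital_subring_polys[of V], of "Var i"]]
  have "(polys (insert i V) :: 'a mpoly set) = adjoin (polys V) (Var i)"
  proof (intro equalityI subsetI)
    fix p :: "'a mpoly" assume "p \<in> polys (insert i V)"
    then show "p \<in> adjoin (polys V) (Var i)"
    proof (induction rule: polys_induct)
      case (Const c)
      then show ?case using adjoin_base(1)[OF unital_subring_polys] Const_in_polys by blast
    next
      case (Var j)
      then show ?case
        using adjoin_base[OF unital_subring_polys[of V], of "Var i"] Var_in_polys by blast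
    qed (auto intro: adj)
  next
    fix p :: "'a mpoly" assume "p \<in> adjoin (polys V) (Var i)"
    then obtain f where f: "p = poly f (Var i)" "\<forall>j. Polynomial.coeff f j \<in> polys V"
      by (auto simp: adjoin_def)
    have "Polynomial.coeff f j \<in> polys (insert i V)" for j
      using f(2) polys_mono[of V "insert i V"] by blast
    then show "p \<in> polys (insert i V)"
      unfolding f(1) poly_altdef
      by (intro unital_subring_sum unital_subring_polys polys_closed(6) unital_subring_power
          Var_in_polys) auto
  qed
  then show ?case
    using hilbert_basis[OF unital_subring_polys insert.IH] by simp
qed


section \<open>Evaluation\<close>

definition monomial_eval :: "(nat \<Rightarrow> 'b::comm_ring_1) \<Rightarrow> monomial \<Rightarrow> 'b" where
  "monomial_eval v t = (\<Prod>i\<in>Poly_Mapping.keys t. v i ^ Poly_Mapping.lookup t i)"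

lemma monomial_eval_add: "monomial_eval v (s + t) = monomial_eval v s * monomial_eval v t"
proof -
  have ext: "monomial_eval v u =
      (\<Prod>i\<in>Poly_Mapping.keys s \<union> Poly_Mapping.keys t. v i ^ Poly_Mapping.lookup u i)"
    if "Poly_Mapping.keys u \<subseteq> Poly_Mapping.keys s \<union> Poly_Mapping.keys t" for u
    unfolding monomial_eval_def using that
    by (intro prod.mono_neutral_left) (auto simp: in_keys_iff)
  show ?thesis
    using ext[of "s + t"] ext[of s] ext[of t]
    by (simp add: keys_add_monomial lookup_add power_add prod.distrib)
qed

lemma mpoly_eval_altdef:
  "mpoly_eval h v p = (\<Sum>t\<in>Poly_Mapping.keys p. h (Poly_Mapping.lookup p t) * monomial_eval v t)"
  by (simp add: mpoly_eval_def monomial_eval_def)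

lemma mpoly_eval_single:
  "h 0 = 0 \<Longrightarrow> mpoly_eval h v (Poly_Mapping.single t c) = h c * monomial_eval v t"
  by (simp add: mpoly_eval_altdef)

lemma mpoly_eval_add:
  "unital_hom h \<Longrightarrow> mpoly_eval h v (p + q) = mpoly_eval h v p + mpoly_eval h v q"
  unfolding mpoly_eval_altdef
  by (rule setsum_keys_plus_distrib) (auto simp: unital_homD algebra_simps)

lemma mpoly_eval_sum:
  "unital_hom h \<Longrightarrow> mpoly_eval h v (sum f T) = (\<Sum>i\<in>T. mpoly_eval h v (f i))"
  by (induction T rule: infinite_finite_induct)
    (auto simp: mpoly_eval_add, auto simp: mpoly_eval_def)

lemma unital_hom_mpoly_eval:
  assumes "unital_hom h"
  shows "unital_hom (mpoly_eval h v)"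
proof -
  note h = unital_homD[OF assms]
  have one: "mpoly_eval h v 1 = 1"
    using mpoly_eval_single[of h v 0 1] by (simp add: h monomial_eval_def)
  have "mpoly_eval h v (p * q) = mpoly_eval h v p * mpoly_eval h v q" for p q
  proof -
    have "p * q = (\<Sum>s\<in>Poly_Mapping.keys p. \<Sum>t\<in>Poly_Mapping.keys q.
        Poly_Mapping.single (s + t) (Poly_Mapping.lookup p s * Poly_Mapping.lookup q t))"
      by (subst poly_mapping_decomp[of p], subst poly_mapping_decomp[of q])
        (simp add: sum_product mult_single)
    then show ?thesis
      by (simp add: mpoly_eval_sum[OF assms] mpoly_eval_single h monomial_eval_add
          mpoly_eval_altdef[of h v p] mpoly_eval_altdef[of h v q] sum_product mult_ac)
  qed
  then show ?thesis
    unfolding unital_hom_def using one mpoly_eval_add[OF assms] by auto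
qed

lemma mpoly_eval_Const: "h 0 = 0 \<Longrightarrow> mpoly_eval h v (Const c) = h c"
  by (simp add: Const_def mpoly_eval_single monomial_eval_def)

lemma mpoly_eval_Var: "unital_hom h \<Longrightarrow> mpoly_eval h v (Var i) = v i"
  by (simp add: Var_def mpoly_eval_single monomial_eval_def unital_homD)

lemma mpoly_eval_cong:
  assumes "p \<in> polys V" "\<And>i. i \<in> V \<Longrightarrow> v i = w i"
  shows "mpoly_eval h v p = mpoly_eval h w p"
  unfolding mpoly_eval_def
proof (intro sum.cong prod.cong arg_cong2[of _ _ _ _ "(*)"] refl)
  fix t i assume "t \<in> Poly_Mapping.keys p" "i \<in> Poly_Mapping.keys t"
  then have "i \<in> V" using assms(1) by (auto simp: mpoly_ring_def)
  then show "v i ^ Poly_Mapping.lookup t i = w i ^ Poly_Mapping.lookup t i"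
    using assms(2) by simp
qed

lemma hom_mpoly_eval:
  assumes "unital_hom f"
  shows "f (mpoly_eval h v p) = mpoly_eval (\<lambda>c. f (h c)) (\<lambda>i. f (v i)) p"
  unfolding mpoly_eval_def
  by (simp add: unital_hom_sum[OF assms] unital_hom_prod[OF assms] unital_homD[OF assms])

lemma lookup_map: "f 0 = 0 \<Longrightarrow> Poly_Mapping.lookup (Poly_Mapping.map f p) t = f (Poly_Mapping.lookup p t)"
  by (simp add: Poly_Mapping.map.rep_eq when_def)

lemma keys_map_subset: "Poly_Mapping.keys (Poly_Mapping.map f p) \<subseteq> Poly_Mapping.keys p"
  by (auto simp: in_keys_iff Poly_Mapping.map.rep_eq when_def)

lemma map_in_polys: "p \<in> polys V \<Longrightarrow> Poly_Mapping.map f p \<in> polys V"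
  using keys_map_subset[of f p] by (auto simp: in_polys_iff)

lemma mpoly_eval_map:
  assumes "f 0 = 0" "h 0 = 0"
  shows "mpoly_eval h v (Poly_Mapping.map f p) = mpoly_eval (\<lambda>c. h (f c)) v p"
proof -
  have "mpoly_eval h v (Poly_Mapping.map f p) = (\<Sum>t\<in>Poly_Mapping.keys p.
      h (Poly_Mapping.lookup (Poly_Mapping.map f p) t) * monomial_eval v t)"
    unfolding mpoly_eval_altdef using keys_map_subset[of f p] assms
    by (intro sum.mono_neutral_left) (auto simp: in_keys_iff)
  then show ?thesis
    using assms by (simp add: mpoly_eval_altdef lookup_map)
qed

lemma unital_subring_algebra:
  fixes \<iota> :: "'k::comm_ring_1 \<Rightarrow> 'r::comm_ring_1"
  shows "unital_subring (subalgebra_generated \<iota> S)"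
  unfolding unital_subring_def subalgebra_generated_def
proof (intro conjI ballI)
  let ?A = "generate_ring (cring_class_ops :: 'r ring) (range \<iota> \<union> S)"
  show "1 \<in> ?A"
    using generate_ring.one[of "cring_class_ops :: 'r ring"] by (simp add: class_simps)
  fix a b assume ab: "a \<in> ?A" "b \<in> ?A"
  have "- b \<in> ?A"
    using generate_ring.a_inv[OF ab(2)] by (simp add: class_simps)
  then show "a - b \<in> ?A"
    using generate_ring.eng_add[OF ab(1)] by (fastforce simp: class_simps)
  show "a * b \<in> ?A"
    using generate_ring.eng_mult[OF ab] by (simp add: class_simps)
qed

lemma algebra_base: "range \<iota> \<subseteq> subalgebra_generated \<iota> S" "S \<subseteq> subalgebra_generated \<iota> S"
  unfolding subalgebra_generated_def by (auto intro: generate_ring.incl)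

lemma algebra_minimal:
  assumes "unital_subring A" "range \<iota> \<subseteq> A" "S \<subseteq> A"
  shows "subalgebra_generated \<iota> S \<subseteq> A"
proof
  fix b assume "b \<in> subalgebra_generated \<iota> S"
  then show "b \<in> A"
    unfolding subalgebra_generated_def
    by induction (use assms in \<open>auto simp: class_simps intro: unital_subringD[OF assms(1)]\<close>)
qed

lemma algebra_mono: "S \<subseteq> T \<Longrightarrow> subalgebra_generated \<iota> S \<subseteq> subalgebra_generated \<iota> T"
  using algebra_base(1)[of \<iota> T] algebra_base(2)[of T \<iota>]
  by (intro algebra_minimal unital_subring_algebra) auto

lemma unital_subring_eval_image:
  assumes "unital_hom h"
  shows "unital_subring (mpoly_eval h v ` polys V)"
proof -
  note e = unital_homD[OF unital_hom_mpoly_eval[OF assms], symmetric]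
  show ?thesis
    unfolding unital_subring_def
    by (auto simp: e intro!: imageI polys_closed simp flip: e(1))
       (use e(1)[of v] polys_closed(1)[of V] in \<open>metis imageI\<close>)
qed

lemma eval_image_eq_algebra:
  assumes "unital_hom \<iota>"
  shows "mpoly_eval \<iota> v ` polys V = subalgebra_generated \<iota> (v ` V)"
proof
  note e = unital_homD[OF unital_hom_mpoly_eval[OF assms]]
  note A = unital_subringD[OF unital_subring_algebra[of \<iota> "v ` V"]]
  have "mpoly_eval \<iota> v p \<in> subalgebra_generated \<iota> (v ` V)" if "p \<in> polys V" for p
    using that
  proof (induction rule: polys_induct)
    case (Const c)
    then show ?case
      using algebra_base(1)[of \<iota>] by (auto simp: mpoly_eval_Const unital_homD[OF assms])
  next
    case (Var i)
    then show ?case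
      using algebra_base(2)[of "v ` V" \<iota>] by (auto simp: mpoly_eval_Var assms)
  qed (auto simp: e intro: A)
  then show "mpoly_eval \<iota> v ` polys V \<subseteq> subalgebra_generated \<iota> (v ` V)" by auto
  have "range \<iota> \<subseteq> mpoly_eval \<iota> v ` polys V"
  proof safe
    fix c show "\<iota> c \<in> mpoly_eval \<iota> v ` polys V"
      using mpoly_eval_Const[of \<iota> v c] Const_in_polys[of c V] unital_homD(2)[OF assms]
      by (metis imageI)
  qed
  moreover have "v ` V \<subseteq> mpoly_eval \<iota> v ` polys V"
    using mpoly_eval_Var[OF assms] Var_in_polys by (metis image_subsetI imageI)
  ultimately show "subalgebra_generated \<iota> (v ` V) \<subseteq> mpoly_eval \<iota> v ` polys V"
    by (intro algebra_minimal unital_subring_eval_image[OF assms])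
qed

text \<open>A finitely generated algebra is the image of a polynomial ring under evaluation.\<close>

lemma noetherian_algebra:
  assumes "noetherian (UNIV :: 'k::comm_ring_1 set)" "unital_hom (\<iota> :: 'k \<Rightarrow> 'r::comm_ring_1)"
    and "finite S"
  shows "noetherian (subalgebra_generated \<iota> S)"
proof -
  obtain v where v: "S = v ` {..<card S}"
    using ex_bij_betw_nat_finite[OF assms(3)] by (metis atLeast0LessThan bij_betw_imp_surj_on)
  show ?thesis
    unfolding eval_image_eq_algebra[OF assms(2), symmetric] arg_cong[OF v, of "subalgebra_generated \<iota>"]
    by (intro noetherian_image noetherian_polys assms unital_subring_polys)
       (auto simp: unital_homD[OF unital_hom_mpoly_eval[OF assms(2)]])
qed


section \<open>Monomial orders and reduced Groebner bases\<close>

lemma noetherian_field: "noetherian (UNIV :: 'a::field set)"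
  unfolding noetherian_def
proof (intro allI impI, elim conjE)
  fix J :: "'a set" assume J: "is_submodule UNIV J"
  show "\<exists>F. finite F \<and> F \<subseteq> J \<and> J \<subseteq> module_span UNIV F"
  proof (cases "J \<subseteq> {0}")
    case True
    then show ?thesis by (intro exI[of _ "{}"]) (auto intro: module_span.zero)
  next
    case False
    then obtain a where a: "a \<in> J" "a \<noteq> 0" by auto
    have "b \<in> module_span UNIV {a}" for b
      using module_span.scale[of "b / a" UNIV a "{a}"] a by (auto intro: module_span.base)
    with a show ?thesis by (intro exI[of _ "{a}"]) auto
  qed
qed

lemma keys_span_monomials:
  assumes "p \<in> module_span (polys V) ((\<lambda>m. Poly_Mapping.single m (1::'a::comm_ring_1)) ` M)"
    and "t \<in> Poly_Mapping.keys p"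
  shows "\<exists>m\<in>M. \<exists>u. t = m + u"
  using assms
proof (induction arbitrary: t)
  case (base s)
  then obtain m where "m \<in> M" "s = Poly_Mapping.single m 1" by auto
  then show ?case using base(2) by (auto intro!: bexI[of _ m] exI[of _ 0])
next
  case (add p q)
  then have "t \<in> Poly_Mapping.keys p \<or> t \<in> Poly_Mapping.keys q"
    using Poly_Mapping.keys_add[of p q] by blast
  with add.IH show ?case by blast
next
  case (scale c p)
  then obtain r s where rs: "t = r + s" "s \<in> Poly_Mapping.keys p"
    using keys_mult[of c p] by blast
  then obtain m u where "m \<in> M" "s = m + u" using scale.IH by blast
  then show ?case using rs by (auto intro!: bexI[of _ m] exI[of _ "r + u"] simp: add_ac)
qed auto

text \<open>
  Dickson's lemma is the Noetherian property of a polynomial ring over a field, applied to a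
  monomial ideal.
\<close>

lemma dickson:
  assumes "finite V" "T \<subseteq> monomials V"
  shows "\<exists>F. finite F \<and> F \<subseteq> T \<and> (\<forall>t\<in>T. \<exists>m\<in>F. \<exists>u. t = m + u)"
proof -
  let ?mon = "\<lambda>m. Poly_Mapping.single m (1::rat)"
  let ?J = "module_span (polys V) (?mon ` T)"
  have "?mon ` T \<subseteq> polys V" using assms(2) by (auto intro!: single_in_polys)
  then obtain F where F: "finite F" "F \<subseteq> ?J" "?J \<subseteq> module_span (polys V) F"
    using noetherian_polys[OF noetherian_field assms(1)] submodule_module_span
      module_span_polys_subset unfolding noetherian_def by meson
  obtain S where S: "finite S" "S \<subseteq> ?mon ` T" "F \<subseteq> module_span (polys V) S"
    using module_span_finite_subset[OF F(1,2)] by blast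
  then obtain E where E: "finite E" "E \<subseteq> T" "S = ?mon ` E"
    using finite_subset_image by metis
  have "?J \<subseteq> module_span (polys V) S"
    using F(3) module_span_minimal[OF submodule_module_span S(3)] by blast
  then have "\<exists>m\<in>E. \<exists>u. t = m + u" if "t \<in> T" for t
    using that module_span.base[of "?mon t" "?mon ` T" "polys V"]
      keys_span_monomials[of "?mon t" V E t] by (auto simp: E(3))
  with E show ?thesis by blast
qed

locale monomial_ordering =
  fixes n :: nat and ord :: "monomial rel"
  assumes monomial_order: "monomial_order n ord"
begin

abbreviation LM :: "('a::zero) mpoly \<Rightarrow> monomial" where
  "LM \<equiv> leading_monomial ord"

lemma ord_refl: "t \<in> monomials {..<n} \<Longrightarrow> (t, t) \<in> ord"
  and ord_trans: "(s, t) \<in> ord \<Longrightarrow> (t, u) \<in> ord \<Longrightarrow> (s, u) \<in> ord"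
  and ord_antisym: "(s, t) \<in> ord \<Longrightarrow> (t, s) \<in> ord \<Longrightarrow> s = t"
  and ord_total: "s \<in> monomials {..<n} \<Longrightarrow> t \<in> monomials {..<n} \<Longrightarrow> (s, t) \<in> ord \<or> (t, s) \<in> ord"
  and ord_monomials: "(s, t) \<in> ord \<Longrightarrow> s \<in> monomials {..<n} \<and> t \<in> monomials {..<n}"
  and ord_zero: "t \<in> monomials {..<n} \<Longrightarrow> (0, t) \<in> ord"
  and ord_add: "(s, t) \<in> ord \<Longrightarrow> u \<in> monomials {..<n} \<Longrightarrow> (s + u, t + u) \<in> ord"
proof -
  have lin: "linear_order_on (monomials {..<n}) ord"
    using monomial_order by (simp add: monomial_order_def)
  then have *: "refl_on (monomials {..<n}) ord" "trans ord" "antisym ord"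
    "total_on (monomials {..<n}) ord" "ord \<subseteq> monomials {..<n} \<times> monomials {..<n}"
    by (auto simp: order_on_defs)
  show refl: "t \<in> monomials {..<n} \<Longrightarrow> (t, t) \<in> ord" for t using *(1) by (auto simp: refl_on_def)
  show "(s, t) \<in> ord \<Longrightarrow> (t, u) \<in> ord \<Longrightarrow> (s, u) \<in> ord" using *(2) unfolding trans_def by blast
  show "(s, t) \<in> ord \<Longrightarrow> (t, s) \<in> ord \<Longrightarrow> s = t" using *(3) unfolding antisym_def by blast
  show "s \<in> monomials {..<n} \<Longrightarrow> t \<in> monomials {..<n} \<Longrightarrow> (s, t) \<in> ord \<or> (t, s) \<in> ord"
    using *(4) refl[of s] unfolding total_on_def by (cases "s = t") auto
  show "(s, t) \<in> ord \<Longrightarrow> s \<in> monomials {..<n} \<and> t \<in> monomials {..<n}" using *(5) by blast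
  show "t \<in> monomials {..<n} \<Longrightarrow> (0, t) \<in> ord"
    "(s, t) \<in> ord \<Longrightarrow> u \<in> monomials {..<n} \<Longrightarrow> (s + u, t + u) \<in> ord"
    using monomial_order unfolding monomial_order_def by blast+
qed

lemma ord_dvd:
  assumes "m + u \<in> monomials {..<n}"
  shows "(m, m + u) \<in> ord"
  using ord_add[of 0 u m] ord_zero[of u] assms by (simp add: keys_add_monomial add.commute)

lemma finite_has_greatest:
  assumes "finite S" "S \<noteq> {}" "S \<subseteq> monomials {..<n}"
  shows "\<exists>t\<in>S. \<forall>s\<in>S. (s, t) \<in> ord"
  using assms
proof (induction rule: finite_ne_induct)
  case (singleton s)
  then show ?case using ord_refl by auto
next
  case (insert s S)
  then obtain t where t: "t \<in> S" "\<forall>s\<in>S. (s, t) \<in> ord" by auto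
  show ?case
  proof (cases "(s, t) \<in> ord")
    case True
    then show ?thesis using t by auto
  next
    case False
    then have "(t, s) \<in> ord" using ord_total[of s t] insert.prems t by auto
    then show ?thesis using t ord_trans insert.prems ord_refl by (intro bexI[of _ s]) auto
  qed
qed

lemma finite_has_least:
  assumes "finite S" "S \<noteq> {}" "S \<subseteq> monomials {..<n}"
  shows "\<exists>t\<in>S. \<forall>s\<in>S. (t, s) \<in> ord"
  using assms
proof (induction rule: finite_ne_induct)
  case (singleton s)
  then show ?case using ord_refl by auto
next
  case (insert s S)
  then obtain t where t: "t \<in> S" "\<forall>s\<in>S. (t, s) \<in> ord" by auto
  show ?case
  proof (cases "(t, s) \<in> ord")
    case True
    then show ?thesis using t by auto
  next
    case False
    then have "(s, t) \<in> ord" using ord_total[of s t] insert.prems t by auto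
    then show ?thesis using t ord_trans insert.prems ord_refl by (intro bexI[of _ s]) auto
  qed
qed

lemma LM_eqI:
  assumes "t \<in> Poly_Mapping.keys p" "\<And>s. s \<in> Poly_Mapping.keys p \<Longrightarrow> (s, t) \<in> ord"
  shows "LM p = t"
  unfolding leading_monomial_def using assms ord_antisym by (intro the_equality) blast+

lemma LM_greatest:
  assumes "p \<in> polys {..<n}" "p \<noteq> 0"
  shows "LM p \<in> Poly_Mapping.keys p" "s \<in> Poly_Mapping.keys p \<Longrightarrow> (s, LM p) \<in> ord"
    "LM p \<in> monomials {..<n}"
proof -
  obtain t where t: "t \<in> Poly_Mapping.keys p" "\<forall>s\<in>Poly_Mapping.keys p. (s, t) \<in> ord"
    using finite_has_greatest[of "Poly_Mapping.keys p"] assms by (auto simp: in_polys_iff)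
  then have "LM p = t" by (intro LM_eqI) auto
  with t show "LM p \<in> Poly_Mapping.keys p" "s \<in> Poly_Mapping.keys p \<Longrightarrow> (s, LM p) \<in> ord" by auto
  with assms show "LM p \<in> monomials {..<n}" by (auto simp: in_polys_iff)
qed

text \<open>
  A monomial order is a well-order: among the finitely many monomials that Dickson's lemma
  provides for a set, the least one is the least element of the set.
\<close>

lemma wf_ord: "wf (ord - Id)"
  unfolding wf_eq_minimal
proof (intro allI impI)
  fix Q x assume x: "x \<in> (Q :: monomial set)"
  show "\<exists>z\<in>Q. \<forall>y. (y, z) \<in> ord - Id \<longrightarrow> y \<notin> Q"
  proof (cases "Q \<inter> monomials {..<n} = {}")
    case True
    then show ?thesis using x ord_monomials by blast
  next
    case False
    obtain F where F: "finite F" "F \<subseteq> Q \<inter> monomials {..<n}"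
      "\<forall>t\<in>Q \<inter> monomials {..<n}. \<exists>m\<in>F. \<exists>u. t = m + u"
      using dickson[of "{..<n}" "Q \<inter> monomials {..<n}"] by auto
    with False have "F \<noteq> {}" by blast
    with F obtain z where z: "z \<in> F" "\<forall>s\<in>F. (z, s) \<in> ord"
      using finite_has_least[of F] by blast
    have "y \<notin> Q" if "(y, z) \<in> ord - Id" for y
    proof
      assume "y \<in> Q"
      then have y: "y \<in> Q \<inter> monomials {..<n}" using that ord_monomials by blast
      then obtain m u where "m \<in> F" "y = m + u" using F(3) by blast
      then have "(z, y) \<in> ord" using z y ord_dvd ord_trans by blast
      with that show False using ord_antisym by blast
    qed
    with z F show ?thesis by blast
  qed
qed

lemma leading_ideal_eq:
  assumes "F \<subseteq> polys {..<n}"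
  shows "leading_ideal n ord (F :: 'a::comm_ring_1 mpoly set) =
    module_span (polys {..<n}) ((\<lambda>m. Poly_Mapping.single m 1) ` (LM ` (F - {0})))"
proof -
  have "(\<lambda>f. Poly_Mapping.single (LM f) (1::'a)) ` (F - {0}) \<subseteq> polys {..<n}"
    using assms LM_greatest(3) by (auto intro!: single_in_polys)
  then show ?thesis
    unfolding leading_ideal_def by (simp add: genideal_mpoly_ring image_image)
qed

text \<open>
  A monomial lies in a monomial ideal if and only if it is divisible by a generator, so the
  equality of leading ideals is a divisibility condition on leading monomials.
\<close>

lemma leading_ideal_eq_iff:
  fixes J :: "'a::comm_ring_1 mpoly set"
  assumes "J \<subseteq> polys {..<n}" "H \<subseteq> J"
  shows "leading_ideal n ord H = leading_ideal n ord J \<longleftrightarrow>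
    (\<forall>f\<in>J - {0}. \<exists>g\<in>H - {0}. \<exists>u. LM f = LM g + u)"
proof -
  let ?mon = "\<lambda>m. Poly_Mapping.single m (1::'a)"
  have H: "H \<subseteq> polys {..<n}" using assms by blast
  show ?thesis
    unfolding leading_ideal_eq[OF assms(1)] leading_ideal_eq[OF H]
  proof
    assume eq: "module_span (polys {..<n}) (?mon ` LM ` (H - {0})) =
      module_span (polys {..<n}) (?mon ` LM ` (J - {0}))"
    show "\<forall>f\<in>J - {0}. \<exists>g\<in>H - {0}. \<exists>u. LM f = LM g + u"
    proof
      fix f assume "f \<in> J - {0}"
      then have "?mon (LM f) \<in> module_span (polys {..<n}) (?mon ` LM ` (H - {0}))"
        unfolding eq by (intro module_span.base) auto
      then show "\<exists>g\<in>H - {0}. \<exists>u. LM f = LM g + u"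
        by (auto dest!: keys_span_monomials[where t = "LM f"])
    qed
  next
    assume dvd: "\<forall>f\<in>J - {0}. \<exists>g\<in>H - {0}. \<exists>u. LM f = LM g + u"
    have "?mon (LM f) \<in> module_span (polys {..<n}) (?mon ` LM ` (H - {0}))" if f: "f \<in> J - {0}" for f
    proof -
      obtain g u where g: "g \<in> H - {0}" "LM f = LM g + u" using dvd f by blast
      have "LM f \<in> monomials {..<n}" using f assms by (intro LM_greatest) auto
      then have "?mon u \<in> polys {..<n}"
        using g by (intro single_in_polys) (simp add: keys_add_monomial)
      then have "?mon u * ?mon (LM g) \<in> module_span (polys {..<n}) (?mon ` LM ` (H - {0}))"
        using g by (intro module_span.scale module_span.base) auto
      then show ?thesis using g by (simp add: mult_single add.commute)
    qed
    then have "module_span (polys {..<n}) (?mon ` LM ` (J - {0}))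
        \<subseteq> module_span (polys {..<n}) (?mon ` LM ` (H - {0}))"
      by (intro module_span_minimal submodule_module_span) blast
    moreover have "module_span (polys {..<n}) (?mon ` LM ` (H - {0}))
        \<subseteq> module_span (polys {..<n}) (?mon ` LM ` (J - {0}))"
      using assms(2) by (intro module_span_mono) blast
    ultimately show "module_span (polys {..<n}) (?mon ` LM ` (H - {0})) =
      module_span (polys {..<n}) (?mon ` LM ` (J - {0}))" by blast
  qed
qed

text \<open>
  Reduction of a monomial modulo monic elements of an ideal. Since no division by leading
  coefficients occurs, the reduction stays within any subring \<open>C\<close> that contains the coefficients
  of the reducing polynomials.  With \<open>C\<close> the whole field this gives the existence of reduced
  Groebner bases, with \<open>C = B[a\<inverse>]\<close> the comparison of localizations.
\<close>

lemma monomial_normal_form: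
  fixes J :: "'a::comm_ring_1 mpoly set"
  assumes J: "is_submodule (polys {..<n}) J" and C: "unital_subring C"
    and F: "F \<subseteq> J" "F \<subseteq> polys {..<n}"
    and monic: "\<And>f. f \<in> F \<Longrightarrow> f \<noteq> 0 \<and> Poly_Mapping.lookup f (LM f) = 1"
    and coeffs: "\<And>f s. f \<in> F \<Longrightarrow> Poly_Mapping.lookup f s \<in> C"
    and t: "t \<in> monomials {..<n}"
  shows "\<exists>r\<in>polys {..<n}. (\<forall>s. Poly_Mapping.lookup r s \<in> C) \<and> Poly_Mapping.single t 1 - r \<in> J \<and>
    (\<forall>s\<in>Poly_Mapping.keys r. (s, t) \<in> ord \<and> (\<forall>f\<in>F. \<nexists>u. s = LM f + u))"
  using t
proof (induction t rule: wf_induct_rule[OF wf_ord])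
  case (1 t)
  note C' = unital_subringD[OF C]
  show ?case
  proof (cases "\<exists>f\<in>F. \<exists>u. t = LM f + u")
    case False
    then show ?thesis
      using 1(2) submoduleD(1)[OF J] ord_refl
      by (intro bexI[of _ "Poly_Mapping.single t 1"] single_in_polys)
         (auto simp: lookup_single when_def intro: C')
  next
    case True
    then obtain f u where f: "f \<in> F" "t = LM f + u" by blast
    have fp: "f \<in> polys {..<n}" "f \<noteq> 0" using f F monic by auto
    note LMf = LM_greatest[OF fp]
    have u: "u \<in> monomials {..<n}" using 1(2) f by (simp add: keys_add_monomial)
    define K where "K = Poly_Mapping.keys f - {LM f}"
    have K: "(s + u, t) \<in> ord - Id" "s + u \<in> monomials {..<n}" if "s \<in> K" for s
    proof -
      have "(s, LM f) \<in> ord" "s \<noteq> LM f" using that LMf by (auto simp: K_def)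
      then show "(s + u, t) \<in> ord - Id" using ord_add[OF _ u] f by auto
      then show "s + u \<in> monomials {..<n}" using ord_monomials by blast
    qed
    have "\<forall>s\<in>K. \<exists>r\<in>polys {..<n}. (\<forall>v. Poly_Mapping.lookup r v \<in> C) \<and>
        Poly_Mapping.single (s + u) 1 - r \<in> J \<and>
        (\<forall>v\<in>Poly_Mapping.keys r. (v, s + u) \<in> ord \<and> (\<forall>f\<in>F. \<nexists>w. v = LM f + w))"
      using 1(1)[OF K(1) K(2)] by blast
    then obtain R where R: "\<And>s. s \<in> K \<Longrightarrow> R s \<in> polys {..<n}"
      "\<And>s v. s \<in> K \<Longrightarrow> Poly_Mapping.lookup (R s) v \<in> C"
      "\<And>s. s \<in> K \<Longrightarrow> Poly_Mapping.single (s + u) 1 - R s \<in> J"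
      "\<And>s v. s \<in> K \<Longrightarrow> v \<in> Poly_Mapping.keys (R s) \<Longrightarrow>
         (v, s + u) \<in> ord \<and> (\<forall>f\<in>F. \<nexists>w. v = LM f + w)"
      by metis
    \<comment> \<open>Subtracting \<open>u f\<close> from \<open>t\<close> leaves a combination of the smaller monomials \<open>s + u\<close>, and these
      have normal forms \<open>R s\<close> by induction.\<close>
    define r where "r = (\<Sum>s\<in>K. Const (- Poly_Mapping.lookup f s) * R s)"
    have "r \<in> polys {..<n}"
      unfolding r_def
      by (intro unital_subring_sum unital_subring_polys polys_closed(6) Const_in_polys R)
    moreover have look: "Poly_Mapping.lookup r v =
        (\<Sum>s\<in>K. - Poly_Mapping.lookup f s * Poly_Mapping.lookup (R s) v)" for v
    proof -
      have "Poly_Mapping.lookup (Const c * p) v = c * Poly_Mapping.lookup p v"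
        for c :: 'a and p
        unfolding Const_def mult_map_scale_conv_mult[symmetric] by (simp add: lookup_map)
      then show ?thesis by (simp add: r_def lookup_sum)
    qed
    then have "Poly_Mapping.lookup r v \<in> C" for v
      unfolding look using R(2) coeffs[OF f(1)]
      by (intro unital_subring_sum[OF C] C'(6) C'(3)) auto
    moreover have "Poly_Mapping.single t 1 - r \<in> J"
    proof -
      have fin: "finite (Poly_Mapping.keys f)" by simp
      have "f = (\<Sum>s\<in>Poly_Mapping.keys f. Poly_Mapping.single s (Poly_Mapping.lookup f s))"
        by (rule poly_mapping_decomp)
      also have "\<dots> = Poly_Mapping.single (LM f) 1 +
          (\<Sum>s\<in>K. Poly_Mapping.single s (Poly_Mapping.lookup f s))"
        unfolding K_def using LMf(1) monic[OF f(1)] by (subst sum.remove[OF fin]) auto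
      finally have "Poly_Mapping.single u 1 * f = Poly_Mapping.single u 1 * (Poly_Mapping.single (LM f) 1 +
          (\<Sum>s\<in>K. Poly_Mapping.single s (Poly_Mapping.lookup f s)))" by (rule arg_cong)
      also have "\<dots> = Poly_Mapping.single t 1 +
          (\<Sum>s\<in>K. Const (Poly_Mapping.lookup f s) * Poly_Mapping.single (s + u) 1)"
        by (simp add: f(2) distrib_left sum_distrib_left mult_single Const_mult_single add.commute[of u])
      finally have uf: "Poly_Mapping.single u 1 * f = Poly_Mapping.single t 1 +
          (\<Sum>s\<in>K. Const (Poly_Mapping.lookup f s) * Poly_Mapping.single (s + u) 1)" .
      have "Poly_Mapping.single t 1 - r = Poly_Mapping.single u 1 * f +
          (\<Sum>s\<in>K. Const (- Poly_Mapping.lookup f s) * (Poly_Mapping.single (s + u) 1 - R s))"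
        unfolding uf r_def
        by (simp add: right_diff_distrib sum_subtractf sum_negf unital_homD[OF unital_hom_Const])
      also have "\<dots> \<in> J"
        using f F u by (intro submoduleD(2,3)[OF J] submodule_sum[OF J] Const_in_polys
            single_in_polys R) auto
      finally show ?thesis .
    qed
    moreover have "(v, t) \<in> ord \<and> (\<forall>f\<in>F. \<nexists>w. v = LM f + w)" if "v \<in> Poly_Mapping.keys r" for v
    proof -
      have "\<exists>s\<in>K. v \<in> Poly_Mapping.keys (R s)"
        using that unfolding in_keys_iff look by (metis (no_types, lifting) mult_zero_right sum.neutral)
      then obtain s where "s \<in> K" "v \<in> Poly_Mapping.keys (R s)" by blast
      then show ?thesis using R(4) K(1) ord_trans by blast
    qed
    ultimately show ?thesis by blast
  qed
qed

lemma normal_form: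
  fixes J :: "'a::comm_ring_1 mpoly set"
  assumes J: "is_submodule (polys {..<n}) J" and C: "unital_subring C"
    and F: "F \<subseteq> J" "F \<subseteq> polys {..<n}"
    and monic: "\<And>f. f \<in> F \<Longrightarrow> f \<noteq> 0 \<and> Poly_Mapping.lookup f (LM f) = 1"
    and coeffs: "\<And>f s. f \<in> F \<Longrightarrow> Poly_Mapping.lookup f s \<in> C"
    and p: "p \<in> polys {..<n}" "\<And>s. Poly_Mapping.lookup p s \<in> C"
  shows "\<exists>r\<in>polys {..<n}. (\<forall>s. Poly_Mapping.lookup r s \<in> C) \<and> p - r \<in> J \<and>
    (\<forall>s\<in>Poly_Mapping.keys r. \<forall>f\<in>F. \<nexists>u. s = LM f + u)"
proof -
  have "\<forall>t\<in>Poly_Mapping.keys p. \<exists>r\<in>polys {..<n}. (\<forall>s. Poly_Mapping.lookup r s \<in> C) \<and>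
    Poly_Mapping.single t 1 - r \<in> J \<and>
    (\<forall>s\<in>Poly_Mapping.keys r. (s, t) \<in> ord \<and> (\<forall>f\<in>F. \<nexists>u. s = LM f + u))"
    using p(1) by (intro ballI monomial_normal_form assms) (auto simp: in_polys_iff)
  then obtain R where R: "\<And>t. t \<in> Poly_Mapping.keys p \<Longrightarrow> R t \<in> polys {..<n}"
      "\<And>t v. t \<in> Poly_Mapping.keys p \<Longrightarrow> Poly_Mapping.lookup (R t) v \<in> C"
      "\<And>t. t \<in> Poly_Mapping.keys p \<Longrightarrow> Poly_Mapping.single t 1 - R t \<in> J"
      "\<And>t v. t \<in> Poly_Mapping.keys p \<Longrightarrow> v \<in> Poly_Mapping.keys (R t) \<Longrightarrow>
         (\<forall>f\<in>F. \<nexists>w. v = LM f + w)"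
    by metis
  define r where "r = (\<Sum>t\<in>Poly_Mapping.keys p. Const (Poly_Mapping.lookup p t) * R t)"
  have look: "Poly_Mapping.lookup r v =
      (\<Sum>t\<in>Poly_Mapping.keys p. Poly_Mapping.lookup p t * Poly_Mapping.lookup (R t) v)" for v
  proof -
    have "Poly_Mapping.lookup (Const c * p) v = c * Poly_Mapping.lookup p v"
      for c :: 'a and p
      unfolding Const_def mult_map_scale_conv_mult[symmetric] by (simp add: lookup_map)
    then show ?thesis by (simp add: r_def lookup_sum)
  qed
  show ?thesis
  proof (intro bexI[of _ r] conjI allI ballI)
    show "r \<in> polys {..<n}"
      unfolding r_def
      by (intro unital_subring_sum unital_subring_polys polys_closed(6) Const_in_polys R)
    show "Poly_Mapping.lookup r s \<in> C" for s
      unfolding look using R(2) p(2)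
      by (intro unital_subring_sum[OF C] unital_subringD(6)[OF C]) auto
    have "p - r = (\<Sum>t\<in>Poly_Mapping.keys p.
        Const (Poly_Mapping.lookup p t) * (Poly_Mapping.single t 1 - R t))"
      by (subst poly_mapping_decomp[of p])
         (simp add: r_def right_diff_distrib sum_subtractf Const_mult_single)
    then show "p - r \<in> J"
      by (simp del: mult_minus_right add: submodule_sum[OF J] submoduleD(3)[OF J] Const_in_polys R)
    show "\<nexists>u. s = LM f + u" if "s \<in> Poly_Mapping.keys r" "f \<in> F" for s f
    proof -
      have "\<exists>t\<in>Poly_Mapping.keys p. s \<in> Poly_Mapping.keys (R t)"
        using that unfolding in_keys_iff[of s] look
        by (metis (no_types, lifting) mult_zero_right sum.neutral)
      then show ?thesis using R(4) that(2) by blast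
    qed
  qed
qed

text \<open>
  The leading monomials of an ideal that are minimal with respect to divisibility are finite in
  number; subtracting from each its normal form modulo all monic elements of the ideal yields
  the reduced Groebner basis.
\<close>

lemma reduced_groebner_basis_exists:
  fixes J :: "'a::field mpoly set"
  assumes J: "is_submodule (polys {..<n}) J" "J \<subseteq> polys {..<n}"
  shows "\<exists>H. reduced_groebner_basis n ord J H"
proof -
  define F where "F = {f \<in> J. f \<noteq> 0 \<and> Poly_Mapping.lookup f (LM f) = 1}"
  define T where "T = LM ` (J - {0})"
  have T: "T \<subseteq> monomials {..<n}" unfolding T_def using LM_greatest(3) J(2) by blast
  have T_F: "\<exists>f\<in>F. LM f = t" if t: "t \<in> T" for t
  proof -
    obtain g where g: "g \<in> J" "g \<noteq> 0" "t = LM g" using t by (auto simp: T_def)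
    define c where "c = Poly_Mapping.lookup g (LM g)"
    have c: "c \<noteq> 0" using LM_greatest(1)[of g] g J unfolding c_def by (auto simp: in_keys_iff)
    define f where "f = Const (inverse c) * g"
    have f: "Poly_Mapping.lookup f s = inverse c * Poly_Mapping.lookup g s" for s
      unfolding f_def Const_def mult_map_scale_conv_mult[symmetric] by (simp add: lookup_map)
    have keys: "Poly_Mapping.keys f = Poly_Mapping.keys g"
      using c by (auto simp: in_keys_iff f)
    have "LM f = LM g"
      using LM_greatest[of g] g J by (intro LM_eqI) (auto simp: keys)
    moreover have "f \<in> J" unfolding f_def by (intro submoduleD(3)[OF J(1)] Const_in_polys g)
    moreover have "f \<noteq> 0" using keys g by (metis keys_eq_empty)
    ultimately show ?thesis
      using c g unfolding F_def by (intro bexI[of _ f]) (auto simp: f c_def)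
  qed
  obtain E where E: "finite E" "E \<subseteq> T" "\<forall>t\<in>T. \<exists>m\<in>E. \<exists>u. t = m + u"
    using dickson[OF _ T] by auto
  define Min where "Min = {t \<in> T. \<forall>s\<in>T. (\<exists>u. t = s + u) \<longrightarrow> s = t}"
  have "Min \<subseteq> E" using E unfolding Min_def by blast
  then have fin: "finite Min" using E(1) finite_subset by blast
  have Min_dvd: "\<exists>m\<in>Min. \<exists>u. t = m + u" if "t \<in> T" for t
  proof -
    let ?D = "{s \<in> T. \<exists>u. t = s + u}"
    have "t \<in> ?D" using that by (auto intro!: exI[of _ 0])
    then have "\<exists>m\<in>?D. \<forall>y. (y, m) \<in> ord - Id \<longrightarrow> y \<notin> ?D"
      using wf_ord[unfolded wf_eq_minimal, rule_format, of t ?D] by simp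
    then obtain m where m: "m \<in> ?D" "\<forall>y. (y, m) \<in> ord - Id \<longrightarrow> y \<notin> ?D"
      by (rule bexE)
    have "s = m" if "s \<in> T" "m = s + u" for s u
    proof (rule ccontr)
      assume "s \<noteq> m"
      then have "(s, m) \<in> ord - Id" using ord_dvd[of s u] that m T by auto
      moreover have "s \<in> ?D" using m that by (auto simp: add.assoc)
      ultimately show False using m(2) by blast
    qed
    with m show ?thesis unfolding Min_def by blast
  qed
  have "\<exists>r\<in>polys {..<n}. (\<forall>s. Poly_Mapping.lookup r s \<in> UNIV) \<and> Poly_Mapping.single m 1 - r \<in> J \<and>
    (\<forall>s\<in>Poly_Mapping.keys r. (s, m) \<in> ord \<and> (\<forall>f\<in>F. \<nexists>u. s = LM f + u))" if m: "m \<in> Min" for m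
  proof (rule monomial_normal_form[OF J(1) unital_subring_UNIV])
    show "F \<subseteq> J" by (auto simp: F_def)
    with J(2) show "F \<subseteq> polys {..<n}" by blast
    show "m \<in> monomials {..<n}" using m T unfolding Min_def by blast
  qed (simp_all add: F_def)
  then obtain R where R: "\<And>m. m \<in> Min \<Longrightarrow> R m \<in> polys {..<n}"
    "\<And>m. m \<in> Min \<Longrightarrow> Poly_Mapping.single m 1 - R m \<in> J"
    "\<And>m s. m \<in> Min \<Longrightarrow> s \<in> Poly_Mapping.keys (R m) \<Longrightarrow>
       (s, m) \<in> ord \<and> (\<forall>f\<in>F. \<nexists>u. s = LM f + u)"
    by metis
  have R_T: "s \<noteq> t + u" if "m \<in> Min" "s \<in> Poly_Mapping.keys (R m)" "t \<in> T" for m s t u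
    using R(3)[OF that(1,2)] T_F[OF that(3)] by blast
  define g where "g m = Poly_Mapping.single m 1 - R m" for m
  have lookup_R: "Poly_Mapping.lookup (R m) m = 0" if "m \<in> Min" for m
    using R_T[OF that, of m m 0] that by (auto simp: in_keys_iff Min_def)
  have g_lookup: "Poly_Mapping.lookup (g m) m = 1" if "m \<in> Min" for m
    using lookup_R[OF that] by (simp add: g_def lookup_minus)
  have g_keys: "s = m \<or> s \<in> Poly_Mapping.keys (R m)" if "s \<in> Poly_Mapping.keys (g m)" for s m
    using that by (auto simp: g_def in_keys_iff lookup_minus lookup_single when_def split: if_splits)
  have g_LM: "LM (g m) = m" if "m \<in> Min" for m
  proof (rule LM_eqI)
    show "m \<in> Poly_Mapping.keys (g m)" using g_lookup[OF that] by (simp add: in_keys_iff)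
    show "(s, m) \<in> ord" if "s \<in> Poly_Mapping.keys (g m)" for s
      using g_keys[OF that] R(3)[OF \<open>m \<in> Min\<close>] ord_refl[of m] T \<open>m \<in> Min\<close> by (auto simp: Min_def)
  qed
  have g_nz: "g m \<noteq> 0" if "m \<in> Min" for m using g_lookup[OF that] by auto
  have g_J: "g ` Min \<subseteq> J" using R(2) by (auto simp: g_def)
  have "\<forall>f\<in>J - {0}. \<exists>h\<in>g ` Min - {0}. \<exists>u. LM f = LM h + u"
  proof
    fix f assume "f \<in> J - {0}"
    then obtain m u where "m \<in> Min" "LM f = m + u" using Min_dvd[of "LM f"] by (auto simp: T_def)
    then show "\<exists>h\<in>g ` Min - {0}. \<exists>u. LM f = LM h + u"
      using g_LM g_nz by (intro bexI[of _ "g m"]) auto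
  qed
  then have "groebner_basis n ord J (g ` Min)"
    unfolding groebner_basis_def using fin g_J leading_ideal_eq_iff[OF J(2) g_J] by blast
  moreover have red: "t \<noteq> LM (g m') + u"
    if "m \<in> Min" "m' \<in> Min" "g m' \<noteq> g m" "t \<in> Poly_Mapping.keys (g m)" for m m' t u
  proof -
    have "m' \<in> T" "m \<noteq> m' + u" using that by (auto simp: Min_def)
    then show ?thesis
      using g_keys[OF that(4)] R_T[OF that(1)] g_LM[OF that(2)] by auto
  qed
  ultimately have "reduced_groebner_basis n ord J (g ` Min)"
    unfolding reduced_groebner_basis_def
  proof (intro conjI ballI)
    fix h h' t assume "h \<in> g ` Min" "h' \<in> g ` Min - {h}" "t \<in> Poly_Mapping.keys h"
    then obtain m m' where "m \<in> Min" "m' \<in> Min" "h = g m" "h' = g m'" "g m' \<noteq> g m"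
      "t \<in> Poly_Mapping.keys (g m)" by blast
    then show "\<nexists>u. t = LM h' + u" using red by blast
  qed (use g_nz g_LM g_lookup in auto)
  then show ?thesis by blast
qed

lemma groebner_basis_dvd:
  assumes "reduced_groebner_basis n ord J H" "J \<subseteq> polys {..<n}" "p \<in> J" "p \<noteq> 0"
  shows "\<exists>g\<in>H. \<exists>u. LM p = LM g + u"
  using assms leading_ideal_eq_iff[of J H]
  unfolding reduced_groebner_basis_def groebner_basis_def by blast

end


section \<open>Finite groups acting on finitely generated algebras\<close>

text \<open>
  The presentation of \<open>R\<close> as a quotient of \<open>K[x\<^sub>1, \<dots>, x\<^sub>n]\<close> appears as the surjectivity of
  evaluation at \<open>x\<close>, and the group structure of \<open>G\<close> is spelled out in terms of functions.
\<close>

locale invariant_setting = monomial_ordering n ord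
  for n :: nat and ord :: "monomial rel" +
  fixes \<iota> :: "'k::comm_ring_1 \<Rightarrow> 'r::idom" and x :: "nat \<Rightarrow> 'r" and G :: "('r \<Rightarrow> 'r) set"
  assumes noetherian_K: "noetherian (UNIV :: 'k set)"
    and hom_\<iota>: "unital_hom \<iota>"
    and generated: "\<exists>p\<in>polys {..<n}. mpoly_eval \<iota> x p = r"
    and finite_G: "finite G"
    and id_G: "(\<lambda>r. r) \<in> G"
    and comp_G: "\<sigma> \<in> G \<Longrightarrow> \<tau> \<in> G \<Longrightarrow> (\<lambda>r. \<sigma> (\<tau> r)) \<in> G"
    and inverse_G: "\<sigma> \<in> G \<Longrightarrow> \<exists>\<tau>\<in>G. (\<forall>r. \<tau> (\<sigma> r) = r) \<and> (\<forall>r. \<sigma> (\<tau> r) = r)"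
    and hom_G: "\<sigma> \<in> G \<Longrightarrow> unital_hom \<sigma>"
    and fix_\<iota>: "\<sigma> \<in> G \<Longrightarrow> \<sigma> (\<iota> c) = \<iota> c"
begin

lemma eq_0_iff_G: "\<sigma> \<in> G \<Longrightarrow> \<sigma> r = 0 \<longleftrightarrow> r = 0"
  using inverse_G[of \<sigma>] hom_G[of \<sigma>] unital_homD(2) hom_G by metis

lemma factor_G:
  assumes "\<sigma> \<in> G" "\<tau> \<in> G"
  obtains \<rho> where "\<rho> \<in> G" "\<And>r. \<sigma> (\<rho> r) = \<tau> r"
proof -
  obtain \<sigma>' where "\<sigma>' \<in> G" "\<forall>r. \<sigma> (\<sigma>' r) = r" using inverse_G[OF assms(1)] by blast
  then show ?thesis using that[of "\<lambda>r. \<sigma>' (\<tau> r)"] comp_G assms(2) by auto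
qed

lemma bij_betw_comp_G:
  assumes "\<sigma> \<in> G"
  shows "bij_betw (\<lambda>\<tau> r. \<sigma> (\<tau> r)) G G"
proof -
  obtain \<sigma>' where \<sigma>': "\<sigma>' \<in> G" "\<forall>r. \<sigma>' (\<sigma> r) = r" using inverse_G[OF assms] by blast
  have "inj_on (\<lambda>\<tau> r. \<sigma> (\<tau> r)) G"
  proof (rule inj_onI, rule ext)
    fix \<tau> \<tau>' r assume "(\<lambda>r. \<sigma> (\<tau> r)) = (\<lambda>r. \<sigma> (\<tau>' r))"
    then have "\<sigma> (\<tau> r) = \<sigma> (\<tau>' r)" by meson
    then show "\<tau> r = \<tau>' r" using \<sigma>'(2) by metis
  qed
  moreover have "(\<lambda>\<tau> r. \<sigma> (\<tau> r)) ` G \<subseteq> G" using comp_G[OF assms] by blast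
  ultimately show ?thesis
    using endo_inj_surj[OF finite_G] by (auto simp: bij_betw_def)
qed

lemma invariantsD: "r \<in> invariants G \<Longrightarrow> \<sigma> \<in> G \<Longrightarrow> \<sigma> r = r"
  by (simp add: invariants_def)

lemma unital_subring_invariants: "unital_subring (invariants G)"
  unfolding unital_subring_def invariants_def by (auto simp: unital_homD[OF hom_G])

lemma \<iota>_invariants: "range \<iota> \<subseteq> invariants G"
  by (auto simp: invariants_def fix_\<iota>)

lemma algebra_invariants: "S \<subseteq> invariants G \<Longrightarrow> subalgebra_generated \<iota> S \<subseteq> invariants G"
  by (intro algebra_minimal unital_subring_invariants \<iota>_invariants)

lemma invariants_cancel:
  assumes "a \<in> invariants G" "a \<noteq> 0" "a * r \<in> invariants G"
  shows "r \<in> invariants G"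
  unfolding invariants_def
proof safe
  fix \<sigma> assume "\<sigma> \<in> G"
  then have "a * \<sigma> r = a * r"
    using invariantsD[OF assms(1)] invariantsD[OF assms(3)] unital_homD(4)[OF hom_G] by metis
  then show "\<sigma> r = r" using assms(2) by simp
qed


section \<open>The Derksen ideal\<close>

text \<open>Modulo the \<open>y\<^sub>i - c\<^sub>i\<close> every polynomial is congruent to a constant, namely its value at \<open>c\<close>.\<close>

lemma ideal_of_point:
  fixes c :: "nat \<Rightarrow> 'a::comm_ring_1"
  shows "Idl\<^bsub>mpoly_ring {..<n}\<^esub> {Var i - Const (c i) | i. i < n} =
    {p \<in> polys {..<n}. mpoly_eval (\<lambda>b. b) c p = 0}"
proof -
  let ?S = "{Var i - Const (c i) | i. i < n}"
  let ?J = "module_span (polys {..<n}) ?S"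
  note e = unital_homD[OF unital_hom_mpoly_eval[OF unital_hom_id], of c]
  have S: "?S \<subseteq> polys {..<n}" by (auto intro!: polys_closed Var_in_polys Const_in_polys)
  note J = submoduleD[OF submodule_module_span[of "polys {..<n}" ?S]]
  have "is_submodule (polys {..<n}) {p \<in> polys {..<n}. mpoly_eval (\<lambda>b. b) c p = 0}"
    unfolding is_submodule_def by (auto simp: e intro: polys_closed)
  then have "?J \<subseteq> {p \<in> polys {..<n}. mpoly_eval (\<lambda>b. b) c p = 0}"
    using S by (intro module_span_minimal)
      (auto simp: e mpoly_eval_Var[OF unital_hom_id] mpoly_eval_Const)
  moreover have "\<exists>d. p - Const d \<in> ?J" if "p \<in> polys {..<n}" for p
    using that
  proof (induction rule: polys_induct)
    case (Const d)
    show ?case by (intro exI[of _ d]) (simp add: module_span.zero)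
  next
    case (Var i)
    then show ?case by (intro exI[of _ "c i"]) (auto intro: module_span.base)
  next
    case (add p q)
    then obtain d d' where "p - Const d \<in> ?J" "q - Const d' \<in> ?J" by blast
    then have "(p - Const d) + (q - Const d') \<in> ?J" by (rule module_span.add)
    then show ?case
      by (intro exI[of _ "d + d'"]) (simp add: unital_homD[OF unital_hom_Const] algebra_simps)
  next
    case (mult p q)
    then obtain d d' where "p - Const d \<in> ?J" "q - Const d' \<in> ?J" by blast
    then have "p * (q - Const d') + Const d' * (p - Const d) \<in> ?J"
      by (intro J(2,3) mult Const_in_polys)
    then show ?case
      by (intro exI[of _ "d * d'"]) (simp add: unital_homD[OF unital_hom_Const] algebra_simps)
  qed
  moreover have "p \<in> ?J"
    if "mpoly_eval (\<lambda>b. b) c p = 0" "p - Const d \<in> ?J" "?J \<subseteq> {p. mpoly_eval (\<lambda>b. b) c p = 0}" for p d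
  proof -
    have "mpoly_eval (\<lambda>b. b) c (p - Const d) = 0" using that by blast
    then have "d = 0" using that(1) by (simp add: e mpoly_eval_Const)
    then show ?thesis using that(2) by (simp add: unital_homD[OF unital_hom_Const])
  qed
  ultimately show ?thesis
    unfolding genideal_mpoly_ring[OF S] by blast
qed

abbreviation conjugate_eval :: "('r \<Rightarrow> 'r) \<Rightarrow> 'r fract mpoly \<Rightarrow> 'r fract" where
  "conjugate_eval \<sigma> \<equiv> mpoly_eval (\<lambda>b. b) (\<lambda>i. to_fract (\<sigma> (x i)))"

lemma conjugate_eval_map:
  "conjugate_eval \<sigma> (Poly_Mapping.map to_fract q) = to_fract (mpoly_eval (\<lambda>b. b) (\<lambda>i. \<sigma> (x i)) q)"
  by (simp add: mpoly_eval_map hom_mpoly_eval[OF unital_hom_to_fract])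

lemma in_derksen_ideal_iff:
  "p \<in> derksen_ideal n x G \<longleftrightarrow> p \<in> polys {..<n} \<and> (\<forall>\<sigma>\<in>G. conjugate_eval \<sigma> p = 0)"
  unfolding derksen_ideal_def ideal_of_point using id_G by auto

lemma derksen_submodule: "is_submodule (polys {..<n}) (derksen_ideal n x G)"
  unfolding is_submodule_def
  by (auto simp: in_derksen_ideal_iff unital_homD[OF unital_hom_mpoly_eval[OF unital_hom_id]] intro: polys_closed)

lemma derksen_subset: "derksen_ideal n x G \<subseteq> polys {..<n}"
  using in_derksen_ideal_iff by blast

text \<open>
  The conjugate of \<open>g\<close> by \<open>\<sigma>\<close> lies in the Derksen ideal and has the same monomials as \<open>g\<close>.  As
  the leading coefficient is \<open>1\<close>, the leading monomial of the difference would be a smaller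
  monomial of \<open>g\<close>, and divisible by a leading monomial of the basis, which is
  excluded in a reduced basis.  To avoid extending the action to the field of fractions, the
  argument is carried out for the multiple \<open>a\<^sup>k g\<close>, whose coefficients lie in \<open>R\<close>.
\<close>

lemma coefficients_invariant:
  assumes H: "reduced_groebner_basis n ord (derksen_ideal n x G) H" and g: "g \<in> H"
    and a: "a \<in> invariants G" "a \<noteq> 0"
    and integral: "Const (to_fract a ^ k) * g \<in> integral_mpolys n"
    and r: "to_fract r = to_fract a ^ e * Poly_Mapping.lookup g t"
  shows "r \<in> invariants G"
  unfolding invariants_def
proof safe
  fix \<sigma> assume \<sigma>: "\<sigma> \<in> G"
  note hom_\<sigma> = unital_homD[OF hom_G[OF \<sigma>]]
  have gD: "g \<in> derksen_ideal n x G"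
    using H g by (auto simp: reduced_groebner_basis_def groebner_basis_def)
  then have gp: "g \<in> polys {..<n}" using derksen_subset by blast
  have g1: "g \<noteq> 0" "Poly_Mapping.lookup g (LM g) = 1"
    using H g by (auto simp: reduced_groebner_basis_def)
  \<comment> \<open>\<open>q\<close> is \<open>a\<^sup>k g\<close> as a polynomial over \<open>R\<close>, where \<open>\<sigma>\<close> can be applied to the coefficients.\<close>
  define q where "q = Poly_Mapping.map (inv_into UNIV to_fract) (Const (to_fract a ^ k) * g)"
  have inv: "inv_into UNIV to_fract (to_fract b) = b" for b :: 'r
    by (rule inv_f_f) (simp add: inj_def)
  have look: "Poly_Mapping.lookup (Const (to_fract a ^ k) * g) s =
      to_fract a ^ k * Poly_Mapping.lookup g s" for s
    unfolding Const_def mult_map_scale_conv_mult[symmetric] by (simp add: lookup_map)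
  have lookup_q: "to_fract (Poly_Mapping.lookup q s) = to_fract a ^ k * Poly_Mapping.lookup g s" for s
  proof -
    have "Poly_Mapping.lookup (Const (to_fract a ^ k) * g) s \<in> range to_fract"
    proof (cases "s \<in> Poly_Mapping.keys (Const (to_fract a ^ k) * g)")
      case True
      then show ?thesis using integral by (auto simp: integral_mpolys_def coefficients_def)
    next
      case False
      then show ?thesis by (metis in_keys_iff rangeI to_fract_0)
    qed
    moreover have "inv_into UNIV to_fract (0 :: 'r fract) = 0" using inv[of 0] by simp
    ultimately show ?thesis unfolding q_def by (auto simp: lookup_map look inv)
  qed
  have map_q: "Poly_Mapping.map to_fract q = Const (to_fract a ^ k) * g"
    by (rule poly_mapping_eqI) (simp add: lookup_map look lookup_q)
  have "q \<in> polys {..<n}"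
    unfolding q_def by (intro map_in_polys polys_closed Const_in_polys gp)
  define w where "w = Poly_Mapping.map to_fract (q - Poly_Mapping.map \<sigma> q)"
  have lookup_w: "Poly_Mapping.lookup w s =
      to_fract (Poly_Mapping.lookup q s - \<sigma> (Poly_Mapping.lookup q s))" for s
    by (simp add: w_def lookup_map lookup_minus hom_\<sigma>)
  have q_vanish: "mpoly_eval (\<lambda>b. b) (\<lambda>i. \<tau> (x i)) q = 0" if "\<tau> \<in> G" for \<tau>
  proof -
    have "to_fract (mpoly_eval (\<lambda>b. b) (\<lambda>i. \<tau> (x i)) q) = conjugate_eval \<tau> (Const (to_fract a ^ k) * g)"
      by (simp add: conjugate_eval_map[symmetric] map_q)
    also have "\<dots> = 0"
      using gD that in_derksen_ideal_iff
      by (simp add: unital_homD[OF unital_hom_mpoly_eval[OF unital_hom_id]])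
    finally show ?thesis by simp
  qed
  have "conjugate_eval \<tau> w = 0" if \<tau>: "\<tau> \<in> G" for \<tau>
  proof -
    obtain \<rho> where \<rho>: "\<rho> \<in> G" "\<And>r. \<sigma> (\<rho> r) = \<tau> r" using factor_G[OF \<sigma> \<tau>] by blast
    have "mpoly_eval (\<lambda>b. b) (\<lambda>i. \<tau> (x i)) (Poly_Mapping.map \<sigma> q) =
        \<sigma> (mpoly_eval (\<lambda>b. b) (\<lambda>i. \<rho> (x i)) q)"
      by (simp add: mpoly_eval_map hom_\<sigma> hom_mpoly_eval[OF hom_G[OF \<sigma>]] \<rho>)
    then have "mpoly_eval (\<lambda>b. b) (\<lambda>i. \<tau> (x i)) (q - Poly_Mapping.map \<sigma> q) = 0"
      using q_vanish \<tau> \<rho>(1) hom_\<sigma>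
      by (simp add: unital_homD[OF unital_hom_mpoly_eval[OF unital_hom_id]])
    then show ?thesis unfolding w_def conjugate_eval_map by simp
  qed
  moreover have wp: "w \<in> polys {..<n}"
    unfolding w_def using \<open>q \<in> polys {..<n}\<close> by (intro map_in_polys polys_closed) auto
  ultimately have wD: "w \<in> derksen_ideal n x G" by (simp add: in_derksen_ideal_iff)
  have w_keys: "Poly_Mapping.keys w \<subseteq> Poly_Mapping.keys g"
  proof
    fix s assume "s \<in> Poly_Mapping.keys w"
    then have "Poly_Mapping.lookup q s \<noteq> 0" by (auto simp: in_keys_iff lookup_w hom_\<sigma>)
    then show "s \<in> Poly_Mapping.keys g"
      using lookup_q[of s] by (auto simp: in_keys_iff)
  qed
  have "w = 0"
  proof (rule ccontr)
    assume "w \<noteq> 0"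
    note LMw = LM_greatest[OF wp this]
    obtain h u where h: "h \<in> H" "LM w = LM h + u"
      using groebner_basis_dvd[OF H derksen_subset wD \<open>w \<noteq> 0\<close>] by blast
    have "LM w \<in> Poly_Mapping.keys g" using LMw(1) w_keys by blast
    then have "h = g" using H g h unfolding reduced_groebner_basis_def by blast
    then have "LM w = LM g"
      using h ord_dvd[of "LM g" u] LMw(3) LM_greatest(2)[OF gp g1(1)] \<open>LM w \<in> Poly_Mapping.keys g\<close>
        ord_antisym by metis
    moreover have "Poly_Mapping.lookup q (LM g) = a ^ k"
      using lookup_q[of "LM g"] g1
      by (metis mult.right_neutral to_fract_eq_iff unital_homD(7)[OF unital_hom_to_fract])
    ultimately have "Poly_Mapping.lookup w (LM w) = 0"
      using invariantsD[OF a(1) \<sigma>] by (simp add: lookup_w hom_\<sigma>)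
    then show False using LMw(1) by (simp add: in_keys_iff)
  qed
  then have q_inv: "\<sigma> (Poly_Mapping.lookup q t) = Poly_Mapping.lookup q t"
    using lookup_w[of t] by simp
  have "to_fract (a ^ k * r) = to_fract (a ^ e * Poly_Mapping.lookup q t)"
    by (simp add: r lookup_q unital_homD[OF unital_hom_to_fract])
  then have eq: "a ^ k * r = a ^ e * Poly_Mapping.lookup q t" by (simp only: to_fract_eq_iff)
  then have "a ^ k * \<sigma> r = a ^ k * r"
    using q_inv invariantsD[OF a(1) \<sigma>] hom_\<sigma> by metis
  then show "\<sigma> r = r" using a(2) by simp
qed

lemma common_denominator:
  assumes "finite S"
  shows "\<exists>d. d \<noteq> (0 :: 'r) \<and> (\<forall>s\<in>S. to_fract d * s \<in> range to_fract)"
  using assms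
proof induction
  case empty
  show ?case by (intro exI[of _ 1]) auto
next
  case (insert s S)
  then obtain d where d: "d \<noteq> 0" "\<forall>s\<in>S. to_fract d * s \<in> range to_fract" by blast
  obtain b c where s: "s = Fract b c" "c \<noteq> 0" by (cases s) auto
  have "to_fract (c * d) * s' \<in> range to_fract" if s': "s' \<in> insert s S" for s'
  proof (cases "s' = s")
    case True
    have "to_fract (c * d) * s = to_fract (b * d)"
      using s by (simp add: Fract_conv_to_fract)
    then show ?thesis unfolding True by (rule image_eqI) simp
  next
    case False
    then obtain b' where "to_fract d * s' = to_fract b'" using d s' by blast
    then have "to_fract (c * d) * s' = to_fract (c * b')" by (simp add: mult.assoc)
    then show ?thesis by (rule image_eqI) simp
  qed
  then show ?case using d s by (intro exI[of _ "c * d"]) auto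
qed

text \<open>
  Replacing a common denominator by its norm, the product of its conjugates, makes it invariant.
\<close>

lemma invariant_denominator:
  assumes "finite S"
  shows "\<exists>a\<in>invariants G. a \<noteq> 0 \<and> (\<forall>s\<in>S. to_fract a * s \<in> range to_fract)"
proof -
  obtain d :: 'r where d: "d \<noteq> 0" "\<forall>s\<in>S. to_fract d * s \<in> range to_fract"
    using common_denominator[OF assms] by blast
  define a where "a = (\<Prod>\<sigma>\<in>G. \<sigma> d)"
  have "\<sigma> a = a" if "\<sigma> \<in> G" for \<sigma>
  proof -
    have "\<sigma> a = (\<Prod>\<tau>\<in>G. \<sigma> (\<tau> d))" by (simp add: a_def unital_hom_prod[OF hom_G[OF that]])
    also have "\<dots> = a"
      unfolding a_def by (rule prod.reindex_bij_betw[OF bij_betw_comp_G[OF that], of "\<lambda>\<tau>. \<tau> d"])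
    finally show ?thesis .
  qed
  then have "a \<in> invariants G" by (auto simp: invariants_def)
  moreover have "a \<noteq> 0" unfolding a_def using d finite_G by (simp add: eq_0_iff_G)
  moreover have "to_fract a * s \<in> range to_fract" if s: "s \<in> S" for s
  proof -
    define b where "b = (\<Prod>\<sigma>\<in>G - {\<lambda>r. r}. \<sigma> d)"
    have "a = b * d"
      unfolding a_def b_def using prod.remove[OF finite_G id_G, of "\<lambda>\<sigma>. \<sigma> d"] by simp
    moreover obtain c where "to_fract d * s = to_fract c" using d s by blast
    ultimately have "to_fract a * s = to_fract (b * c)" by (simp add: mult.assoc)
    then show ?thesis by (rule image_eqI) simp
  qed
  ultimately show ?thesis by blast
qed

lemma localization_base: "r \<in> B \<Longrightarrow> to_fract r \<in> localization_at B a"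
  unfolding localization_at_def by (auto intro!: exI[of _ "0 :: nat"])

lemma unital_subring_localization:
  assumes "unital_subring B" "a \<in> B" "a \<noteq> 0"
  shows "unital_subring (localization_at B a)"
  unfolding unital_subring_def
proof (intro conjI ballI)
  note B = unital_subringD[OF assms(1)] unital_subring_power[OF assms(1,2)]
  note f = unital_homD[OF unital_hom_to_fract]
  show "1 \<in> localization_at B a"
    using localization_base[OF B(1), of a] by simp
  fix b c assume "b \<in> localization_at B a" "c \<in> localization_at B a"
  then obtain r s k l where bc: "r \<in> B" "s \<in> B" "b = to_fract r / to_fract a ^ k"
    "c = to_fract s / to_fract a ^ l" by (auto simp: localization_at_def)
  have "b - c = to_fract (r * a ^ l - s * a ^ k) / to_fract a ^ (k + l)"
    using assms(3) by (simp add: bc f power_add field_simps)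
  moreover have "r * a ^ l - s * a ^ k \<in> B" using bc by (intro B) auto
  ultimately show "b - c \<in> localization_at B a" unfolding localization_at_def by blast
  have "b * c = to_fract (r * s) / to_fract a ^ (k + l)"
    by (simp add: bc f power_add)
  then show "b * c \<in> localization_at B a"
    unfolding localization_at_def using B(6) bc by blast
qed

text \<open>
  The reason why the coefficients of the basis generate the invariants up to denominators:
  if \<open>f = F(x)\<close> is invariant, then \<open>F - f\<close> vanishes on the orbit of \<open>x\<close>, so that \<open>f\<close> is the normal
  form of \<open>F\<close> modulo the Derksen ideal.  As \<open>F\<close> and the monic basis have coefficients in
  \<open>B[a\<inverse>]\<close>, so has the normal form.
\<close>

lemma invariants_in_localization:
  assumes H: "reduced_groebner_basis n ord (derksen_ideal n x G) H"
    and B: "unital_subring B" "range \<iota> \<subseteq> B" and a: "a \<in> B" "a \<noteq> 0"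
    and coeffs: "\<And>s. s \<in> coefficients H \<Longrightarrow> s \<in> localization_at B a"
    and f: "f \<in> invariants G"
  shows "to_fract f \<in> localization_at B a"
proof -
  let ?D = "derksen_ideal n x G" and ?C = "localization_at B a"
  have C: "unital_subring ?C" by (rule unital_subring_localization[OF B(1) a])
  obtain F where F: "F \<in> polys {..<n}" "mpoly_eval \<iota> x F = f" using generated by blast
  define P where "P = Poly_Mapping.map (\<lambda>c. to_fract (\<iota> c)) F"
  have P: "P \<in> polys {..<n}" unfolding P_def by (rule map_in_polys[OF F(1)])
  have P_eval: "conjugate_eval \<sigma> P = to_fract f" if "\<sigma> \<in> G" for \<sigma>
  proof -
    have "conjugate_eval \<sigma> P = mpoly_eval (\<lambda>c. to_fract (\<sigma> (\<iota> c))) (\<lambda>i. to_fract (\<sigma> (x i))) F"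
      unfolding P_def by (simp add: mpoly_eval_map unital_homD[OF hom_\<iota>] fix_\<iota>[OF that])
    also have "\<dots> = to_fract (\<sigma> (mpoly_eval \<iota> x F))"
      by (simp add: hom_mpoly_eval[OF hom_G[OF that]] hom_mpoly_eval[OF unital_hom_to_fract])
    also have "\<dots> = to_fract f" using F(2) invariantsD[OF f that] by simp
    finally show ?thesis .
  qed
  have HD: "H \<subseteq> ?D" using H by (auto simp: reduced_groebner_basis_def groebner_basis_def)
  have P_C: "Poly_Mapping.lookup P s \<in> ?C" for s
    unfolding P_def using B(2) by (auto simp: lookup_map unital_homD[OF hom_\<iota>] intro!: localization_base)
  have H_C: "Poly_Mapping.lookup h s \<in> ?C" if "h \<in> H" for h s
  proof (cases "s \<in> Poly_Mapping.keys h")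
    case True
    then show ?thesis using that by (intro coeffs) (auto simp: coefficients_def)
  next
    case False
    then show ?thesis using unital_subringD(2)[OF C] by (simp add: in_keys_iff)
  qed
  have monic: "h \<noteq> 0 \<and> Poly_Mapping.lookup h (LM h) = 1" if "h \<in> H" for h
    using H that by (auto simp: reduced_groebner_basis_def)
  obtain r where r: "r \<in> polys {..<n}" "\<And>s. Poly_Mapping.lookup r s \<in> ?C" "P - r \<in> ?D"
    "\<And>s h u. s \<in> Poly_Mapping.keys r \<Longrightarrow> h \<in> H \<Longrightarrow> s \<noteq> LM h + u"
    using normal_form[OF derksen_submodule C HD subset_trans[OF HD derksen_subset] monic H_C P P_C]
    by auto
  note ev = unital_homD[OF unital_hom_mpoly_eval[OF unital_hom_id]]
  define w where "w = r - Const (to_fract f)"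
  have wp: "w \<in> polys {..<n}" unfolding w_def by (intro polys_closed r Const_in_polys)
  have "conjugate_eval \<sigma> w = 0" if "\<sigma> \<in> G" for \<sigma>
    using r(3) that P_eval[OF that] unfolding in_derksen_ideal_iff w_def
    by (simp add: ev mpoly_eval_Const)
  then have wD: "w \<in> ?D" using wp by (simp add: in_derksen_ideal_iff)
  \<comment> \<open>The only monomial of \<open>w\<close> that may be reducible is \<open>1\<close>; but if \<open>1\<close> is the leading monomial,
    then \<open>w\<close> is a constant that vanishes on the orbit.\<close>
  have "w = 0"
  proof (rule ccontr)
    assume w0: "w \<noteq> 0"
    note LMw = LM_greatest[OF wp w0]
    obtain h u where h: "h \<in> H" "LM w = LM h + u"
      using groebner_basis_dvd[OF H derksen_subset wD w0] by blast
    then have "LM w \<notin> Poly_Mapping.keys r" using r(4) by blast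
    then have LM0: "LM w = 0"
      using LMw(1)
      by (auto simp: in_keys_iff w_def lookup_minus Const_def lookup_single when_def split: if_splits)
    have "Poly_Mapping.keys w \<subseteq> {0}"
    proof
      fix s assume "s \<in> Poly_Mapping.keys w"
      then have "(s, 0) \<in> ord" "(0, s) \<in> ord"
        using LMw(2) LM0 wp ord_zero by (auto simp: in_polys_iff)
      then show "s \<in> {0}" using ord_antisym by blast
    qed
    then have "w = Const (Poly_Mapping.lookup w 0)"
      by (intro poly_mapping_eqI) (auto simp: Const_def lookup_single when_def in_keys_iff)
    then have "conjugate_eval (\<lambda>r. r) w = Poly_Mapping.lookup w 0"
      by (metis mpoly_eval_Const)
    then have "Poly_Mapping.lookup w 0 = 0"
      using bspec[OF conjunct2[OF wD[unfolded in_derksen_ideal_iff]] id_G] by simp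
    then show False using LMw(1) LM0 by (simp add: in_keys_iff)
  qed
  then have "r = Const (to_fract f)" by (simp add: w_def)
  then have "to_fract f = Poly_Mapping.lookup r 0" by (simp add: Const_def)
  then show ?thesis using r(2) by simp
qed

lemma localization_eqI:
  assumes B: "unital_subring B" "a \<in> B" "B \<subseteq> invariants G" "a \<noteq> 0"
    and inv: "\<And>f. f \<in> invariants G \<Longrightarrow> to_fract f \<in> localization_at B a"
  shows "localization_at (invariants G) a = localization_at B a"
proof
  show "localization_at B a \<subseteq> localization_at (invariants G) a"
    using B(3) unfolding localization_at_def by blast
  show "localization_at (invariants G) a \<subseteq> localization_at B a"
  proof
    fix b assume "b \<in> localization_at (invariants G) a"
    then obtain r k where b: "r \<in> invariants G" "b = to_fract r / to_fract a ^ k"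
      by (auto simp: localization_at_def)
    then obtain s l where "s \<in> B" "to_fract r = to_fract s / to_fract a ^ l"
      using inv[OF b(1)] by (auto simp: localization_at_def)
    then show "b \<in> localization_at B a"
      unfolding localization_at_def b(2)
      by (auto intro!: exI[of _ s] exI[of _ "l + k"] simp: power_add)
  qed
qed

end


context invariant_setting
begin

section \<open>Finite generation of the invariant ring\<close>

text \<open>
  The coefficients of \<open>\<Prod>\<sigma>\<in>G. (X - \<sigma> r)\<close> are invariant because applying an element
  of \<open>G\<close> permutes the factors.
\<close>

lemma invariant_orbit_polynomial:
  "Polynomial.coeff (\<Prod>\<sigma>\<in>G. [:- \<sigma> r, 1:]) i \<in> invariants G"
  unfolding invariants_def
proof safe
  fix \<tau> assume \<tau>: "\<tau> \<in> G"
  note h = unital_homD[OF hom_G[OF \<tau>]] unital_hom_sum[OF hom_G[OF \<tau>]]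
  have mult: "map_poly \<tau> (p * q) = map_poly \<tau> p * map_poly \<tau> q" for p q
    by (rule poly_eqI) (simp add: coeff_map_poly h coeff_mult)
  have "map_poly \<tau> (prod f T) = (\<Prod>\<sigma>\<in>T. map_poly \<tau> (f \<sigma>))" if "finite T" for f and T :: "('r \<Rightarrow> 'r) set"
    using that by induction (auto simp: mult map_poly_1 h)
  then have "map_poly \<tau> (\<Prod>\<sigma>\<in>G. [:- \<sigma> r, 1:]) = (\<Prod>\<sigma>\<in>G. [:- \<tau> (\<sigma> r), 1:])"
    using finite_G by (simp add: map_poly_pCons h)
  also have "\<dots> = (\<Prod>\<sigma>\<in>G. [:- \<sigma> r, 1:])"
    by (rule prod.reindex_bij_betw[OF bij_betw_comp_G[OF \<tau>], of "\<lambda>\<sigma>. [:- \<sigma> r, 1:]"])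
  finally show "\<tau> (Polynomial.coeff (\<Prod>\<sigma>\<in>G. [:- \<sigma> r, 1:]) i) =
      Polynomial.coeff (\<Prod>\<sigma>\<in>G. [:- \<sigma> r, 1:]) i"
    by (metis coeff_map_poly h(2))
qed

lemma orbit_polynomial:
  "poly (\<Prod>\<sigma>\<in>G. [:- \<sigma> r, 1:]) r = 0" "Polynomial.degree (\<Prod>\<sigma>\<in>G. [:- \<sigma> r, 1:]) = card G"
  "Polynomial.coeff (\<Prod>\<sigma>\<in>G. [:- \<sigma> r, 1:]) (card G) = 1"
proof -
  have "poly (\<Prod>\<sigma>\<in>G. [:- \<sigma> r, 1:]) r = (\<Prod>\<sigma>\<in>G. r - \<sigma> r)"
    by (simp add: poly_prod)
  also have "\<dots> = 0"
    using finite_G by (rule prod_zero) (use id_G in \<open>intro bexI[of _ "\<lambda>r. r"], auto\<close>)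
  finally show "poly (\<Prod>\<sigma>\<in>G. [:- \<sigma> r, 1:]) r = 0" .
  show deg: "Polynomial.degree (\<Prod>\<sigma>\<in>G. [:- \<sigma> r, 1:]) = card G"
    by (subst degree_prod_eq_sum_degree) auto
  have "lead_coeff (\<Prod>\<sigma>\<in>G. [:- \<sigma> r, 1:]) = 1"
    by (simp add: lead_coeff_prod)
  then show "Polynomial.coeff (\<Prod>\<sigma>\<in>G. [:- \<sigma> r, 1:]) (card G) = 1" using deg by simp
qed

text \<open>
  Noether's argument: \<open>R\<close> is a finite module over the Noetherian subalgebra generated by the
  coefficients of the polynomials \<open>\<Prod>\<sigma>. (X - \<sigma> x\<^sub>i)\<close>, hence so is its submodule of invariants.
\<close>

theorem invariants_finitely_generated:
  "\<exists>S. finite S \<and> S \<subseteq> invariants G \<and> invariants G \<subseteq> subalgebra_generated \<iota> S"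
proof -
  define P where "P i = (\<Prod>\<sigma>\<in>G. [:- \<sigma> (x i), 1:])" for i
  define d where "d = card G"
  define S0 where "S0 = (\<lambda>(i, k). Polynomial.coeff (P i) k) ` ({..<n} \<times> {..d})"
  define A where "A = subalgebra_generated \<iota> S0"
  have S0: "finite S0" "S0 \<subseteq> invariants G"
    unfolding S0_def P_def using invariant_orbit_polynomial by auto
  have A: "unital_subring A" "noetherian A"
    unfolding A_def by (intro unital_subring_algebra noetherian_algebra noetherian_K hom_\<iota> S0)+
  have A_inv: "A \<subseteq> invariants G" unfolding A_def by (rule algebra_invariants[OF S0(2)])
  have P_A: "Polynomial.coeff (P i) k \<in> A" if i: "i < n" for i k
  proof (cases "k \<le> d")
    case True
    then show ?thesis using i algebra_base(2)[of S0 \<iota>] by (auto simp: A_def S0_def)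
  next
    case False
    then have "Polynomial.coeff (P i) k = 0"
      unfolding P_def by (intro coeff_eq_0) (simp add: orbit_polynomial d_def)
    then show ?thesis using unital_subringD(2)[OF A(1)] by simp
  qed
  have "0 < d" unfolding d_def using finite_G id_G by (auto simp: card_gt_0_iff)
  have x_pow: "x i ^ d = (\<Sum>k<d. - Polynomial.coeff (P i) k * x i ^ k)" if "i < n" for i
  proof -
    have "(\<Sum>k\<le>d. Polynomial.coeff (P i) k * x i ^ k) = 0"
      using orbit_polynomial[of "x i"] unfolding poly_altdef P_def d_def by simp
    moreover have "Polynomial.coeff (P i) d = 1"
      using orbit_polynomial(3)[of "x i"] by (simp add: P_def d_def)
    ultimately have "(\<Sum>k<d. Polynomial.coeff (P i) k * x i ^ k) + x i ^ d = 0"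
      by (simp add: lessThan_Suc_atMost[symmetric])
    then show ?thesis by (simp add: sum_negf eq_neg_iff_add_eq_0 add.commute)
  qed
  \<comment> \<open>\<open>R\<close> is spanned over \<open>A\<close> by the monomials with all exponents below \<open>d\<close>: multiplication by \<open>x\<^sub>i\<close>
    preserves their span because \<open>x\<^sub>i\<^sup>d\<close> is a combination of lower powers.\<close>
  define M where "M = (\<lambda>e. \<Prod>i<n. x i ^ e i) ` ({..<n} \<rightarrow>\<^sub>E {..<d})"
  have M: "finite M" unfolding M_def by (intro finite_imageI finite_PiE) auto
  have M_I: "(\<Prod>i<n. x i ^ e i) \<in> M" if "\<And>i. i < n \<Longrightarrow> e i < d" for e
    unfolding M_def using that
    by (intro image_eqI[of _ _ "restrict e {..<n}"]) (auto simp: PiE_def)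
  let ?W = "module_span A M"
  note W = submoduleD[OF submodule_module_span[of A M]]
  have W_x: "x i * w \<in> ?W" if i: "i < n" and w: "w \<in> ?W" for i w
    using w
  proof induction
    case (base m)
    then obtain e where e: "\<And>j. j < n \<Longrightarrow> e j < d" "m = (\<Prod>j<n. x j ^ e j)"
      by (auto simp: M_def PiE_def Pi_def)
    have split: "(\<Prod>j<n. x j ^ (e(i := k)) j) = x i ^ k * (\<Prod>j\<in>{..<n} - {i}. x j ^ e j)" for k
      using i by (subst prod.remove[of _ i]) (auto intro!: prod.cong)
    have m: "x i * m = x i ^ Suc (e i) * (\<Prod>j\<in>{..<n} - {i}. x j ^ e j)"
      using split[of "e i"] e(2) by (simp add: mult.assoc)
    have in_M: "x i ^ k * (\<Prod>j\<in>{..<n} - {i}. x j ^ e j) \<in> M" if "k < d" for k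
      unfolding split[symmetric] by (rule M_I) (use e(1) that in auto)
    show ?case
    proof (cases "Suc (e i) = d")
      case False
      then have "Suc (e i) < d" using e(1)[OF i] by simp
      then show ?thesis unfolding m by (intro module_span.base in_M)
    next
      case True
      have "x i * m = (\<Sum>k<d. - Polynomial.coeff (P i) k *
          (x i ^ k * (\<Prod>j\<in>{..<n} - {i}. x j ^ e j)))"
        unfolding m True x_pow[OF i] by (simp add: sum_distrib_right mult.assoc)
      also have "\<dots> \<in> ?W"
        using P_A[OF i] by (intro submodule_sum[OF submodule_module_span] module_span.scale
            module_span.base in_M unital_subringD(3)[OF A(1)]) auto
      finally show ?thesis .
    qed
  next
    case (add u v)
    then show ?case by (simp add: distrib_left module_span.add)
  next
    case (scale c v)
    then have "c * (x i * v) \<in> ?W" by (intro module_span.scale[OF scale(1)])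
    then show ?case by (simp add: mult.left_commute)
  qed (simp add: module_span.zero)
  have W_mult: "mpoly_eval \<iota> x p * w \<in> ?W" if "p \<in> polys {..<n}" "w \<in> ?W" for p w
    using that
  proof (induction arbitrary: w rule: polys_induct)
    case (Const c)
    have "\<iota> c \<in> A" unfolding A_def using algebra_base(1) by blast
    then show ?case
      using Const by (simp add: mpoly_eval_Const unital_homD[OF hom_\<iota>] module_span.scale)
  next
    case (Var i)
    then show ?case using W_x by (simp add: mpoly_eval_Var[OF hom_\<iota>])
  next
    case (add p q)
    then show ?case
      by (simp add: unital_homD[OF unital_hom_mpoly_eval[OF hom_\<iota>]] distrib_right module_span.add)
  next
    case (mult p q)
    then show ?case
      by (simp add: unital_homD[OF unital_hom_mpoly_eval[OF hom_\<iota>]] mult.assoc)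
  qed
  have "1 \<in> M" using M_I[of "\<lambda>_. 0"] \<open>0 < d\<close> by simp
  then have "r \<in> ?W" for r
    using generated[of r] W_mult[of _ 1] by (metis module_span.base mult.right_neutral)
  moreover have "is_submodule A (invariants G)"
    unfolding is_submodule_def
    using unital_subringD(2,4,6)[OF unital_subring_invariants] subsetD[OF A_inv] by simp
  ultimately obtain F where F: "finite F" "F \<subseteq> invariants G" "invariants G \<subseteq> module_span A F"
    using noetherian_submodule_fg[OF A M, of "invariants G"] by blast
  let ?B = "subalgebra_generated \<iota> (S0 \<union> F)"
  note B = unital_subringD[OF unital_subring_algebra[of \<iota> "S0 \<union> F"]]
  have "A \<subseteq> ?B" unfolding A_def by (rule algebra_mono) simp
  then have "is_submodule A ?B" unfolding is_submodule_def using B(2,4,6) by (simp add: subset_iff)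
  then have "module_span A F \<subseteq> ?B"
    using algebra_base(2)[of "S0 \<union> F" \<iota>] by (intro module_span_minimal) auto
  then show ?thesis using F S0 by (intro exI[of _ "S0 \<union> F"]) auto
qed


section \<open>The ideals of the unlocalization procedure\<close>

definition full_point :: "'k mpoly list \<Rightarrow> nat \<Rightarrow> 'r" where
  "full_point fs j = (if j < n then x j else mpoly_eval \<iota> x (fs ! (j - n)))"

abbreviation full_eval :: "'k mpoly list \<Rightarrow> 'k mpoly \<Rightarrow> 'r" where
  "full_eval fs \<equiv> mpoly_eval \<iota> (full_point fs)"

lemmas full_eval_hom = unital_homD[OF unital_hom_mpoly_eval[OF hom_\<iota>]]

lemma full_eval_y: "p \<in> polys {..<n} \<Longrightarrow> full_eval fs p = mpoly_eval \<iota> x p"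
  by (erule mpoly_eval_cong) (simp add: full_point_def)

lemma full_eval_z: "p \<in> carrier (z_ring n fs) \<Longrightarrow> full_eval fs p = z_eval n \<iota> x fs p"
  unfolding z_eval_def z_ring_def by (erule mpoly_eval_cong) (simp add: full_point_def)

lemma z_ring_subset: "carrier (z_ring n fs) \<subseteq> polys {..<n + length fs}"
  unfolding z_ring_def by (rule polys_mono) auto

lemma y_ring_subset: "polys {..<n} \<subseteq> polys {..<n + m}"
  by (rule polys_mono) auto

lemma algebra_of_eq_z_eval: "algebra_of \<iota> x fs = z_eval n \<iota> x fs ` carrier (z_ring n fs)"
proof -
  have "(\<lambda>j. mpoly_eval \<iota> x (fs ! (j - n))) ` {n..<n + length fs} = mpoly_eval \<iota> x ` set fs"
  proof -
    have "{n..<n + length fs} = (+) n ` {..<length fs}"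
      by (simp add: lessThan_atLeast0 add.commute)
    then have "(\<lambda>j. mpoly_eval \<iota> x (fs ! (j - n))) ` {n..<n + length fs} =
        mpoly_eval \<iota> x ` ((!) fs ` {..<length fs})"
      by (simp add: image_image)
    then show ?thesis using nth_image[of "length fs" fs] by (simp add: lessThan_atLeast0)
  qed
  then show ?thesis
    unfolding algebra_of_def z_ring_def z_eval_def eval_image_eq_algebra[OF hom_\<iota>] by simp
qed

context
  fixes fs :: "'k mpoly list"
  assumes fs: "set fs \<subseteq> polys {..<n}"
begin

text \<open>
  Modulo the \<open>z\<^sub>i - f\<^sub>i\<close> every polynomial is congruent to one in the variables \<open>y\<close> only, and this one
  has the same value; if the value is \<open>0\<close>, it is a relation among the \<open>x\<^sub>i\<close>.
\<close>

lemma in_ideal_L_hat_iff: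
  "p \<in> ideal_L_hat n \<iota> x fs \<longleftrightarrow> p \<in> polys {..<n + length fs} \<and> full_eval fs p = 0"
proof
  let ?P = "polys {..<n + length fs}"
  let ?S = "relation_ideal n \<iota> x \<union> {Var (n + i) - fs ! i | i. i < length fs}"
  have S: "?S \<subseteq> ?P"
  proof (intro Un_least subsetI)
    show "p \<in> ?P" if "p \<in> relation_ideal n \<iota> x" for p
      using that y_ring_subset by (auto simp: relation_ideal_def)
    show "p \<in> ?P" if "p \<in> {Var (n + i) - fs ! i | i. i < length fs}" for p
    proof -
      obtain i where i: "i < length fs" "p = Var (n + i) - fs ! i" using \<open>p \<in> _\<close> by blast
      then have "fs ! i \<in> polys {..<n}" using fs by auto
      then show ?thesis using i y_ring_subset by (auto intro!: polys_closed Var_in_polys)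
    qed
  qed
  have L: "ideal_L_hat n \<iota> x fs = module_span ?P ?S"
    unfolding ideal_L_hat_def by (rule genideal_mpoly_ring[OF S])
  have "is_submodule ?P {p \<in> ?P. full_eval fs p = 0}"
    unfolding is_submodule_def by (auto simp: full_eval_hom intro: polys_closed)
  moreover have "full_eval fs p = 0" if "p \<in> ?S" for p
    using that
  proof
    assume "p \<in> relation_ideal n \<iota> x"
    then show ?thesis by (simp add: relation_ideal_def full_eval_y)
  next
    assume "p \<in> {Var (n + i) - fs ! i | i. i < length fs}"
    then obtain i where i: "i < length fs" "p = Var (n + i) - fs ! i" by blast
    then have "fs ! i \<in> polys {..<n}" using fs by auto
    then show ?thesis
      by (simp add: i full_eval_hom mpoly_eval_Var[OF hom_\<iota>] full_eval_y) (simp add: full_point_def)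
  qed
  ultimately have sub: "module_span ?P ?S \<subseteq> {p \<in> ?P. full_eval fs p = 0}"
    using S by (intro module_span_minimal) auto
  then show "p \<in> ?P \<and> full_eval fs p = 0" if "p \<in> ideal_L_hat n \<iota> x fs"
    using that unfolding L by blast
  note J = submoduleD[OF submodule_module_span[of ?P ?S]]
  have ex: "\<exists>q\<in>polys {..<n}. p - q \<in> module_span ?P ?S" if "p \<in> ?P" for p
    using that
  proof (induction rule: polys_induct)
    case (Const d)
    show ?case by (intro bexI[of _ "Const d"]) (simp_all add: module_span.zero Const_in_polys)
  next
    case (Var i)
    show ?case
    proof (cases "i < n")
      case True
      then show ?thesis by (intro bexI[of _ "Var i"]) (simp_all add: module_span.zero Var_in_polys)
    next
      case False
      then have "Var i - fs ! (i - n) \<in> ?S" "i - n < length fs" using Var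
        by (auto intro!: exI[of _ "i - n"])
      then show ?thesis using fs by (intro bexI[of _ "fs ! (i - n)"] module_span.base) auto
    qed
  next
    case (add p q)
    then obtain p' q' where *: "p' \<in> polys {..<n}" "p - p' \<in> module_span ?P ?S"
      "q' \<in> polys {..<n}" "q - q' \<in> module_span ?P ?S" by blast
    then have "(p - p') + (q - q') \<in> module_span ?P ?S" by (intro module_span.add)
    with * show ?case
      by (intro bexI[of _ "p' + q'"]) (auto intro: polys_closed simp: algebra_simps)
  next
    case (mult p q)
    then obtain p' q' where *: "p' \<in> polys {..<n}" "p - p' \<in> module_span ?P ?S"
      "q' \<in> polys {..<n}" "q - q' \<in> module_span ?P ?S" by blast
    then have "p * (q - q') + q' * (p - p') \<in> module_span ?P ?S"
      using mult(1) y_ring_subset by (intro J(2,3)) auto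
    with * show ?case
      by (intro bexI[of _ "p' * q'"]) (auto intro: polys_closed simp: algebra_simps)
  qed
  assume p: "p \<in> ?P \<and> full_eval fs p = 0"
  then obtain q where q: "q \<in> polys {..<n}" "p - q \<in> module_span ?P ?S" using ex by blast
  then have "full_eval fs (p - q) = 0" using sub by blast
  then have "mpoly_eval \<iota> x q = 0" using p q by (simp add: full_eval_hom full_eval_y)
  then have "q \<in> ?S" using q by (simp add: relation_ideal_def)
  then have "(p - q) + q \<in> module_span ?P ?S"
    by (intro module_span.add[OF q(2)] module_span.base)
  then show "p \<in> ideal_L_hat n \<iota> x fs" unfolding L by simp
qed

context
  fixes a :: 'r and g :: "'k mpoly"
  assumes g: "g \<in> carrier (z_ring n fs)" "z_eval n \<iota> x fs g = a"
begin

text \<open>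
  If the value of \<open>h\<close> is \<open>a r\<close> and \<open>q\<close> represents \<open>r\<close>, then \<open>h - q g\<close> lies in the kernel of evaluation.
  Here \<open>q\<close> can be taken in \<open>K[y]\<close> for every \<open>r\<close>, and in \<open>K[z]\<close> for \<open>r \<in> B\<close>. So \<open>M\<close> and \<open>N\<close> are the
  preimages in \<open>K[z]\<close> of the ideals \<open>B \<inter> aR\<close> and \<open>aB\<close> of \<open>B\<close>.
\<close>

lemma in_ideal_M_iff:
  "h \<in> ideal_M n \<iota> x fs g \<longleftrightarrow> h \<in> carrier (z_ring n fs) \<and> (\<exists>r. z_eval n \<iota> x fs h = a * r)"
proof -
  let ?P = "polys {..<n + length fs}"
  let ?S = "ideal_L_hat n \<iota> x fs \<union> {g}"
  have gP: "g \<in> ?P" using g z_ring_subset by blast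
  have g_eval: "full_eval fs g = a" using g by (simp add: full_eval_z)
  have S: "?S \<subseteq> ?P" using gP in_ideal_L_hat_iff by blast
  have M: "ideal_M_hat n \<iota> x fs g = module_span ?P ?S"
    unfolding ideal_M_hat_def by (rule genideal_mpoly_ring[OF S])
  have "is_submodule ?P {p. \<exists>r. full_eval fs p = a * r}"
    unfolding is_submodule_def
  proof (intro conjI ballI)
    show "0 \<in> {p. \<exists>r. full_eval fs p = a * r}"
      by (auto simp: full_eval_hom intro: exI[of _ 0])
  next
    fix u v assume "u \<in> {p. \<exists>r. full_eval fs p = a * r}" "v \<in> {p. \<exists>r. full_eval fs p = a * r}"
    then obtain r s where "full_eval fs u = a * r" "full_eval fs v = a * s" by blast
    then have "full_eval fs (u + v) = a * (r + s)" by (simp add: full_eval_hom distrib_left)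
    then show "u + v \<in> {p. \<exists>r. full_eval fs p = a * r}" by blast
  next
    fix c v assume "v \<in> {p. \<exists>r. full_eval fs p = a * r}"
    then obtain r where "full_eval fs v = a * r" by blast
    then have "full_eval fs (c * v) = a * (full_eval fs c * r)"
      by (simp add: full_eval_hom mult.left_commute)
    then show "c * v \<in> {p. \<exists>r. full_eval fs p = a * r}" by blast
  qed
  moreover have "full_eval fs p = a * 0" if "p \<in> ideal_L_hat n \<iota> x fs" for p
    using that in_ideal_L_hat_iff by simp
  moreover have "full_eval fs g = a * 1" using g_eval by simp
  ultimately have "module_span ?P ?S \<subseteq> {p. \<exists>r. full_eval fs p = a * r}"
    by (intro module_span_minimal) blast+
  moreover have "p \<in> module_span ?P ?S" if p: "p \<in> ?P" "full_eval fs p = a * r" for p r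
  proof -
    obtain q where q: "q \<in> polys {..<n}" "mpoly_eval \<iota> x q = r" using generated by blast
    then have qP: "q \<in> ?P" using y_ring_subset by blast
    have "full_eval fs (p - q * g) = 0"
      using p q by (simp add: full_eval_hom full_eval_y g_eval)
    then have "p - q * g \<in> ideal_L_hat n \<iota> x fs"
      using p qP gP by (simp add: in_ideal_L_hat_iff polys_closed)
    then have "(p - q * g) + q * g \<in> module_span ?P ?S"
      using qP by (intro module_span.add module_span.scale module_span.base) auto
    then show ?thesis by simp
  qed
  ultimately have M_hat: "p \<in> ideal_M_hat n \<iota> x fs g \<longleftrightarrow> (\<exists>r. full_eval fs p = a * r)" if "p \<in> ?P" for p
    unfolding M using that by blast
  show ?thesis
    unfolding ideal_M_def Int_iff
  proof (rule conj_cong[OF refl])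
    assume "h \<in> carrier (z_ring n fs)"
    then show "h \<in> ideal_M_hat n \<iota> x fs g \<longleftrightarrow> (\<exists>r. z_eval n \<iota> x fs h = a * r)"
      using M_hat[of h] subsetD[OF z_ring_subset, of h] full_eval_z[of h] by simp
  qed
qed

lemma in_ideal_N_iff:
  "h \<in> ideal_N n \<iota> x fs g \<longleftrightarrow>
     h \<in> carrier (z_ring n fs) \<and> (\<exists>b\<in>algebra_of \<iota> x fs. z_eval n \<iota> x fs h = a * b)"
proof -
  let ?Z = "carrier (z_ring n fs)"
  let ?S = "(?Z \<inter> ideal_L_hat n \<iota> x fs) \<union> {g}"
  have "unital_subring ?Z" unfolding z_ring_def by (rule unital_subring_polys)
  note Z = unital_subringD[OF this]
  note e = full_eval_hom
  have S: "?S \<subseteq> ?Z" using g by blast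
  have N: "ideal_N n \<iota> x fs g = module_span ?Z ?S"
    unfolding ideal_N_def z_ring_def by (rule genideal_mpoly_ring) (use S in \<open>simp add: z_ring_def\<close>)
  have B: "b \<in> algebra_of \<iota> x fs \<longleftrightarrow> (\<exists>q\<in>?Z. full_eval fs q = b)" for b
    unfolding algebra_of_eq_z_eval using full_eval_z by auto
  have "is_submodule ?Z {p \<in> ?Z. \<exists>q\<in>?Z. full_eval fs p = a * full_eval fs q}"
    unfolding is_submodule_def
  proof (intro conjI ballI)
    show "0 \<in> {p \<in> ?Z. \<exists>q\<in>?Z. full_eval fs p = a * full_eval fs q}"
      using Z(2) by (auto simp: e intro!: bexI[of _ 0])
  next
    fix u v assume "u \<in> {p \<in> ?Z. \<exists>q\<in>?Z. full_eval fs p = a * full_eval fs q}"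
      "v \<in> {p \<in> ?Z. \<exists>q\<in>?Z. full_eval fs p = a * full_eval fs q}"
    then obtain q q' where "u \<in> ?Z" "v \<in> ?Z" "q \<in> ?Z" "q' \<in> ?Z"
      "full_eval fs u = a * full_eval fs q" "full_eval fs v = a * full_eval fs q'" by blast
    then show "u + v \<in> {p \<in> ?Z. \<exists>q\<in>?Z. full_eval fs p = a * full_eval fs q}"
      by (auto simp: e distrib_left intro!: bexI[of _ "q + q'"] Z)
  next
    fix c v assume "c \<in> ?Z" "v \<in> {p \<in> ?Z. \<exists>q\<in>?Z. full_eval fs p = a * full_eval fs q}"
    then obtain q where "c \<in> ?Z" "v \<in> ?Z" "q \<in> ?Z" "full_eval fs v = a * full_eval fs q" by blast
    then show "c * v \<in> {p \<in> ?Z. \<exists>q\<in>?Z. full_eval fs p = a * full_eval fs q}"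
      by (auto simp: e mult.left_commute intro!: bexI[of _ "c * q"] Z)
  qed
  moreover have "\<exists>q\<in>?Z. full_eval fs p = a * full_eval fs q" if "p \<in> ?S" for p
    using that
  proof
    assume "p \<in> ?Z \<inter> ideal_L_hat n \<iota> x fs"
    then have "full_eval fs p = 0" using in_ideal_L_hat_iff by blast
    then show ?thesis using Z(2) by (intro bexI[of _ 0]) (simp_all add: e)
  next
    assume "p \<in> {g}"
    then show ?thesis using Z(1) g by (intro bexI[of _ 1]) (simp_all add: e full_eval_z)
  qed
  ultimately have "module_span ?Z ?S \<subseteq> {p \<in> ?Z. \<exists>q\<in>?Z. full_eval fs p = a * full_eval fs q}"
    using S by (intro module_span_minimal) blast+
  moreover have "p \<in> module_span ?Z ?S"
    if p: "p \<in> ?Z" "q \<in> ?Z" "full_eval fs p = a * full_eval fs q" for p q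
  proof -
    have "full_eval fs (p - q * g) = 0" using p g by (simp add: e full_eval_z mult.commute)
    moreover have pqZ: "p - q * g \<in> ?Z" using p g by (intro Z) auto
    ultimately have "p - q * g \<in> ideal_L_hat n \<iota> x fs"
      using z_ring_subset by (auto simp: in_ideal_L_hat_iff)
    then have "(p - q * g) + q * g \<in> module_span ?Z ?S"
      using p pqZ by (intro module_span.add module_span.scale module_span.base) auto
    then show ?thesis by simp
  qed
  ultimately have "h \<in> module_span ?Z ?S \<longleftrightarrow>
      h \<in> ?Z \<and> (\<exists>q\<in>?Z. full_eval fs h = a * full_eval fs q)" by blast
  also have "\<dots> \<longleftrightarrow> h \<in> ?Z \<and> (\<exists>b\<in>algebra_of \<iota> x fs. z_eval n \<iota> x fs h = a * b)"
    using full_eval_z[of h] B by metis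
  finally show ?thesis unfolding N .
qed

end

end

end


section \<open>The procedure\<close>

inductive_cases step_StartE: "step n \<iota> x G ord Start s"
inductive_cases step_BasisE: "step n \<iota> x G ord (Basis H) s"
inductive_cases step_DenominatorE: "step n \<iota> x G ord (Denominator H a) s"
inductive_cases step_SubalgebraE: "step n \<iota> x G ord (Subalgebra B a) s"
inductive_cases step_UnlocalizeE: "step n \<iota> x G ord (Unlocalize a fs) s"
inductive_cases step_TrimmedE: "step n \<iota> x G ord (Trimmed a fs) s"
inductive_cases step_IdealsE: "step n \<iota> x G ord (Ideals a fs g) s"
inductive_cases step_EnlargeE: "step n \<iota> x G ord (Enlarge a fs hs) s"
inductive_cases step_ReturnE: "step n \<iota> x G ord (Return fs) s"

context invariant_setting
begin

definition admissible :: "'r \<Rightarrow> 'k mpoly list \<Rightarrow> bool" where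
  "admissible a fs \<longleftrightarrow>
     set fs \<subseteq> polys {..<n} \<and> unlocalization_input G (algebra_of \<iota> x fs) a"

definition represents :: "'k mpoly list \<Rightarrow> 'r \<Rightarrow> 'k mpoly \<Rightarrow> bool" where
  "represents fs a g \<longleftrightarrow> g \<in> carrier (z_ring n fs) \<and> z_eval n \<iota> x fs g = a"

lemma unital_subring_algebra_of: "unital_subring (algebra_of \<iota> x fs)"
  unfolding algebra_of_def by (rule unital_subring_algebra)

lemma admissibleD:
  assumes "admissible a fs"
  shows "set fs \<subseteq> polys {..<n}" "algebra_of \<iota> x fs \<subseteq> invariants G" "a \<in> algebra_of \<iota> x fs"
    "a \<in> invariants G" "a \<noteq> 0"
    "localization_at (invariants G) a = localization_at (algebra_of \<iota> x fs) a"
  using assms by (auto simp: admissible_def unlocalization_input_def)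

lemma unlocalization_input_mono:
  assumes "unlocalization_input G B a" "B \<subseteq> B'" "B' \<subseteq> invariants G"
  shows "unlocalization_input G B' a"
proof -
  have "localization_at B a \<subseteq> localization_at B' a" "localization_at B' a \<subseteq> localization_at (invariants G) a"
    using assms(2,3) unfolding localization_at_def by blast+
  with assms show ?thesis unfolding unlocalization_input_def by blast
qed

lemma exists_power_in_algebra:
  assumes "unlocalization_input G B a" "r \<in> invariants G"
  shows "\<exists>k. a ^ k * r \<in> B"
proof -
  have "to_fract r \<in> localization_at B a"
    using assms localization_base[OF assms(2), of a] by (simp add: unlocalization_input_def)
  then obtain b k where b: "b \<in> B" "to_fract r = to_fract b / to_fract a ^ k"
    by (auto simp: localization_at_def)
  have "to_fract a \<noteq> 0" using assms(1) by (simp add: unlocalization_input_def)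
  then have "to_fract (a ^ k * r) = to_fract b"
    by (simp add: b(2) unital_homD[OF unital_hom_to_fract])
  then have "a ^ k * r = b" by (simp only: to_fract_eq_iff)
  with b show ?thesis by blast
qed

text \<open>
  If \<open>B \<inter> aR \<subseteq> aB\<close>, then factors of \<open>a\<close> can be cancelled one by one from \<open>a\<^sup>k r \<in> B\<close>.
\<close>

lemma return_correct:
  assumes adm: "admissible a fs" and g: "represents fs a g"
    and sub: "ideal_M n \<iota> x fs g \<subseteq> ideal_N n \<iota> x fs g"
  shows "algebra_of \<iota> x fs = invariants G"
proof
  note a = admissibleD[OF adm]
  note M_iff = in_ideal_M_iff[OF a(1) g[unfolded represents_def, THEN conjunct1]
    g[unfolded represents_def, THEN conjunct2]]
  note N_iff = in_ideal_N_iff[OF a(1) g[unfolded represents_def, THEN conjunct1]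
    g[unfolded represents_def, THEN conjunct2]]
  show "algebra_of \<iota> x fs \<subseteq> invariants G" by (rule a)
  have cancel: "r \<in> algebra_of \<iota> x fs" if r: "a * r \<in> algebra_of \<iota> x fs" for r
  proof -
    obtain h where h: "h \<in> carrier (z_ring n fs)" "z_eval n \<iota> x fs h = a * r"
      using r unfolding algebra_of_eq_z_eval by auto
    then have "h \<in> ideal_N n \<iota> x fs g" using M_iff sub by blast
    then obtain b where "b \<in> algebra_of \<iota> x fs" "a * r = a * b" using N_iff h by auto
    then show ?thesis using a(5) by simp
  qed
  have "a ^ k * r \<in> algebra_of \<iota> x fs \<Longrightarrow> r \<in> algebra_of \<iota> x fs" for k r
    by (induction k) (auto simp: mult.assoc intro: cancel)
  moreover have "\<exists>k. a ^ k * r \<in> algebra_of \<iota> x fs" if "r \<in> invariants G" for r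
    using adm that by (intro exists_power_in_algebra) (auto simp: admissible_def)
  ultimately show "invariants G \<subseteq> algebra_of \<iota> x fs" by blast
qed

lemma algebra_of_append:
  "algebra_of \<iota> x fs \<subseteq> algebra_of \<iota> x (fs @ fs')" "r \<in> set fs' \<Longrightarrow> mpoly_eval \<iota> x r \<in> algebra_of \<iota> x (fs @ fs')"
proof -
  show "algebra_of \<iota> x fs \<subseteq> algebra_of \<iota> x (fs @ fs')"
    unfolding algebra_of_def by (rule algebra_mono) auto
  show "mpoly_eval \<iota> x r \<in> algebra_of \<iota> x (fs @ fs')" if "r \<in> set fs'"
    unfolding algebra_of_def using algebra_base(2)[of "mpoly_eval \<iota> x ` set (fs @ fs')" \<iota>] that by auto
qed

text \<open>The new elements are invariant because the invariant factor \<open>a\<close> can be cancelled.\<close>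

lemma admissible_enlarge:
  assumes adm: "admissible a fs" and hs: "set hs \<subseteq> carrier (z_ring n fs)"
    and fs': "set fs' \<subseteq> polys {..<n}" "length fs' = length hs"
    "\<forall>i<length hs. a * mpoly_eval \<iota> x (fs' ! i) = z_eval n \<iota> x fs (hs ! i)"
  shows "admissible a (fs @ fs')"
proof -
  note a = admissibleD[OF adm]
  have "mpoly_eval \<iota> x f \<in> invariants G" if f: "f \<in> set fs'" for f
  proof -
    obtain i where i: "i < length hs" "f = fs' ! i" using f fs'(2) by (auto simp: in_set_conv_nth)
    then have "hs ! i \<in> carrier (z_ring n fs)" using hs by auto
    then have "z_eval n \<iota> x fs (hs ! i) \<in> invariants G"
      using a(2) unfolding algebra_of_eq_z_eval by blast
    then show ?thesis using i fs'(3) invariants_cancel[OF a(4,5)] by auto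
  qed
  moreover have "mpoly_eval \<iota> x f \<in> invariants G" if "f \<in> set fs" for f
    using a(2) algebra_base(2)[of "mpoly_eval \<iota> x ` set fs" \<iota>] that unfolding algebra_of_def by auto
  ultimately have "algebra_of \<iota> x (fs @ fs') \<subseteq> invariants G"
    unfolding algebra_of_def by (intro algebra_invariants) auto
  then show ?thesis
    using unlocalization_input_mono[OF _ algebra_of_append(1)] adm fs'(1)
    unfolding admissible_def by auto
qed

text \<open>
  One round divides by \<open>a\<close> whatever can be divided: the polynomials with values in
  \<open>a B'\<close>, for the enlarged algebra \<open>B'\<close>, form an ideal that contains \<open>N\<close> and the chosen generators,
  hence all of \<open>M\<close>.
\<close>

lemma enlarge_divides:
  assumes adm: "admissible a fs" and g: "represents fs a g"
    and hs: "Idl\<^bsub>z_ring n fs\<^esub> (ideal_N n \<iota> x fs g \<union> set hs) = ideal_M n \<iota> x fs g"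
      "set hs \<subseteq> ideal_M n \<iota> x fs g"
    and fs': "length fs' = length hs"
    "\<forall>i<length hs. a * mpoly_eval \<iota> x (fs' ! i) = z_eval n \<iota> x fs (hs ! i)"
    and r: "a * r \<in> algebra_of \<iota> x fs"
  shows "r \<in> algebra_of \<iota> x (fs @ fs')"
proof -
  note a = admissibleD[OF adm]
  note M_iff = in_ideal_M_iff[OF a(1) g[unfolded represents_def, THEN conjunct1]
    g[unfolded represents_def, THEN conjunct2]]
  note N_iff = in_ideal_N_iff[OF a(1) g[unfolded represents_def, THEN conjunct1]
    g[unfolded represents_def, THEN conjunct2]]
  let ?Z = "carrier (z_ring n fs)" and ?B = "algebra_of \<iota> x (fs @ fs')"
  let ?J = "{h \<in> ?Z. \<exists>b\<in>?B. z_eval n \<iota> x fs h = a * b}"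
  note B = unital_subringD[OF unital_subring_algebra_of[of "fs @ fs'"]]
  have "unital_subring ?Z" unfolding z_ring_def by (rule unital_subring_polys)
  note Z = unital_subringD[OF this]
  have z_hom: "unital_hom (z_eval n \<iota> x fs)"
    using unital_hom_mpoly_eval[OF hom_\<iota>] unfolding z_eval_def[abs_def] .
  note e = unital_homD[OF z_hom]
  have NM: "ideal_N n \<iota> x fs g \<union> set hs \<subseteq> ?Z" using N_iff M_iff hs(2) by blast
  have "is_submodule ?Z ?J"
    unfolding is_submodule_def
  proof (intro conjI ballI)
    show "0 \<in> ?J" using Z(2) B(2) by (auto simp: e intro!: bexI[of _ 0])
  next
    fix u v assume "u \<in> ?J" "v \<in> ?J"
    then obtain b c where "u \<in> ?Z" "v \<in> ?Z" "b \<in> ?B" "c \<in> ?B"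
      "z_eval n \<iota> x fs u = a * b" "z_eval n \<iota> x fs v = a * c" by blast
    then show "u + v \<in> ?J"
      by (auto simp: e distrib_left intro!: bexI[of _ "b + c"] Z B)
  next
    fix q v assume "q \<in> ?Z" "v \<in> ?J"
    then obtain b where q: "q \<in> ?Z" "v \<in> ?Z" "b \<in> ?B" "z_eval n \<iota> x fs v = a * b" by blast
    moreover have "z_eval n \<iota> x fs q \<in> ?B"
      using q(1) algebra_of_append(1) algebra_of_eq_z_eval by blast
    ultimately show "q * v \<in> ?J"
      by (auto simp: e mult.left_commute intro!: bexI[of _ "z_eval n \<iota> x fs q * b"] Z B)
  qed
  moreover have "ideal_N n \<iota> x fs g \<subseteq> ?J" using N_iff algebra_of_append(1)[of fs fs'] by blast
  moreover have "set hs \<subseteq> ?J"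
  proof
    fix h assume h: "h \<in> set hs"
    then obtain i where i: "i < length hs" "h = hs ! i" by (auto simp: in_set_conv_nth)
    then have "mpoly_eval \<iota> x (fs' ! i) \<in> ?B" using fs'(1) by (intro algebra_of_append) auto
    moreover have "z_eval n \<iota> x fs h = a * mpoly_eval \<iota> x (fs' ! i)" using i fs'(2) by simp
    moreover have "h \<in> ?Z" using NM h by blast
    ultimately show "h \<in> ?J" by blast
  qed
  ultimately have "module_span ?Z (ideal_N n \<iota> x fs g \<union> set hs) \<subseteq> ?J"
    by (intro module_span_minimal) auto
  moreover have "Idl\<^bsub>z_ring n fs\<^esub> (ideal_N n \<iota> x fs g \<union> set hs) =
      module_span ?Z (ideal_N n \<iota> x fs g \<union> set hs)"
    using NM unfolding z_ring_def by (rule genideal_mpoly_ring)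
  ultimately have sub: "ideal_M n \<iota> x fs g \<subseteq> ?J" using hs(1) by simp
  obtain h where h: "h \<in> ?Z" "z_eval n \<iota> x fs h = a * r"
    using r unfolding algebra_of_eq_z_eval by auto
  then have "h \<in> ?J" using sub M_iff by blast
  then obtain b where "b \<in> ?B" "a * r = a * b" using h by auto
  then show ?thesis using a(5) by simp
qed


subsection \<open>Partial correctness\<close>

text \<open>
  An invariant of the reachable states. It records what the later steps need from the earlier
  ones, in particular that \<open>B\<close> stays a subalgebra of \<open>R\<^sup>G\<close> with \<open>R\<^sup>G[a\<inverse>] = B[a\<inverse>]\<close>.
\<close>

primrec safe :: "('k, 'r) state \<Rightarrow> bool" where
  "safe Start \<longleftrightarrow> True"
| "safe (Basis H) \<longleftrightarrow> reduced_groebner_basis n ord (derksen_ideal n x G) H"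
| "safe (Denominator H a) \<longleftrightarrow> reduced_groebner_basis n ord (derksen_ideal n x G) H \<and>
     a \<in> invariants G \<and> a \<noteq> 0 \<and> (\<exists>k. \<forall>g\<in>H. Const (to_fract a ^ k) * g \<in> integral_mpolys n)"
| "safe (Subalgebra B a) \<longleftrightarrow>
     (\<exists>S. finite S \<and> B = subalgebra_generated \<iota> S) \<and> unlocalization_input G B a"
| "safe (Unlocalize a fs) \<longleftrightarrow> admissible a fs"
| "safe (Trimmed a fs) \<longleftrightarrow> admissible a fs"
| "safe (Ideals a fs g) \<longleftrightarrow> admissible a fs \<and> represents fs a g"
| "safe (Enlarge a fs hs) \<longleftrightarrow> admissible a fs \<and>
     (\<forall>h\<in>set hs. h \<in> carrier (z_ring n fs) \<and> (\<exists>r. z_eval n \<iota> x fs h = a * r))"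
| "safe (Return fs) \<longleftrightarrow> algebra_of \<iota> x fs = invariants G"

lemma finite_coefficients: "finite H \<Longrightarrow> finite (coefficients H)"
  by (simp add: coefficients_def)

lemma coefficient_algebra_input:
  assumes safe: "safe (Denominator H a)"
    and e: "\<forall>s\<in>coefficients H. to_fract a ^ e s * s \<in> range to_fract"
    and S: "S = {r. \<exists>s\<in>coefficients H. to_fract r = to_fract a ^ e s * s}"
  shows "finite S" "unlocalization_input G (subalgebra_generated \<iota> ({a} \<union> S)) a"
proof -
  let ?B = "subalgebra_generated \<iota> ({a} \<union> S)"
  from safe obtain k where H: "reduced_groebner_basis n ord (derksen_ideal n x G) H"
    and a: "a \<in> invariants G" "a \<noteq> 0"
    and k: "\<And>g. g \<in> H \<Longrightarrow> Const (to_fract a ^ k) * g \<in> integral_mpolys n" by auto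
  have "finite H" using H by (simp add: reduced_groebner_basis_def groebner_basis_def)
  then have "finite ((\<lambda>s. to_fract a ^ e s * s) ` coefficients H)"
    by (intro finite_imageI finite_coefficients)
  then have "finite (to_fract -` ((\<lambda>s. to_fract a ^ e s * s) ` coefficients H))"
    by (rule finite_vimageI) (simp add: inj_def)
  moreover have "S \<subseteq> to_fract -` ((\<lambda>s. to_fract a ^ e s * s) ` coefficients H)"
    unfolding S by auto
  ultimately show "finite S" by (rule rev_finite_subset)
  have "r \<in> invariants G" if r: "r \<in> S" for r
  proof -
    obtain g t where "g \<in> H" "to_fract r = to_fract a ^ e (Poly_Mapping.lookup g t) * Poly_Mapping.lookup g t"
      using r unfolding S coefficients_def by blast
    then show ?thesis using coefficients_invariant[OF H _ a k] by blast
  qed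
  then have B_inv: "?B \<subseteq> invariants G" using a by (intro algebra_invariants) auto
  have aB: "a \<in> ?B" and SB: "S \<subseteq> ?B" using algebra_base(2)[of "{a} \<union> S" \<iota>] by auto
  have "s \<in> localization_at ?B a" if s: "s \<in> coefficients H" for s
  proof -
    obtain r where r: "to_fract a ^ e s * s = to_fract r" using e s by blast
    then have "r \<in> ?B" using s SB unfolding S by (metis (mono_tags, lifting) mem_Collect_eq subsetD)
    moreover have "s = to_fract r / to_fract a ^ e s" using r[symmetric] a(2) by simp
    ultimately show ?thesis unfolding localization_at_def by blast
  qed
  then have "localization_at (invariants G) a = localization_at ?B a"
    by (intro localization_eqI unital_subring_algebra aB B_inv a
        invariants_in_localization[OF H unital_subring_algebra algebra_base(1) aB a(2)])
  then show "unlocalization_input G ?B a"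
    unfolding unlocalization_input_def using B_inv aB a by blast
qed

lemma step_safe:
  assumes "step n \<iota> x G ord s s'" "safe s"
  shows "safe s'"
  using assms
proof (induction rule: step.induct)
  case (coefficient_algebra H a e S)
  then show ?case using coefficient_algebra_input[of H a e S]
    by (auto simp del: safe.simps(3) intro!: exI[of _ "{a} \<union> S"])
next
  case (start_unlocalization B a fs)
  then show ?case by (simp add: admissible_def)
next
  case (replace fs' fs a)
  then show ?case by (simp add: admissible_def)
next
  case (ideals g fs a)
  then show ?case by (simp add: represents_def)
next
  case (return fs g a)
  then show ?case using return_correct by auto
next
  case (new_elements fs g hs a)
  then have "set fs \<subseteq> polys {..<n}" "g \<in> carrier (z_ring n fs)" "z_eval n \<iota> x fs g = a"
    by (auto simp: admissible_def represents_def)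
  then show ?case using new_elements in_ideal_M_iff by auto
next
  case (enlarge fs' hs a fs)
  then show ?case using admissible_enlarge[of a fs hs fs'] by auto
qed auto

lemma reachable_safe:
  assumes "(step n \<iota> x G ord)\<^sup>*\<^sup>* Start s"
  shows "safe s"
  using assms by induction (auto intro: step_safe)


subsection \<open>Progress\<close>

lemma exists_preimages: "\<exists>pre. \<forall>r. pre r \<in> polys {..<n} \<and> mpoly_eval \<iota> x (pre r) = r"
  using generated by metis

lemma step_progress:
  assumes "safe s"
  shows "(\<exists>fs. s = Return fs) \<or> (\<exists>s'. step n \<iota> x G ord s s')"
proof -
  obtain pre where pre: "\<And>r. pre r \<in> polys {..<n}" "\<And>r. mpoly_eval \<iota> x (pre r) = r"
    using exists_preimages by blast
  have look: "Poly_Mapping.lookup (Const c * p) t = c * Poly_Mapping.lookup p t"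
    for c :: "'r fract" and p :: "'r fract mpoly" and t
    unfolding Const_def mult_map_scale_conv_mult[symmetric] by (simp add: lookup_map)
  show ?thesis
  proof (cases s)
    case Start
    then show ?thesis
      using reduced_groebner_basis_exists[OF derksen_submodule derksen_subset] step.groebner by blast
  next
    case (Basis H)
    with assms have H: "reduced_groebner_basis n ord (derksen_ideal n x G) H" by simp
    then have fin: "finite H" and sub: "H \<subseteq> polys {..<n}"
      using derksen_subset by (auto simp: reduced_groebner_basis_def groebner_basis_def)
    obtain a where a: "a \<in> invariants G" "a \<noteq> 0"
      "\<And>s. s \<in> coefficients H \<Longrightarrow> to_fract a * s \<in> range to_fract"
      using invariant_denominator[OF finite_coefficients[OF fin]] by blast
    have "Const (to_fract a ^ 1) * g \<in> integral_mpolys n" if g: "g \<in> H" for g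
    proof -
      have "Poly_Mapping.lookup (Const (to_fract a ^ 1) * g) t \<in> range to_fract"
        if t: "t \<in> Poly_Mapping.keys (Const (to_fract a ^ 1) * g)" for t
      proof -
        have "t \<in> Poly_Mapping.keys g" using t by (auto simp: in_keys_iff look)
        then have "Poly_Mapping.lookup g t \<in> coefficients H" using g by (auto simp: coefficients_def)
        then show ?thesis using a(3) by (simp add: look)
      qed
      moreover have "Const (to_fract a ^ 1) * g \<in> polys {..<n}"
        using g sub by (intro polys_closed Const_in_polys) auto
      ultimately show ?thesis by (auto simp: integral_mpolys_def coefficients_def)
    qed
    then show ?thesis using step.denominator[OF a(1,2), of H] Basis by blast
  next
    case (Denominator H a)
    with assms obtain k where k: "\<And>g. g \<in> H \<Longrightarrow> Const (to_fract a ^ k) * g \<in> integral_mpolys n"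
      and a: "a \<noteq> 0" by auto
    have "to_fract a ^ k * s \<in> range to_fract" if s: "s \<in> coefficients H" for s
    proof -
      obtain g t where g: "g \<in> H" "t \<in> Poly_Mapping.keys g" "s = Poly_Mapping.lookup g t"
        using s unfolding coefficients_def by blast
      have "to_fract a \<noteq> 0" using a by simp
      then have "t \<in> Poly_Mapping.keys (Const (to_fract a ^ k) * g)"
        using g by (simp add: in_keys_iff look)
      then have "Poly_Mapping.lookup (Const (to_fract a ^ k) * g) t \<in> range to_fract"
        using k[OF g(1)] by (auto simp: integral_mpolys_def coefficients_def)
      then show ?thesis by (simp add: look g(3))
    qed
    then show ?thesis
      using step.coefficient_algebra[of H a "\<lambda>_. k", OF _ refl] unfolding Denominator by blast
  next
    case (Subalgebra B a)
    with assms obtain S where S: "finite S" "B = subalgebra_generated \<iota> S"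
      "unlocalization_input G B a" by auto
    obtain rs where rs: "set rs = S" using finite_list[OF S(1)] by blast
    have "algebra_of \<iota> x (map pre rs) = B"
      unfolding algebra_of_def by (simp add: image_image pre rs S)
    moreover have "set (map pre rs) \<subseteq> polys {..<n}" using pre by auto
    ultimately show ?thesis
      using step.start_unlocalization[OF S(3)] unfolding Subalgebra by blast
  next
    case (Unlocalize a fs)
    then show ?thesis using step.keep by blast
  next
    case (Trimmed a fs)
    with assms have "a \<in> algebra_of \<iota> x fs" using admissibleD by simp
    then obtain g where "g \<in> carrier (z_ring n fs)" "z_eval n \<iota> x fs g = a"
      unfolding algebra_of_eq_z_eval by blast
    then show ?thesis using step.ideals unfolding Trimmed by blast
  next
    case (Ideals a fs g)
    let ?Z = "carrier (z_ring n fs)" and ?M = "ideal_M n \<iota> x fs g" and ?N = "ideal_N n \<iota> x fs g"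
    show ?thesis
    proof (cases "?M \<subseteq> ?N")
      case True
      then show ?thesis using step.return unfolding Ideals by blast
    next
      case False
      from assms Ideals have "set fs \<subseteq> polys {..<n}" "g \<in> ?Z" "z_eval n \<iota> x fs g = a"
        using admissibleD by (auto simp: represents_def)
      note M_iff = in_ideal_M_iff[OF this] and N_iff = in_ideal_N_iff[OF this]
      have "unital_subring ?Z" unfolding z_ring_def by (rule unital_subring_polys)
      note Z = unital_subringD[OF this]
      have "unital_hom (z_eval n \<iota> x fs)"
        using unital_hom_mpoly_eval[OF hom_\<iota>] unfolding z_eval_def[abs_def] .
      note e = unital_homD[OF this]
      have M: "is_submodule ?Z ?M"
        unfolding is_submodule_def
      proof (intro conjI ballI)
        show "0 \<in> ?M" using Z(2) by (auto simp: M_iff e intro: exI[of _ 0])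
      next
        fix u v assume "u \<in> ?M" "v \<in> ?M"
        then obtain r r' where "u \<in> ?Z" "v \<in> ?Z" "z_eval n \<iota> x fs u = a * r"
          "z_eval n \<iota> x fs v = a * r'" unfolding M_iff by blast
        then show "u + v \<in> ?M"
          unfolding M_iff by (auto simp: e intro!: Z exI[of _ "r + r'"] distrib_left[symmetric])
      next
        fix c v assume "c \<in> ?Z" "v \<in> ?M"
        then obtain r where "c \<in> ?Z" "v \<in> ?Z" "z_eval n \<iota> x fs v = a * r" unfolding M_iff by blast
        then show "c * v \<in> ?M"
          unfolding M_iff by (auto simp: e intro!: Z exI[of _ "z_eval n \<iota> x fs c * r"])
      qed
      have MZ: "?M \<subseteq> ?Z" using M_iff by blast
      have "noetherian ?Z" unfolding z_ring_def by (intro noetherian_polys noetherian_K) simp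
      then obtain F where F: "finite F" "F \<subseteq> ?M" "?M \<subseteq> module_span ?Z F"
        using M MZ unfolding noetherian_def by meson
      obtain hs where hs: "set hs = F" using finite_list[OF F(1)] by blast
      have NM: "?N \<subseteq> ?M" using M_iff N_iff by blast
      have "Idl\<^bsub>z_ring n fs\<^esub> (?N \<union> set hs) = module_span ?Z (?N \<union> set hs)"
        unfolding z_ring_def
        by (rule genideal_mpoly_ring) (use NM MZ F(2) hs in \<open>auto simp: z_ring_def\<close>)
      also have "\<dots> = ?M"
      proof
        show "module_span ?Z (?N \<union> set hs) \<subseteq> ?M"
          using NM F(2) hs by (intro module_span_minimal[OF M]) auto
        show "?M \<subseteq> module_span ?Z (?N \<union> set hs)"
          using F(3) hs module_span_mono[of F "?N \<union> set hs" ?Z] by auto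
      qed
      finally show ?thesis using step.new_elements[OF False] F(2) hs unfolding Ideals by blast
    qed
  next
    case (Enlarge a fs hs)
    with assms have "\<forall>h\<in>set hs. \<exists>r. z_eval n \<iota> x fs h = a * r" by auto
    then obtain q where q: "\<And>h. h \<in> set hs \<Longrightarrow> z_eval n \<iota> x fs h = a * q h" by metis
    have "step n \<iota> x G ord (Enlarge a fs hs) (Unlocalize a (fs @ map (\<lambda>h. pre (q h)) hs))"
      by (rule step.enlarge) (use pre q in auto)
    then show ?thesis unfolding Enlarge by blast
  next
    case (Return fs)
    then show ?thesis by blast
  qed
qed


subsection \<open>Termination\<close>

text \<open>
  Membership in the accessible part rather than the absence of infinite runs, so that termination
  can be propagated backwards along the steps.
\<close>

definition terminating :: "('k, 'r) state \<Rightarrow> bool" where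
  "terminating = Wellfounded.accp (\<lambda>s' s. step n \<iota> x G ord s s')"

lemma terminatingI: "(\<And>s'. step n \<iota> x G ord s s' \<Longrightarrow> terminating s') \<Longrightarrow> terminating s"
  unfolding terminating_def by (rule accp.accI) blast

lemma terminating_no_infinite_run:
  assumes "terminating s0"
  shows "\<nexists>s. s 0 = s0 \<and> (\<forall>i. step n \<iota> x G ord (s i) (s (Suc i)))"
proof (rule accp_induct[OF assms[unfolded terminating_def]])
  fix s0 :: "('k, 'r) state"
  assume IH: "\<forall>s1. step n \<iota> x G ord s0 s1 \<longrightarrow>
    (\<nexists>s. s 0 = s1 \<and> (\<forall>i. step n \<iota> x G ord (s i) (s (Suc i))))"
  show "\<nexists>s. s 0 = s0 \<and> (\<forall>i. step n \<iota> x G ord (s i) (s (Suc i)))"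
  proof
    assume "\<exists>s. s 0 = s0 \<and> (\<forall>i. step n \<iota> x G ord (s i) (s (Suc i)))"
    then obtain s where s: "s 0 = s0" "\<And>i. step n \<iota> x G ord (s i) (s (Suc i))" by blast
    then have "step n \<iota> x G ord s0 (s (Suc 0))" by metis
    then have "\<nexists>s'. s' 0 = s (Suc 0) \<and> (\<forall>i. step n \<iota> x G ord (s' i) (s' (Suc i)))"
      using IH by blast
    moreover have "\<exists>s'. s' 0 = s (Suc 0) \<and> (\<forall>i. step n \<iota> x G ord (s' i) (s' (Suc i)))"
      by (rule exI[of _ "\<lambda>i. s (Suc i)"]) (simp add: s(2))
    ultimately show False by blast
  qed
qed

lemma terminating_Return: "terminating (Return fs)"
  by (rule terminatingI) (auto elim: step_ReturnE)

text \<open>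
  If \<open>a\<^sup>k S \<subseteq> B\<close> for a generating set \<open>S\<close> of the invariant ring, the loop is left
  after at most \<open>k\<close> enlargements: each of them lowers \<open>k\<close> by one, and for \<open>k = 0\<close> already
  \<open>B = R\<^sup>G\<close>, whence \<open>M \<subseteq> N\<close>.
\<close>

lemma terminating_Trimmed:
  assumes S: "S \<subseteq> invariants G" "invariants G \<subseteq> subalgebra_generated \<iota> S"
  shows "admissible a fs \<Longrightarrow> \<forall>r\<in>S. a ^ k * r \<in> algebra_of \<iota> x fs \<Longrightarrow> terminating (Trimmed a fs)"
proof (induction k arbitrary: fs)
  case 0
  note a = admissibleD[OF 0(1)]
  have "subalgebra_generated \<iota> S \<subseteq> algebra_of \<iota> x fs"
    using 0(2) algebra_base(1)[of \<iota> "mpoly_eval \<iota> x ` set fs"]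
    by (intro algebra_minimal unital_subring_algebra_of) (auto simp: algebra_of_def)
  then have full: "invariants G \<subseteq> algebra_of \<iota> x fs" using S(2) by blast
  show ?case
  proof (rule terminatingI, erule step_TrimmedE)
    fix s :: "('k, 'r) state" and g assume s: "s = Ideals a fs g" and g: "g \<in> carrier (z_ring n fs)" "z_eval n \<iota> x fs g = a"
    have MN: "ideal_M n \<iota> x fs g \<subseteq> ideal_N n \<iota> x fs g"
    proof
      fix h assume "h \<in> ideal_M n \<iota> x fs g"
      then obtain r where h: "h \<in> carrier (z_ring n fs)" "z_eval n \<iota> x fs h = a * r"
        using in_ideal_M_iff[OF a(1) g] by blast
      then have "a * r \<in> invariants G" using a(2) unfolding algebra_of_eq_z_eval by force
      then have "r \<in> algebra_of \<iota> x fs" using invariants_cancel[OF a(4,5)] full by blast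
      then show "h \<in> ideal_N n \<iota> x fs g" using in_ideal_N_iff[OF a(1) g] h by blast
    qed
    show "terminating s"
      unfolding s
    proof (rule terminatingI, erule step_IdealsE)
      fix s' :: "('k, 'r) state" assume "s' = Return fs"
      then show "terminating s'" by (simp add: terminating_Return)
    qed (use MN in simp)
  qed
next
  case (Suc k)
  show ?case
  proof (rule terminatingI, erule step_TrimmedE)
    fix s :: "('k, 'r) state" and g assume s: "s = Ideals a fs g" and g: "g \<in> carrier (z_ring n fs)" "z_eval n \<iota> x fs g = a"
    have rep: "represents fs a g" using g by (simp add: represents_def)
    show "terminating s"
      unfolding s
    proof (rule terminatingI, erule step_IdealsE)
      fix s' :: "('k, 'r) state" assume "s' = Return fs"
      then show "terminating s'" by (simp add: terminating_Return)
    next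
      fix s' :: "('k, 'r) state" and hs assume s': "s' = Enlarge a fs hs" and hs: "set hs \<subseteq> ideal_M n \<iota> x fs g"
        "Idl\<^bsub>z_ring n fs\<^esub> (ideal_N n \<iota> x fs g \<union> set hs) = ideal_M n \<iota> x fs g"
      show "terminating s'"
        unfolding s'
      proof (rule terminatingI, erule step_EnlargeE)
        fix s'' :: "('k, 'r) state" and fs' assume s'': "s'' = Unlocalize a (fs @ fs')"
          and fs': "set fs' \<subseteq> polys {..<n}" "length fs' = length hs"
          "\<forall>i<length hs. a * mpoly_eval \<iota> x (fs' ! i) = z_eval n \<iota> x fs (hs ! i)"
        have hsZ: "set hs \<subseteq> carrier (z_ring n fs)"
          using hs(1) in_ideal_M_iff[OF admissibleD(1)[OF Suc.prems(1)] g] by blast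
        have adm: "admissible a (fs @ fs')"
          by (rule admissible_enlarge[OF Suc.prems(1) hsZ fs'])
        have pow: "\<forall>r\<in>S. a ^ k * r \<in> algebra_of \<iota> x (fs @ fs')"
          using Suc.prems(2) enlarge_divides[OF Suc.prems(1) rep hs(2,1) fs'(2,3)]
          by (simp add: mult.assoc)
        show "terminating s''"
          unfolding s''
        proof (rule terminatingI, erule step_UnlocalizeE)
          fix s :: "('k, 'r) state" assume "s = Trimmed a (fs @ fs')"
          then show "terminating s" using Suc.IH[OF adm pow] by simp
        next
          fix s :: "('k, 'r) state" and fs'' assume "s = Trimmed a fs''" "set fs'' \<subseteq> polys {..<n}"
            "algebra_of \<iota> x fs'' = algebra_of \<iota> x (fs @ fs')"
          then show "terminating s"
            using adm pow by (auto intro!: Suc.IH simp: admissible_def)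
        qed
      qed
    qed
  qed
qed

lemma terminating_Trimmed_admissible:
  assumes "admissible a fs"
  shows "terminating (Trimmed a fs)"
proof -
  let ?B = "algebra_of \<iota> x fs"
  note a = admissibleD[OF assms]
  note B = unital_subringD[OF unital_subring_algebra_of[of fs]]
  obtain S where S: "finite S" "S \<subseteq> invariants G" "invariants G \<subseteq> subalgebra_generated \<iota> S"
    using invariants_finitely_generated by blast
  have "\<forall>r\<in>S. \<exists>k. a ^ k * r \<in> ?B"
    using assms S(2) by (auto simp: admissible_def intro!: exists_power_in_algebra)
  then obtain e where e: "\<And>r. r \<in> S \<Longrightarrow> a ^ e r * r \<in> ?B" by metis
  have "a ^ Max (e ` S) * r \<in> ?B" if r: "r \<in> S" for r
  proof -
    have "e r \<le> Max (e ` S)" using S(1) r by simp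
    then obtain l where l: "Max (e ` S) = l + e r" by (metis add.commute le_Suc_ex)
    have "a ^ l * (a ^ e r * r) \<in> ?B"
      by (intro B(6) unital_subring_power unital_subring_algebra_of a e r)
    then show ?thesis by (simp add: l power_add mult.assoc)
  qed
  then show ?thesis using terminating_Trimmed[OF S(2,3) assms] by blast
qed

lemma terminating_Unlocalize:
  assumes "admissible a fs"
  shows "terminating (Unlocalize a fs)"
proof (rule terminatingI, erule step_UnlocalizeE)
  fix s :: "('k, 'r) state" assume "s = Trimmed a fs"
  then show "terminating s" using terminating_Trimmed_admissible[OF assms] by simp
next
  fix s :: "('k, 'r) state" and fs' assume "s = Trimmed a fs'" "set fs' \<subseteq> polys {..<n}" "algebra_of \<iota> x fs' = algebra_of \<iota> x fs"
  then show "terminating s"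
    using assms by (auto intro!: terminating_Trimmed_admissible simp: admissible_def)
qed

lemma terminating_Start: "terminating Start"
proof (rule terminatingI, erule step_StartE)
  have sub: "terminating (Subalgebra B a)" for B a
    by (rule terminatingI, erule step_SubalgebraE)
      (auto intro: terminating_Unlocalize simp: admissible_def)
  have den: "terminating (Denominator H a)" for H a
    by (rule terminatingI, erule step_DenominatorE) (auto intro: sub)
  fix s :: "('k, 'r) state" and H assume "s = Basis H"
  then show "terminating s"
    by (auto intro!: terminatingI den elim!: step_BasisE)
qed

end


section \<open>The invariant ring of a quotient of a polynomial ring\<close>

text \<open>
  The projection followed by \<open>\<phi>\<close> agrees with evaluation, as both are homomorphisms with the same
  values on constants and variables.
\<close>

lemma quotient_evaluation:
  fixes \<phi> :: "'k::comm_ring_1 mpoly set \<Rightarrow> 'r::comm_ring_1"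
  assumes I: "ideal I (mpoly_ring V)"
    and R: "\<phi> \<in> ring_iso (mpoly_ring V Quot I) (cring_class_ops :: 'r ring)"
    and \<iota>: "\<forall>c. \<iota> c = \<phi> (I +>\<^bsub>mpoly_ring V\<^esub> Const c)"
    and x: "\<forall>i\<in>V. x i = \<phi> (I +>\<^bsub>mpoly_ring V\<^esub> Var i)"
  shows "unital_hom \<iota>" "\<exists>p\<in>polys V. mpoly_eval \<iota> x p = r"
proof -
  let ?\<psi> = "\<phi> \<circ> (+>\<^bsub>mpoly_ring V\<^esub>) I"
  interpret ideal I "mpoly_ring V" by (rule I)
  have "\<phi> \<in> ring_hom (mpoly_ring V Quot I) (cring_class_ops :: 'r ring)"
    using R by (simp add: ring_iso_def)
  then have "?\<psi> \<in> ring_hom (mpoly_ring V) (cring_class_ops :: 'r ring)"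
    by (rule ring_hom_trans[OF rcos_ring_hom])
  note hom = ring_hom_memE[OF this]
  have \<psi>: "?\<psi> 1 = 1" "\<And>p q. p \<in> polys V \<Longrightarrow> q \<in> polys V \<Longrightarrow> ?\<psi> (p + q) = ?\<psi> p + ?\<psi> q"
    "\<And>p q. p \<in> polys V \<Longrightarrow> q \<in> polys V \<Longrightarrow> ?\<psi> (p * q) = ?\<psi> p * ?\<psi> q"
    using hom(2-4) by (simp_all add: mpoly_ring_def cring_class_ops_def)
  have \<iota>': "\<iota> c = ?\<psi> (Const c)" for c using \<iota> by simp
  have "Const (1 :: 'k) = 1" by (simp add: Const_def)
  then show hom_\<iota>: "unital_hom \<iota>"
    unfolding unital_hom_def \<iota>' using \<psi> Const_in_polys
    by (metis unital_homD(3,4)[OF unital_hom_Const])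
  have eval: "mpoly_eval \<iota> x p = ?\<psi> p" if "p \<in> polys V" for p
    using that
  proof (induction rule: polys_induct)
    case (Const c)
    show ?case by (rule trans[OF mpoly_eval_Const[of \<iota> x c, OF unital_homD(2)[OF hom_\<iota>]] \<iota>'])
  next
    case (Var i)
    then show ?case using x by (simp add: mpoly_eval_Var[OF hom_\<iota>])
  next
    case (add p q)
    then show ?case by (simp only: unital_homD[OF unital_hom_mpoly_eval[OF hom_\<iota>]] \<psi>)
  next
    case (mult p q)
    then show ?case by (simp only: unital_homD[OF unital_hom_mpoly_eval[OF hom_\<iota>]] \<psi>)
  qed
  have "r \<in> \<phi> ` carrier (mpoly_ring V Quot I)"
    using R by (simp add: ring_iso_def bij_betw_def cring_class_ops_def)
  then obtain p where "p \<in> polys V" "r = ?\<psi> p"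
    unfolding FactRing_def A_RCOSETS_def' by auto
  then show "\<exists>p\<in>polys V. mpoly_eval \<iota> x p = r" using eval by auto
qed

lemma subgroup_BijGroup_UNIV:
  fixes G :: "('a \<Rightarrow> 'a) set"
  assumes "subgroup G (BijGroup UNIV)"
  shows "(\<lambda>r. r) \<in> G" "\<sigma> \<in> G \<Longrightarrow> \<tau> \<in> G \<Longrightarrow> (\<lambda>r. \<sigma> (\<tau> r)) \<in> G"
    "\<sigma> \<in> G \<Longrightarrow> \<exists>\<tau>\<in>G. (\<forall>r. \<tau> (\<sigma> r) = r) \<and> (\<forall>r. \<sigma> (\<tau> r) = r)"
proof -
  interpret subgroup G "BijGroup UNIV" by (rule assms)
  interpret group "BijGroup (UNIV :: 'a set)" by (rule group_BijGroup)
  have Bij: "\<sigma> \<in> Bij UNIV" if "\<sigma> \<in> G" for \<sigma>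
    using subset that by (auto simp: BijGroup_def)
  have mult: "\<sigma> \<otimes>\<^bsub>BijGroup UNIV\<^esub> \<tau> = (\<lambda>r. \<sigma> (\<tau> r))" if "\<sigma> \<in> G" "\<tau> \<in> G" for \<sigma> \<tau>
    using Bij[OF that(1)] Bij[OF that(2)] by (simp add: BijGroup_def compose_def restrict_def)
  have one: "\<one>\<^bsub>BijGroup UNIV\<^esub> = (\<lambda>r :: 'a. r)" by (auto simp: BijGroup_def)
  show "(\<lambda>r. r) \<in> G" using subgroup.one_closed[OF assms] one by simp
  show "\<sigma> \<in> G \<Longrightarrow> \<tau> \<in> G \<Longrightarrow> (\<lambda>r. \<sigma> (\<tau> r)) \<in> G" using subgroup.m_closed[OF assms] mult by metis
  show "\<exists>\<tau>\<in>G. (\<forall>r. \<tau> (\<sigma> r) = r) \<and> (\<forall>r. \<sigma> (\<tau> r) = r)" if \<sigma>: "\<sigma> \<in> G"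
  proof (intro bexI conjI allI)
    let ?\<tau> = "inv\<^bsub>BijGroup UNIV\<^esub> \<sigma>"
    show \<tau>: "?\<tau> \<in> G" using \<sigma> by (rule m_inv_closed)
    have "?\<tau> \<otimes>\<^bsub>BijGroup UNIV\<^esub> \<sigma> = (\<lambda>r. r)" "\<sigma> \<otimes>\<^bsub>BijGroup UNIV\<^esub> ?\<tau> = (\<lambda>r. r)"
      using l_inv[OF mem_carrier[OF \<sigma>]] r_inv[OF mem_carrier[OF \<sigma>]] one by simp_all
    then show "?\<tau> (\<sigma> r) = r" "\<sigma> (?\<tau> r) = r" for r
      unfolding mult[OF \<sigma> \<tau>] mult[OF \<tau> \<sigma>] by (simp_all add: fun_eq_iff)
  qed
qed

lemma unital_hom_of_ring_iso:
  assumes "h \<in> ring_iso (cring_class_ops :: 'a::comm_ring_1 ring) (cring_class_ops :: 'b::comm_ring_1 ring)"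
  shows "unital_hom h"
proof -
  have "h \<in> ring_hom (cring_class_ops :: 'a ring) (cring_class_ops :: 'b ring)"
    using assms by (simp add: ring_iso_def)
  from ring_hom_memE(2-4)[OF this] show ?thesis
    by (auto simp: unital_hom_def class_simps)
qed

theorem mainTheorem7:
  fixes algorithmic ::
      "('k::comm_ring_1 list \<times> 'k \<Rightarrow> ('k list \<times> 'k list list) option) \<Rightarrow> bool"
    and n :: nat
    and I :: "'k mpoly set"
    and \<phi> :: "'k mpoly set \<Rightarrow> 'r::idom"
    and \<iota> :: "'k \<Rightarrow> 'r"
    and x :: "nat \<Rightarrow> 'r"
    and G :: "('r \<Rightarrow> 'r) set"
    and ord :: "monomial rel"
  assumes K: "zacharias_ring algorithmic"
    and I_prime: "primeideal I (mpoly_ring {..<n})"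
    and I_K: "range Const \<inter> I = {0}"
    and R: "\<phi> \<in> ring_iso (mpoly_ring {..<n} Quot I) (cring_class_ops :: 'r ring)"
    and \<iota>: "\<forall>c. \<iota> c = \<phi> (I +>\<^bsub>mpoly_ring {..<n}\<^esub> Const c)"
    and x: "\<forall>i<n. x i = \<phi> (I +>\<^bsub>mpoly_ring {..<n}\<^esub> Var i)"
    and G_group: "subgroup G (BijGroup UNIV)"
    and G_finite: "finite G"
    and G_aut: "\<forall>\<sigma>\<in>G. \<sigma> \<in> ring_iso cring_class_ops cring_class_ops \<and> (\<forall>c. \<sigma> (\<iota> c) = \<iota> c)"
    and ord: "monomial_order n ord"
  shows
    "(\<nexists>s. s 0 = Start \<and> (\<forall>i. step n \<iota> x G ord (s i) (s (Suc i)))) \<and>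
     (\<forall>s. (step n \<iota> x G ord)\<^sup>*\<^sup>* Start s \<longrightarrow>
        (\<exists>fs. s = Return fs) \<or> (\<exists>s'. step n \<iota> x G ord s s')) \<and>
     (\<forall>fs. (step n \<iota> x G ord)\<^sup>*\<^sup>* Start (Return fs) \<longrightarrow>
        finite (mpoly_eval \<iota> x ` set fs) \<and>
        subalgebra_generated \<iota> (mpoly_eval \<iota> x ` set fs) = invariants G)"
proof -
  have I: "ideal I (mpoly_ring {..<n})"
    using I_prime by (rule primeideal.axioms(1))
  note eval = quotient_evaluation[OF I R \<iota>, of x]
  interpret invariant_setting n ord \<iota> x G
  proof
    show "monomial_order n ord" by (rule ord)
    show "noetherian (UNIV :: 'k set)"
      using K by (intro noetherian_UNIV_of_noetherian_ring) (simp add: zacharias_ring_def)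
    show "unital_hom \<iota>" "\<exists>p\<in>polys {..<n}. mpoly_eval \<iota> x p = r" for r
      using eval x by auto
    show "unital_hom \<sigma>" if "\<sigma> \<in> G" for \<sigma>
      using G_aut that by (intro unital_hom_of_ring_iso) auto
    show "\<sigma> (\<iota> c) = \<iota> c" if "\<sigma> \<in> G" for \<sigma> c using G_aut that by blast
  qed (use subgroup_BijGroup_UNIV[OF G_group] G_finite in auto)
  show ?thesis
  proof (intro conjI allI impI)
    show "\<nexists>s. s 0 = Start \<and> (\<forall>i. step n \<iota> x G ord (s i) (s (Suc i)))"
      using terminating_no_infinite_run[OF terminating_Start] by blast
    fix s assume "(step n \<iota> x G ord)\<^sup>*\<^sup>* Start s"
    then show "(\<exists>fs. s = Return fs) \<or> (\<exists>s'. step n \<iota> x G ord s s')"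
      by (intro step_progress reachable_safe)
  next
    fix fs assume "(step n \<iota> x G ord)\<^sup>*\<^sup>* Start (Return fs)"
    then have "safe (Return fs)" by (rule reachable_safe)
    then show "subalgebra_generated \<iota> (mpoly_eval \<iota> x ` set fs) = invariants G"
      by (simp add: algebra_of_def)
  qed simp
qed

end
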